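(* Let $R=k[x_1,\ldots,x_n]$ be the standard graded polynomial ring over a field $k$, and let $I$ and $J$ be graded ideals of $R$ with $I\cap J=I\cdot J$. Suppose that $\mathbb{F}_\bullet$ and $\mathbb{G}_\bullet$ are minimal graded free resolutions of $R/I$ and $R/J$ respectively. Then $\mathbb{F}_\bullet\otimes_R\mathbb{G}_\bullet$ is a minimal graded free resolution of $R/(I+J)$. *)

theory Defs
  imports "HOL-Algebra.Algebra" "HOL-Library.Poly_Mapping"
begin

section \<open>Modules: generated submodules, quotients, free modules, tensor products\<close>

definition gen_submodule ::
  "('a, 'r) ring_scheme \<Rightarrow> ('a, 'b, 'm) module_scheme \<Rightarrow> 'b set \<Rightarrow> 'b set" where
  "gen_submodule R M S = \<Inter>{N. submodule N R M \<and> S \<subseteq> N}"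

text \<open>The ring components \<open>mult\<close> and \<open>one\<close> that a module record inherits play no role
  and are left unspecified in the constructions below.\<close>

definition quot_module :: "('a, 'b, 'm) module_scheme \<Rightarrow> 'b set \<Rightarrow> ('a, 'b set) module" where
  "quot_module M N =
    \<lparr>carrier = a_rcosets\<^bsub>M\<^esub> N, monoid.mult = undefined, one = undefined,
     ring.zero = N, ring.add = set_add M,
     smult = (\<lambda>a A. \<Union>x\<in>A. N +>\<^bsub>M\<^esub> (a \<odot>\<^bsub>M\<^esub> x))\<rparr>"

text \<open>The free module on a (possibly infinite) set \<open>S\<close>: finitely supported functions.\<close>

definition free_module :: "('a, 'r) ring_scheme \<Rightarrow> 's set \<Rightarrow> ('a, 's \<Rightarrow> 'a) module" where
  "free_module R S =
    \<lparr>carrier = {f \<in> S \<rightarrow>\<^sub>E carrier R. finite {s \<in> S. f s \<noteq> \<zero>\<^bsub>R\<^esub>}},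
     monoid.mult = undefined, one = undefined,
     ring.zero = (\<lambda>s\<in>S. \<zero>\<^bsub>R\<^esub>), ring.add = (\<lambda>f g. \<lambda>s\<in>S. f s \<oplus>\<^bsub>R\<^esub> g s),
     smult = (\<lambda>a f. \<lambda>s\<in>S. a \<otimes>\<^bsub>R\<^esub> f s)\<rparr>"

definition free_gen :: "('a, 'r) ring_scheme \<Rightarrow> 's set \<Rightarrow> 's \<Rightarrow> 's \<Rightarrow> 'a" where
  "free_gen R S s = (\<lambda>t\<in>S. if t = s then \<one>\<^bsub>R\<^esub> else \<zero>\<^bsub>R\<^esub>)"

abbreviation tensor_free ::
  "('a, 'r) ring_scheme \<Rightarrow> ('a, 'b, 'm) module_scheme \<Rightarrow> ('a, 'c, 'n) module_scheme
    \<Rightarrow> ('a, 'b \<times> 'c \<Rightarrow> 'a) module" where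
  "tensor_free R M N \<equiv> free_module R (carrier M \<times> carrier N)"

abbreviation tensor_gen ::
  "('a, 'r) ring_scheme \<Rightarrow> ('a, 'b, 'm) module_scheme \<Rightarrow> ('a, 'c, 'n) module_scheme
    \<Rightarrow> 'b \<Rightarrow> 'c \<Rightarrow> 'b \<times> 'c \<Rightarrow> 'a" where
  "tensor_gen R M N x y \<equiv> free_gen R (carrier M \<times> carrier N) (x, y)"

inductive_set tensor_rels ::
  "('a, 'r) ring_scheme \<Rightarrow> ('a, 'b, 'm) module_scheme \<Rightarrow> ('a, 'c, 'n) module_scheme
    \<Rightarrow> ('b \<times> 'c \<Rightarrow> 'a) set"
  for R and M and N where
    add_left: "\<lbrakk>x \<in> carrier M; x' \<in> carrier M; y \<in> carrier N\<rbrakk> \<Longrightarrow>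
      tensor_gen R M N (x \<oplus>\<^bsub>M\<^esub> x') y
        \<ominus>\<^bsub>tensor_free R M N\<^esub> (tensor_gen R M N x y \<oplus>\<^bsub>tensor_free R M N\<^esub> tensor_gen R M N x' y)
      \<in> tensor_rels R M N"
  | add_right: "\<lbrakk>x \<in> carrier M; y \<in> carrier N; y' \<in> carrier N\<rbrakk> \<Longrightarrow>
      tensor_gen R M N x (y \<oplus>\<^bsub>N\<^esub> y')
        \<ominus>\<^bsub>tensor_free R M N\<^esub> (tensor_gen R M N x y \<oplus>\<^bsub>tensor_free R M N\<^esub> tensor_gen R M N x y')
      \<in> tensor_rels R M N"
  | smult_left: "\<lbrakk>a \<in> carrier R; x \<in> carrier M; y \<in> carrier N\<rbrakk> \<Longrightarrow>
      tensor_gen R M N (a \<odot>\<^bsub>M\<^esub> x) y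
        \<ominus>\<^bsub>tensor_free R M N\<^esub> (a \<odot>\<^bsub>tensor_free R M N\<^esub> tensor_gen R M N x y)
      \<in> tensor_rels R M N"
  | smult_right: "\<lbrakk>a \<in> carrier R; x \<in> carrier M; y \<in> carrier N\<rbrakk> \<Longrightarrow>
      tensor_gen R M N x (a \<odot>\<^bsub>N\<^esub> y)
        \<ominus>\<^bsub>tensor_free R M N\<^esub> (a \<odot>\<^bsub>tensor_free R M N\<^esub> tensor_gen R M N x y)
      \<in> tensor_rels R M N"

definition tensor_null ::
  "('a, 'r) ring_scheme \<Rightarrow> ('a, 'b, 'm) module_scheme \<Rightarrow> ('a, 'c, 'n) module_scheme
    \<Rightarrow> ('b \<times> 'c \<Rightarrow> 'a) set" where
  "tensor_null R M N = gen_submodule R (tensor_free R M N) (tensor_rels R M N)"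

definition tensor_module ::
  "('a, 'r) ring_scheme \<Rightarrow> ('a, 'b, 'm) module_scheme \<Rightarrow> ('a, 'c, 'n) module_scheme
    \<Rightarrow> ('a, ('b \<times> 'c \<Rightarrow> 'a) set) module" where
  "tensor_module R M N = quot_module (tensor_free R M N) (tensor_null R M N)"

definition pure_tensor ::
  "('a, 'r) ring_scheme \<Rightarrow> ('a, 'b, 'm) module_scheme \<Rightarrow> ('a, 'c, 'n) module_scheme
    \<Rightarrow> 'b \<Rightarrow> 'c \<Rightarrow> ('b \<times> 'c \<Rightarrow> 'a) set" where
  "pure_tensor R M N x y = tensor_null R M N +>\<^bsub>tensor_free R M N\<^esub> tensor_gen R M N x y"

text \<open>The map \<open>M \<otimes> N \<rightarrow> M' \<otimes> N'\<close> induced by linear maps \<open>\<phi>\<close> and \<open>\<psi>\<close>: a coset \<open>A\<close> is sent to the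
  common value on its representatives \<open>f\<close> of the linear extension of
  \<open>(x, y) \<mapsto> \<phi> x \<otimes> \<psi> y\<close>.\<close>

definition tensor_map ::
  "('a, 'r) ring_scheme \<Rightarrow> ('a, 'b, 'm) module_scheme \<Rightarrow> ('a, 'c, 'n) module_scheme
    \<Rightarrow> ('a, 'd, 'p) module_scheme \<Rightarrow> ('a, 'e, 'q) module_scheme
    \<Rightarrow> ('b \<Rightarrow> 'd) \<Rightarrow> ('c \<Rightarrow> 'e) \<Rightarrow> ('b \<times> 'c \<Rightarrow> 'a) set \<Rightarrow> ('d \<times> 'e \<Rightarrow> 'a) set" where
  "tensor_map R M N M' N' \<phi> \<psi> A =
    the_elem ((\<lambda>f. finsum (tensor_module R M' N')
        (\<lambda>(x, y). f (x, y) \<odot>\<^bsub>tensor_module R M' N'\<^esub> pure_tensor R M' N' (\<phi> x) (\<psi> y))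
        {s \<in> carrier M \<times> carrier N. f s \<noteq> \<zero>\<^bsub>R\<^esub>}) ` A)"


section \<open>Graded modules\<close>

record ('a, 'b) graded_module = "('a, 'b) module" +
  part :: "int \<Rightarrow> 'b set"

text \<open>A graded ring is represented as a \<open>graded_module\<close> record that is a module over itself;
  see \<open>mpoly_ring\<close> below.\<close>

definition is_graded_module :: "('a, 'a) graded_module \<Rightarrow> ('a, 'b) graded_module \<Rightarrow> bool" where
  "is_graded_module R M \<longleftrightarrow>
     module R M \<and>
     (\<forall>d. additive_subgroup (part M d) M) \<and>
     (\<forall>d e. \<forall>a\<in>part R d. \<forall>x\<in>part M e. a \<odot>\<^bsub>M\<^esub> x \<in> part M (d + e)) \<and>
     (\<forall>x\<in>carrier M. \<exists>!c. (\<forall>d. c d \<in> part M d) \<and> finite {d. c d \<noteq> \<zero>\<^bsub>M\<^esub>} \<and>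
        x = finsum M c {d. c d \<noteq> \<zero>\<^bsub>M\<^esub>})"

definition graded_hom ::
  "('a, 'a) graded_module \<Rightarrow> ('a, 'b) graded_module \<Rightarrow> ('a, 'c) graded_module
    \<Rightarrow> ('b \<Rightarrow> 'c) \<Rightarrow> bool" where
  "graded_hom R M N h \<longleftrightarrow>
     h \<in> hom (add_monoid M) (add_monoid N) \<and>
     (\<forall>a\<in>carrier R. \<forall>x\<in>carrier M. h (a \<odot>\<^bsub>M\<^esub> x) = a \<odot>\<^bsub>N\<^esub> h x) \<and>
     (\<forall>d. h ` part M d \<subseteq> part N d)"

text \<open>Finitely generated graded free modules: a finite basis of homogeneous elements.\<close>

definition graded_free :: "('a, 'a) graded_module \<Rightarrow> ('a, 'b) graded_module \<Rightarrow> bool" where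
  "graded_free R M \<longleftrightarrow>
     is_graded_module R M \<and>
     (\<exists>B. finite B \<and> B \<subseteq> (\<Union>d. part M d) \<and>
        (\<forall>x\<in>carrier M. \<exists>!c. c \<in> B \<rightarrow>\<^sub>E carrier R \<and> x = finsum M (\<lambda>b. c b \<odot>\<^bsub>M\<^esub> b) B))"

definition graded_ideal :: "('a, 'a) graded_module \<Rightarrow> 'a set \<Rightarrow> bool" where
  "graded_ideal R I \<longleftrightarrow> ideal I R \<and> I = genideal R (I \<inter> (\<Union>d. part R d))"

definition graded_quot ::
  "('a, 'b) graded_module \<Rightarrow> 'b set \<Rightarrow> ('a, 'b set) graded_module" where
  "graded_quot M N = module.extend (quot_module M N)
     (graded_module.fields (\<lambda>d. (\<lambda>x. N +>\<^bsub>M\<^esub> x) ` part M d))"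

definition graded_tensor ::
  "('a, 'a) graded_module \<Rightarrow> ('a, 'b) graded_module \<Rightarrow> ('a, 'c) graded_module
    \<Rightarrow> ('a, ('b \<times> 'c \<Rightarrow> 'a) set) graded_module" where
  "graded_tensor R M N = module.extend (tensor_module R M N)
     (graded_module.fields (\<lambda>d. generate (add_monoid (tensor_module R M N))
        {pure_tensor R M N x y |x y p q. x \<in> part M p \<and> y \<in> part N q \<and> p + q = d}))"

text \<open>The direct sum over a finite index set \<open>A\<close>.\<close>

definition graded_sum ::
  "'i set \<Rightarrow> ('i \<Rightarrow> ('a, 'b) graded_module) \<Rightarrow> ('a, 'i \<Rightarrow> 'b) graded_module" where
  "graded_sum A M =
    \<lparr>carrier = (\<Pi>\<^sub>E i\<in>A. carrier (M i)), monoid.mult = undefined, one = undefined,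
     ring.zero = (\<lambda>i\<in>A. \<zero>\<^bsub>M i\<^esub>), ring.add = (\<lambda>x y. \<lambda>i\<in>A. x i \<oplus>\<^bsub>M i\<^esub> y i),
     smult = (\<lambda>a x. \<lambda>i\<in>A. a \<odot>\<^bsub>M i\<^esub> x i),
     part = (\<lambda>d. \<Pi>\<^sub>E i\<in>A. part (M i) d)\<rparr>"


section \<open>Complexes and resolutions\<close>

text \<open>\<open>cdiff C i\<close> is the differential from \<open>cmod C (Suc i)\<close> to \<open>cmod C i\<close>.\<close>

record ('a, 'b) graded_complex =
  cmod :: "nat \<Rightarrow> ('a, 'b) graded_module"
  cdiff :: "nat \<Rightarrow> 'b \<Rightarrow> 'b"

definition graded_free_resolution ::
  "('a, 'a) graded_module \<Rightarrow> ('a, 'b) graded_complex \<Rightarrow> ('a, 'c) graded_module \<Rightarrow> bool" where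
  "graded_free_resolution R C M \<longleftrightarrow>
     (\<forall>i. graded_free R (cmod C i)) \<and>
     (\<forall>i. graded_hom R (cmod C (Suc i)) (cmod C i) (cdiff C i)) \<and>
     (\<forall>i. cdiff C (Suc i) ` carrier (cmod C (Suc (Suc i)))
        = a_kernel (cmod C (Suc i)) (cmod C i) (cdiff C i)) \<and>
     (\<exists>\<epsilon>. graded_hom R (cmod C 0) M \<epsilon> \<and>
        \<epsilon> ` carrier (cmod C 0) = carrier M \<and>
        cdiff C 0 ` carrier (cmod C (Suc 0)) = a_kernel (cmod C 0) M \<epsilon>)"

text \<open>The component of degree \<open>n\<close> of \<open>C \<otimes> D\<close> is the direct sum of the \<open>C\<^sub>i \<otimes> D\<^sub>n\<^sub>-\<^sub>i\<close> for
  \<open>i \<le> n\<close>, and \<open>\<partial>(x \<otimes> y) = \<partial>x \<otimes> y + (-1)\<^sup>i x \<otimes> \<partial>y\<close> for \<open>x \<in> C\<^sub>i\<close>. Below, the \<open>i\<close>-th entry of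
  \<open>\<partial> t\<close> collects the contributions of \<open>C\<^sub>i\<^sub>+\<^sub>1 \<otimes> D\<^sub>n\<^sub>-\<^sub>i\<close> and \<open>C\<^sub>i \<otimes> D\<^sub>n\<^sub>+\<^sub>1\<^sub>-\<^sub>i\<close>.\<close>

definition tensor_complex ::
  "('a, 'a) graded_module \<Rightarrow> ('a, 'b) graded_complex \<Rightarrow> ('a, 'c) graded_complex
    \<Rightarrow> ('a, nat \<Rightarrow> ('b \<times> 'c \<Rightarrow> 'a) set) graded_complex" where
  "tensor_complex R C D =
    \<lparr>cmod = (\<lambda>n. graded_sum {..n} (\<lambda>i. graded_tensor R (cmod C i) (cmod D (n - i)))),
     cdiff = (\<lambda>n t. \<lambda>i\<in>{..n}.
       let T = graded_tensor R (cmod C i) (cmod D (n - i));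
           u = tensor_map R (cmod C (Suc i)) (cmod D (n - i)) (cmod C i) (cmod D (n - i))
                 (cdiff C i) id (t (Suc i));
           v = tensor_map R (cmod C i) (cmod D (Suc (n - i))) (cmod C i) (cmod D (n - i))
                 id (cdiff D (n - i)) (t i)
       in u \<oplus>\<^bsub>T\<^esub> (if even i then v else \<ominus>\<^bsub>T\<^esub> v))\<rparr>"


section \<open>The standard graded polynomial ring\<close>

type_synonym ('n, 'k) mpoly = "('n \<Rightarrow>\<^sub>0 nat) \<Rightarrow>\<^sub>0 'k"

text \<open>Variables are indexed by the finite type \<open>'n\<close>; an element of \<open>'n \<Rightarrow>\<^sub>0 nat\<close> is the exponent
  vector of a monomial. The record is at the same time the ring and its regular module.\<close>

definition mpoly_ring :: "(('n::finite, 'k::field) mpoly, ('n, 'k) mpoly) graded_module" where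
  "mpoly_ring =
    \<lparr>carrier = UNIV, monoid.mult = (*), one = 1, ring.zero = 0, ring.add = (+), smult = (*),
     part = (\<lambda>d. {p. \<forall>m\<in>Poly_Mapping.keys p.
       int (\<Sum>i\<in>UNIV. Poly_Mapping.lookup m i) = d})\<rparr>"

definition irrelevant_ideal :: "('n::finite, 'k::field) mpoly set" where
  "irrelevant_ideal = genideal mpoly_ring
     (range (\<lambda>i. Poly_Mapping.single (Poly_Mapping.single i 1) 1))"

definition minimal_graded_free_resolution ::
  "(('n::finite, 'k::field) mpoly, 'b) graded_complex
    \<Rightarrow> (('n, 'k) mpoly, 'c) graded_module \<Rightarrow> bool" where
  "minimal_graded_free_resolution C M \<longleftrightarrow>
     graded_free_resolution mpoly_ring C M \<and>
     (\<forall>i. cdiff C i ` carrier (cmod C (Suc i)) \<subseteq>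
        gen_submodule mpoly_ring (cmod C i)
          {a \<odot>\<^bsub>cmod C i\<^esub> x |a x. a \<in> irrelevant_ideal \<and> x \<in> carrier (cmod C i)})"

end

theory Submission
  imports Defs "HOL-Library.Product_Plus"
begin

text \<open>
  The complex \<open>F \<otimes> G\<close> computes \<open>Tor\<close> of \<open>R/I\<close> and \<open>R/J\<close>. Its homology in degree \<open>0\<close> is
  \<open>R/(I + J)\<close>, and \<open>Tor\<^sub>1(R/I, R/J) = (I \<inter> J)/IJ\<close> vanishes by hypothesis (\<open>tor_one\<close>). What remains is
  the rigidity of \<open>Tor\<close> over a polynomial ring: \<open>Tor\<^sub>1 = 0\<close> forces \<open>Tor\<^sub>i = 0\<close> for all \<open>i \<ge> 1\<close>
  (\<open>rigidity\<close>).

  Rigidity is proved by reduction to the diagonal. Let \<open>P = F \<otimes>\<^sub>k R/J\<close>, a complex over \<open>k[x, y]\<close> where \<open>x\<close>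
  acts on the first factor and \<open>y\<close> on the second. It is exact in positive degrees because \<open>k\<close> is a field
  (\<open>exact_mod_empty\<close>), and dividing by the differences \<open>x\<^sub>v - y\<^sub>v\<close>, one after the other, leads to
  \<open>F \<otimes>\<^sub>R R/J\<close>. Each difference \<open>z\<close> is a nonzerodivisor on the quotient \<open>Q\<close> at which it is used, so there
  are exact sequences
  \<open>H\<^sub>i(Q) \<rightarrow> H\<^sub>i(Q) \<rightarrow> H\<^sub>i(Q/zQ) \<rightarrow> H\<^sub>i\<^sub>-\<^sub>1(Q) \<rightarrow> H\<^sub>i\<^sub>-\<^sub>1(Q)\<close>
  whose outer maps are multiplication by \<open>z\<close>. If \<open>H\<^sub>1(Q/zQ) = 0\<close>, then \<open>H\<^sub>1(Q) = z H\<^sub>1(Q)\<close>, hence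
  \<open>H\<^sub>1(Q) = 0\<close> by the graded Nakayama lemma (\<open>exact_mod_down\<close>). Descending from \<open>F \<otimes>\<^sub>R R/J\<close> to \<open>P\<close> this gives
  \<open>H\<^sub>1 = 0\<close> at every stage; climbing back from \<open>P\<close>, the sequences with \<open>i \<ge> 2\<close> carry the vanishing of all
  \<open>H\<^sub>i\<close> along (\<open>exact_mod_up\<close>). All of this is expressed elementwise: "\<open>dx\<close> lies in the ideal, so \<open>x\<close> is a
  boundary modulo the ideal". No quotient modules and no connecting maps have to be formed.

  A staircase argument replaces \<open>R/J\<close> by its resolution \<open>G\<close> (\<open>tensor_exact\<close>). Minimality is visible in
  coordinates, because each nonzero entry of the differential of \<open>F \<otimes> G\<close> is, up to sign, an entry of one of the two
  given differentials.

  These arguments concern matrices over \<open>R\<close>. The link with the module-theoretic statement is the notion of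
  homogeneous coordinates (\<open>graded_coords\<close>): a graded module has them exactly if it is graded free of finite rank, and
  they pass to tensor products and finite direct sums.
\<close>

section \<open>Linear maps between monoid algebras\<close>

abbreviation single where "single \<equiv> Poly_Mapping.single"
abbreviation lookup where "lookup \<equiv> Poly_Mapping.lookup"
abbreviation keys where "keys \<equiv> Poly_Mapping.keys"

text \<open>Every linear map used below is determined by its values on monomials. Two additive maps can then be
  compared on single terms (\<open>additive_eqI\<close>), which replaces most computations with products of
  polynomials.\<close>
definition lin_ext :: "('a \<Rightarrow> 'b \<Rightarrow>\<^sub>0 'k) \<Rightarrow> ('a \<Rightarrow>\<^sub>0 'k::comm_ring_1) \<Rightarrow> 'b::comm_monoid_add \<Rightarrow>\<^sub>0 'k" where
  "lin_ext g p = (\<Sum>m\<in>keys p. single 0 (lookup p m) * g m)"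

lemma lin_ext_superset:
  assumes "finite A" "keys p \<subseteq> A"
  shows "lin_ext g p = (\<Sum>m\<in>A. single 0 (lookup p m) * g m)"
  unfolding lin_ext_def
  by (rule sum.mono_neutral_left) (use assms in \<open>auto simp: in_keys_iff\<close>)

lemma lin_ext_add: "lin_ext g (p + q) = lin_ext g p + lin_ext g q"
proof -
  let ?A = "keys p \<union> keys q"
  have k: "finite ?A" "keys p \<subseteq> ?A" "keys q \<subseteq> ?A" "keys (p + q) \<subseteq> ?A"
    using Poly_Mapping.keys_add[of p q] by auto
  show ?thesis
    unfolding lin_ext_superset[OF k(1,2)] lin_ext_superset[OF k(1,3)] lin_ext_superset[OF k(1,4)]
    by (simp add: lookup_add single_add distrib_right sum.distrib)
qed

lemma lin_ext_single: "lin_ext g (single m c) = single 0 c * g m"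
  by (subst lin_ext_superset[of "{m}"]) (auto simp: lookup_single)

lemma poly_mapping_induct_single [case_names single add]:
  fixes p :: "'a \<Rightarrow>\<^sub>0 'k::comm_monoid_add"
  assumes "\<And>m c. P (single m c)" "\<And>p q. P p \<Longrightarrow> P q \<Longrightarrow> P (p + q)"
  shows "P p"
proof (induct p rule: update_induct)
  case const
  show ?case using assms(1)[of undefined 0] by simp
next
  case (update f a b)
  have "Poly_Mapping.update a b f = single a b + f"
    using update(1) by (auto intro!: poly_mapping_eqI simp: lookup_update lookup_add lookup_single in_keys_iff when_def)
  thus ?case using assms update by metis
qed

lemma additive_eqI:
  fixes f g :: "('a \<Rightarrow>\<^sub>0 'k::comm_monoid_add) \<Rightarrow> 'c::plus"
  assumes "\<And>p q. f (p + q) = f p + f q" "\<And>p q. g (p + q) = g p + g q"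
    and "\<And>m c. f (single m c) = g (single m c)"
  shows "f p = g p"
  by (induct p rule: poly_mapping_induct_single) (simp_all add: assms)

lemma lin_ext_zero [simp]: "lin_ext g 0 = 0"
  by (simp add: lin_ext_def)

lemma lin_ext_uminus: "lin_ext g (- p) = - lin_ext g p"
  by (metis add.right_inverse lin_ext_add lin_ext_zero minus_unique)

lemma lin_ext_diff: "lin_ext g (p - q) = lin_ext g p - lin_ext g q"
  using lin_ext_add[of g p "- q"] by (simp add: lin_ext_uminus)

lemma lin_ext_sum: "lin_ext g (sum f A) = (\<Sum>a\<in>A. lin_ext g (f a))"
  by (induct A rule: infinite_finite_induct) (simp_all add: lin_ext_add)

lemma lin_ext_mult:
  assumes "\<And>m m'. g (m + m') = g m * g m'"
  shows "lin_ext g (p * q) = lin_ext g p * lin_ext g q"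
proof (induct p rule: poly_mapping_induct_single)
  case (single m c)
  show ?case
  proof (induct q rule: poly_mapping_induct_single)
    case (single m' c')
    have "single 0 (c * c') = single 0 c * single (0::'b) c'"
      by (simp add: mult_single)
    thus ?case by (simp only: mult_single lin_ext_single assms ac_simps)
  qed (simp add: distrib_left lin_ext_add)
next
  case (add p q)
  thus ?case by (simp add: distrib_right lin_ext_add)
qed

lemma lin_ext_scale: "lin_ext f (single 0 c * q) = single 0 c * lin_ext f q"
  by (induct q rule: poly_mapping_induct_single)
      (simp_all add: mult_single lin_ext_single distrib_left lin_ext_add mult.assoc[symmetric])

section \<open>Weights and truncation\<close>

definition homog :: "('a \<Rightarrow> int) \<Rightarrow> int \<Rightarrow> ('a \<Rightarrow>\<^sub>0 'k::zero) \<Rightarrow> bool" where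
  "homog w d p \<longleftrightarrow> (\<forall>m\<in>keys p. w m = d)"

text \<open>With \<open>P m\<close> of the form \<open>w m = d\<close> this extracts a homogeneous component; with \<open>w m \<le> D\<close> it truncates.\<close>
definition filt :: "('a \<Rightarrow> bool) \<Rightarrow> ('a \<Rightarrow>\<^sub>0 'k::comm_ring_1) \<Rightarrow> 'a::comm_monoid_add \<Rightarrow>\<^sub>0 'k" where
  "filt P = lin_ext (\<lambda>m. if P m then single m 1 else 0)"

lemma filt_single: "filt P (single m c) = (if P m then single m c else 0)"
  by (simp add: filt_def lin_ext_single mult_single)

lemmas filt_add = lin_ext_add[of "\<lambda>m. if P m then single m 1 else 0" for P, folded filt_def]
lemmas filt_diff = lin_ext_diff[of "\<lambda>m. if P m then single m 1 else 0" for P, folded filt_def]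
lemmas filt_sum = lin_ext_sum[of "\<lambda>m. if P m then single m 1 else 0" for P, folded filt_def]

lemma filt_zero [simp]: "filt P 0 = 0"
  by (simp add: filt_def)

lemma lookup_filt: "lookup (filt P p) m = (if P m then lookup p m else 0)"
  by (induct p rule: poly_mapping_induct_single) (auto simp: filt_add filt_single lookup_add lookup_single when_def)

lemma keys_filt: "keys (filt P p) = {m\<in>keys p. P m}"
  by (auto simp: in_keys_iff lookup_filt split: if_splits)

lemma filt_True: "(\<And>m. m \<in> keys p \<Longrightarrow> P m) \<Longrightarrow> filt P p = p"
  by (rule poly_mapping_eqI) (auto simp: lookup_filt in_keys_iff)

lemma homog_induct [consumes 1, case_names zero single add]:
  fixes p :: "'a \<Rightarrow>\<^sub>0 'k::comm_monoid_add"
  assumes "homog w d p" "P 0" "\<And>m c. w m = d \<Longrightarrow> P (single m c)"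
    "\<And>p q. P p \<Longrightarrow> P q \<Longrightarrow> P (p + q)"
  shows "P p"
  using assms(1)
proof (induct p rule: update_induct)
  case const
  show ?case using assms by simp
next
  case (update f a b)
  have "Poly_Mapping.update a b f = single a b + f"
    using update(1) by (auto intro!: poly_mapping_eqI simp: lookup_update lookup_add lookup_single in_keys_iff when_def)
  moreover have "w a = d" "homog w d f"
    using update(4) update(1,2) by (auto simp: homog_def keys_update)
  ultimately show ?case using assms(3,4) update by metis
qed

lemma homog_zero [simp]: "homog w d 0" by (simp add: homog_def)
lemma homog_add: "homog w d p \<Longrightarrow> homog w d q \<Longrightarrow> homog w d (p + q)"
  unfolding homog_def using Poly_Mapping.keys_add[of p q] by blast
lemma homog_uminus: "homog w d p \<Longrightarrow> homog w d (- p :: 'a \<Rightarrow>\<^sub>0 'k::ab_group_add)"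
  by (simp add: homog_def in_keys_iff)
lemma homog_sum: "(\<And>a. a \<in> A \<Longrightarrow> homog w d (f a)) \<Longrightarrow> homog w d (sum f A)"
  by (induct A rule: infinite_finite_induct) (auto simp: homog_add)
lemma homog_single: "w m = d \<Longrightarrow> homog w d (single m c)"
  by (simp add: homog_def)
lemma homog_filt: "homog w d (filt (\<lambda>m. w m = d) p)"
  by (simp add: homog_def keys_filt)
lemma homog_iff_filt: "homog w d p \<longleftrightarrow> filt (\<lambda>m. w m = d) p = p"
proof
  show "homog w d p \<Longrightarrow> filt (\<lambda>m. w m = d) p = p"
    by (rule filt_True) (simp add: homog_def)
  show "filt (\<lambda>m. w m = d) p = p \<Longrightarrow> homog w d p"
    using homog_filt[of w d p] by simp
qed
lemma homog_mult:
  assumes "\<And>m m'. w (m + m') = w m + w m'" "homog w d p" "homog w e q"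
  shows "homog w (d + e) (p * q)"
  unfolding homog_def
proof
  fix m assume "m \<in> keys (p * q)"
  then obtain a b where "m = a + b" "a \<in> keys p" "b \<in> keys q"
    using Poly_Mapping.keys_mult[of p q] by blast
  thus "w m = d + e" using assms by (simp add: homog_def)
qed

text \<open>Truncation is not multiplicative, but it passes through a homogeneous factor at the price of a shift.
  This makes it commute with the differential of a graded complex.\<close>
lemma filt_mult_homog:
  fixes w :: "'a::comm_monoid_add \<Rightarrow> int"
  assumes w: "\<And>m m'. w (m + m') = w m + w m'" and h: "homog w e h"
  shows "filt (\<lambda>m. w m \<le> D) (s * h) = filt (\<lambda>m. w m \<le> D - e) s * h"
  using h
proof (induct rule: homog_induct)
  case (single m c)
  show ?case
    by (induct s rule: poly_mapping_induct_single)
      (auto simp: filt_single mult_single w single filt_add distrib_right)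
qed (simp_all add: filt_add distrib_left)

section \<open>Polynomials in two sets of variables\<close>

definition mdeg :: "('n::finite \<Rightarrow>\<^sub>0 nat) \<Rightarrow> int" where
  "mdeg m = int (\<Sum>i\<in>UNIV. lookup m i)"

lemma mdeg_add: "mdeg (m + m') = mdeg m + mdeg m'"
  by (simp add: mdeg_def lookup_add sum.distrib)
lemma mdeg_nonneg: "mdeg m \<ge> 0"
  unfolding mdeg_def by (rule of_nat_0_le_iff)

text \<open>A key \<open>(a, b)\<close> stands for the monomial \<open>x\<^sup>a y\<^sup>b\<close>, so this is the ring \<open>k[x, y] = R \<otimes>\<^sub>k R\<close>. With pairs
  as keys the two factors, the diagonal and the partial identifications of \<open>x\<close> with \<open>y\<close> are all induced by
  maps of exponent vectors.\<close>
type_synonym ('n, 'k) mpoly2 = "(('n \<Rightarrow>\<^sub>0 nat) \<times> ('n \<Rightarrow>\<^sub>0 nat)) \<Rightarrow>\<^sub>0 'k"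

definition mdeg2 :: "('n::finite \<Rightarrow>\<^sub>0 nat) \<times> ('n \<Rightarrow>\<^sub>0 nat) \<Rightarrow> int" where
  "mdeg2 m = mdeg (fst m) + mdeg (snd m)"

lemma mdeg2_add: "mdeg2 (m + m') = mdeg2 m + mdeg2 m'"
  by (simp add: mdeg2_def mdeg_add)
lemma mdeg2_nonneg: "mdeg2 m \<ge> 0"
  by (simp add: mdeg2_def mdeg_nonneg)

definition restr :: "'n set \<Rightarrow> ('n::finite \<Rightarrow>\<^sub>0 nat) \<Rightarrow> 'n \<Rightarrow>\<^sub>0 nat" where
  "restr T m = Poly_Mapping.Abs_poly_mapping (\<lambda>v. if v \<in> T then lookup m v else 0)"

lemma lookup_restr: "lookup (restr T m) v = (if v \<in> T then lookup m v else 0)"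
  by (simp add: restr_def)

lemma restr_add: "restr T (m + m') = restr T m + restr T m'"
  by (auto intro!: poly_mapping_eqI simp: lookup_restr lookup_add)
lemma restr_split: "restr (- T) m + restr T m = m"
  by (auto intro!: poly_mapping_eqI simp: lookup_restr lookup_add)
lemma restr_zero [simp]: "restr T 0 = 0"
  by (auto intro!: poly_mapping_eqI simp: lookup_restr)
lemma restr_empty [simp]: "restr {} m = 0" and restr_UNIV [simp]: "restr UNIV m = m"
  by (auto intro!: poly_mapping_eqI simp: lookup_restr)

definition xpoly :: "('n::finite, 'k::field) mpoly \<Rightarrow> ('n, 'k) mpoly2" where
  "xpoly = lin_ext (\<lambda>m. single (m, 0) 1)"
definition ypoly :: "('n::finite, 'k::field) mpoly \<Rightarrow> ('n, 'k) mpoly2" where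
  "ypoly = lin_ext (\<lambda>m. single (0, m) 1)"
definition diag :: "('n::finite, 'k::field) mpoly2 \<Rightarrow> ('n, 'k) mpoly" where
  "diag = lin_ext (\<lambda>m. single (fst m + snd m) 1)"
text \<open>The substitution \<open>x\<^sub>v := y\<^sub>v\<close> for the variables \<open>v \<in> T\<close>; its kernel is the ideal generated by the
  differences \<open>x\<^sub>v - y\<^sub>v\<close> with \<open>v \<in> T\<close>.\<close>
definition ident :: "'n set \<Rightarrow> ('n::finite, 'k::field) mpoly2 \<Rightarrow> ('n, 'k) mpoly2" where
  "ident T = lin_ext (\<lambda>m. single (restr (- T) (fst m), snd m + restr T (fst m)) 1)"
text \<open>The coefficient of \<open>x\<^sup>a\<close>, a polynomial in \<open>y\<close>; for \<open>yslice\<close> the two sets of variables are exchanged.\<close>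
definition xslice :: "('n::finite \<Rightarrow>\<^sub>0 nat) \<Rightarrow> ('n, 'k::field) mpoly2 \<Rightarrow> ('n, 'k) mpoly" where
  "xslice a = lin_ext (\<lambda>m. if fst m = a then single (snd m) 1 else 0)"
definition yslice :: "('n::finite \<Rightarrow>\<^sub>0 nat) \<Rightarrow> ('n, 'k::field) mpoly2 \<Rightarrow> ('n, 'k) mpoly" where
  "yslice a = lin_ext (\<lambda>m. if snd m = a then single (fst m) 1 else 0)"

definition xy :: "'n::finite \<Rightarrow> ('n, 'k::field) mpoly2" where
  "xy v = single (single v 1, 0) 1 - single (0, single v 1) 1"

lemmas map2_defs = xpoly_def ypoly_def diag_def ident_def xslice_def yslice_def

lemma zero_prod_pair: "(0::'a::zero \<times> 'b::zero) = (0, 0)"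
  by (simp add: zero_prod_def)

lemma map2_add:
  "xpoly (p + q) = xpoly p + xpoly q" "ypoly (p + q) = ypoly p + ypoly q" "diag (r + s) = diag r + diag s"
  "ident T (r + s) = ident T r + ident T s" "xslice a (r + s) = xslice a r + xslice a s"
  "yslice a (r + s) = yslice a r + yslice a s"
  by (simp_all add: map2_defs lin_ext_add)

lemma map2_diff:
  "xpoly (p - q) = xpoly p - xpoly q" "ypoly (p - q) = ypoly p - ypoly q" "diag (r - s) = diag r - diag s"
  "ident T (r - s) = ident T r - ident T s" "xslice a (r - s) = xslice a r - xslice a s"
  "yslice a (r - s) = yslice a r - yslice a s"
  by (simp_all add: map2_defs lin_ext_diff)

lemma map2_zero [simp]:
  "xpoly 0 = 0" "ypoly 0 = 0" "diag 0 = 0" "ident T 0 = 0" "xslice a 0 = 0" "yslice a 0 = 0"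
  by (simp_all add: map2_defs)

lemma map2_sum:
  "xpoly (sum f A) = (\<Sum>i\<in>A. xpoly (f i))" "ypoly (sum f A) = (\<Sum>i\<in>A. ypoly (f i))"
  "diag (sum g B) = (\<Sum>i\<in>B. diag (g i))"
  "ident T (sum g B) = (\<Sum>i\<in>B. ident T (g i))" "xslice a (sum g B) = (\<Sum>i\<in>B. xslice a (g i))"
  "yslice a (sum g B) = (\<Sum>i\<in>B. yslice a (g i))"
  by (simp_all add: map2_defs lin_ext_sum)

lemma map2_single:
  "xpoly (single m c) = single (m, 0) c"
  "ypoly (single m c) = single (0, m) c"
  "diag (single (m, m') c) = single (m + m') c"
  "ident T (single (m, m') c) = single (restr (- T) m, m' + restr T m) c"
  "xslice a (single (m, m') c) = (if m = a then single m' c else 0)"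
  "yslice a (single (m, m') c) = (if m' = a then single m c else 0)"
  by (simp_all add: map2_defs lin_ext_single mult_single zero_prod_pair)

lemma map2_mult:
  "xpoly (p * q) = xpoly p * xpoly q" "ypoly (p * q) = ypoly p * ypoly q" "diag (r * s) = diag r * diag s"
  "ident T (r * s) = ident T r * ident T s"
  unfolding map2_defs
  by (rule lin_ext_mult; simp add: mult_single restr_add ac_simps)+

lemma mpoly2_eqI:
  fixes f g :: "('n::finite, 'k::field) mpoly2 \<Rightarrow> 'c::plus"
  assumes "\<And>p q. f (p + q) = f p + f q" "\<And>p q. g (p + q) = g p + g q"
    and "\<And>m m' c. f (single (m, m') c) = g (single (m, m') c)"
  shows "f p = g p"
  by (rule additive_eqI) (use assms in auto)

lemma diag_xpoly: "diag (xpoly p) = p" and diag_ypoly: "diag (ypoly p) = p"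
  by (rule additive_eqI[where p=p]; simp add: map2_add map2_single)+

lemma ident_UNIV: "ident UNIV s = ypoly (diag s)"
  by (rule mpoly2_eqI[where p=s]) (simp_all add: map2_add map2_single ac_simps)
lemma ident_empty [simp]: "ident {} s = s"
  by (rule mpoly2_eqI[where p=s]) (simp_all add: map2_add map2_single)

lemma ident_ident: "ident T (ident U s) = ident (T \<union> U) s"
proof (rule mpoly2_eqI[where p=s])
  fix m m' :: "'a \<Rightarrow>\<^sub>0 nat" and c :: 'b
  have "restr (- T) (restr (- U) m) = restr (- (T \<union> U)) m"
    "restr U m + restr T (restr (- U) m) = restr (T \<union> U) m"
    by (auto intro!: poly_mapping_eqI simp: lookup_restr lookup_add)
  thus "ident T (ident U (single (m, m') c)) = ident (T \<union> U) (single (m, m') c)"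
    by (simp add: map2_single add.assoc)
qed (simp_all add: map2_add)

lemma restr_single: "restr T (single v k) = (if v \<in> T then single v k else 0)"
  by (auto intro!: poly_mapping_eqI simp: lookup_restr lookup_single when_def)

lemma ident_xy: "v \<notin> T \<Longrightarrow> ident T (xy v) = xy v" "v \<in> T \<Longrightarrow> ident T (xy v) = 0"
  by (simp_all add: xy_def map2_diff map2_single restr_single)

text \<open>On a monomial this is the divisibility of \<open>x\<^sub>v\<^sup>k - y\<^sub>v\<^sup>k\<close> by \<open>x\<^sub>v - y\<^sub>v\<close>.\<close>
lemma xy_dvd: "xy v dvd s - ident {v} s"
proof (induct s rule: poly_mapping_induct_single)
  case (single a c)
  obtain m m' where a: "a = (m, m')" by (cases a)
  define k where "k = lookup m v"
  define px :: "('a, 'b) mpoly2" where "px = single (single v 1, 0) 1"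
  define py :: "('a, 'b) mpoly2" where "py = single (0, single v 1) 1"
  have pw: "px ^ j = single (single v j, 0) 1"
     "py ^ j = single (0, single v j) 1" for j
    by (induct j) (simp_all add: px_def py_def mult_single flip: single_add zero_prod_pair)
  have r: "restr {v} m = single v k"
    by (auto intro!: poly_mapping_eqI simp: lookup_restr lookup_single when_def k_def)
  have "single a c = single (restr (- {v}) m, m') c * px ^ k"
    unfolding pw using restr_split[of "{v}" m] by (simp add: mult_single a r)
  moreover have "ident {v} (single a c) = single (restr (- {v}) m, m') c * py ^ k"
    unfolding pw by (simp add: mult_single a r map2_single)
  moreover have "px - py dvd px ^ k - py ^ k"
    by (simp add: power_diff_sumr2)
  moreover have "xy v = px - py"
    by (simp add: xy_def px_def py_def)
  ultimately show ?case
    by (simp flip: right_diff_distrib)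
next
  case (add p q)
  have "p + q - ident {v} (p + q) = (p - ident {v} p) + (q - ident {v} q)"
    by (simp add: map2_add)
  thus ?case using add by (simp only: dvd_add)
qed

lemma lookup_slice:
  "lookup (xslice a s) b = lookup s (a, b)"
  "lookup (yslice b s) a = lookup s (a, b)"
  by (induct s rule: poly_mapping_induct_single)
    (auto simp: map2_add lookup_add map2_single lookup_single when_def split_paired_all split: prod.splits)

lemma lookup_mult_xpoly:
  "lookup (single (a, 0) 1 * ypoly p) (a', b) = (lookup p b when a = a')"
  "lookup (single (0, a) 1 * xpoly p) (b, a') = (lookup p b when a = a')"
  by (induct p rule: poly_mapping_induct_single)
    (auto simp: map2_add distrib_left lookup_add map2_single mult_single lookup_single when_def)

lemma xslice_expansion:
  fixes s :: "('n::finite, 'k::field) mpoly2"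
  shows "s = (\<Sum>a\<in>fst ` keys s. single (a, 0) 1 * ypoly (xslice a s))"
proof (rule poly_mapping_eqI)
  fix m :: "('n \<Rightarrow>\<^sub>0 nat) \<times> ('n \<Rightarrow>\<^sub>0 nat)"
  obtain a b where m: "m = (a, b)" by (cases m)
  show "lookup s m = lookup (\<Sum>a\<in>fst ` keys s.
      single (a, 0) 1 * ypoly (xslice a s)) m"
    by (auto simp: m lookup_sum lookup_mult_xpoly lookup_slice when_def image_iff) (metis fst_conv in_keys_iff)
qed

lemma yslice_expansion:
  fixes s :: "('n::finite, 'k::field) mpoly2"
  shows "s = (\<Sum>a\<in>snd ` keys s. single (0, a) 1 * xpoly (yslice a s))"
proof (rule poly_mapping_eqI)
  fix m :: "('n \<Rightarrow>\<^sub>0 nat) \<times> ('n \<Rightarrow>\<^sub>0 nat)"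
  obtain a b where m: "m = (b, a)" by (cases m)
  show "lookup s m = lookup (\<Sum>a\<in>snd ` keys s.
      single (0, a) 1 * xpoly (yslice a s)) m"
    by (auto simp: m lookup_sum lookup_mult_xpoly lookup_slice when_def image_iff) (metis snd_conv in_keys_iff)
qed

section \<open>Ideals extended to the second set of variables\<close>

definition ideal_set :: "'a::comm_ring_1 set \<Rightarrow> bool" where
  "ideal_set J \<longleftrightarrow> 0 \<in> J \<and> (\<forall>a\<in>J. \<forall>b\<in>J. a + b \<in> J) \<and> (\<forall>a\<in>J. \<forall>r. r * a \<in> J)"

lemma ideal_setD:
  assumes "ideal_set J"
  shows "0 \<in> J" "a \<in> J \<Longrightarrow> b \<in> J \<Longrightarrow> a + b \<in> J" "a \<in> J \<Longrightarrow> r * a \<in> J" "a \<in> J \<Longrightarrow> a * r \<in> J"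
    "a \<in> J \<Longrightarrow> - a \<in> J" "a \<in> J \<Longrightarrow> b \<in> J \<Longrightarrow> a - b \<in> J"
proof -
  show *: "0 \<in> J" "a \<in> J \<Longrightarrow> b \<in> J \<Longrightarrow> a + b \<in> J" "\<And>r. a \<in> J \<Longrightarrow> r * a \<in> J" for a b
    using assms by (auto simp: ideal_set_def)
  show "a \<in> J \<Longrightarrow> a * r \<in> J" by (metis *(3) mult.commute)
  show neg: "a \<in> J \<Longrightarrow> - a \<in> J" for a
    using *(3)[of a "-1"] by simp
  show "a \<in> J \<Longrightarrow> b \<in> J \<Longrightarrow> a - b \<in> J" using *(2)[of a "- b"] neg[of b] by simp
qed

lemma ideal_set_sum: "ideal_set J \<Longrightarrow> (\<And>a. a \<in> A \<Longrightarrow> f a \<in> J) \<Longrightarrow> sum f A \<in> J"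
  by (induct A rule: infinite_finite_induct) (auto simp: ideal_setD)

text \<open>This is \<open>R \<otimes>\<^sub>k J\<close>: the ideal of \<open>k[x, y]\<close> generated by \<open>J\<close> in the variables \<open>y\<close>.\<close>
definition ext_ideal :: "('n::finite, 'k::field) mpoly set \<Rightarrow> ('n, 'k) mpoly2 set" where
  "ext_ideal J = {s. \<forall>a. xslice a s \<in> J}"

lemma xslice_mult_single:
  "xslice (a + b) (single (a, a') c * s) = single a' c * xslice b s"
  by (rule mpoly2_eqI[where p=s]) (simp_all add: distrib_left map2_add map2_single mult_single)

lemma xslice_mult_single_0:
  assumes "\<And>b. e \<noteq> a + b"
  shows "xslice e (single (a, a') c * s) = 0"
  by (rule mpoly2_eqI[where p=s and g = "\<lambda>_. 0"])
    (use assms in \<open>auto simp: distrib_left map2_add map2_single mult_single\<close>)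

lemma ext_ideal:
  assumes J: "ideal_set J"
  shows "ideal_set (ext_ideal J)"
proof -
  have "r * s \<in> ext_ideal J" if "s \<in> ext_ideal J" for r s
  proof (induct r rule: poly_mapping_induct_single)
    case (single m c)
    obtain a a' where m: "m = (a, a')" by (cases m)
    have "xslice e (single (a, a') c * s) \<in> J" for e
    proof (cases "\<exists>b. e = a + b")
      case True
      then obtain b where "e = a + b" by blast
      thus ?thesis using that J by (simp add: xslice_mult_single ext_ideal_def ideal_setD)
    next
      case False
      thus ?thesis using J by (simp add: xslice_mult_single_0 ideal_setD)
    qed
    thus ?case by (simp add: m ext_ideal_def)
  next
    case (add p q)
    thus ?case using J by (simp add: ext_ideal_def distrib_right map2_add ideal_setD)
  qed
  thus ?thesis using J by (auto simp: ideal_set_def ext_ideal_def map2_add)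
qed

lemma xslice_eq_0_outside: "a \<notin> fst ` keys s \<Longrightarrow> xslice a s = 0"
  unfolding xslice_def lin_ext_def by (rule sum.neutral) (auto simp: image_iff Bex_def)

text \<open>Modulo \<open>R \<otimes> J\<close> the equation \<open>(x\<^sub>v - y\<^sub>v) s = 0\<close> says that each coefficient of \<open>s\<close> is \<open>y\<^sub>v\<close> times the
  coefficient one step higher in \<open>x\<^sub>v\<close>. Coefficients of sufficiently high degree vanish, hence all do.\<close>
lemma xy_regular:
  assumes J: "ideal_set J" and s: "xy v * s \<in> ext_ideal J"
  shows "s \<in> ext_ideal J"
  unfolding ext_ideal_def
proof (safe)
  fix a
  let ?e = "single v 1 :: 'a \<Rightarrow>\<^sub>0 nat"
  have step: "xslice b s \<in> J" if "xslice (b + ?e) s \<in> J" for b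
  proof -
    have "xslice (b + ?e) (xy v * s) = xslice b s - single ?e 1 * xslice (b + ?e) s"
      using xslice_mult_single[of ?e b 0 1 s] xslice_mult_single[of 0 "b + ?e" ?e 1 s]
      by (simp add: xy_def left_diff_distrib map2_diff add.commute)
    hence "xslice b s = xslice (b + ?e) (xy v * s) + single ?e 1 * xslice (b + ?e) s"
      by simp
    moreover have "xslice (b + ?e) (xy v * s) \<in> J" using s by (simp add: ext_ideal_def)
    ultimately show ?thesis using that J by (simp add: ideal_setD)
  qed
  have down: "xslice (a + single v k) s \<in> J \<Longrightarrow> xslice a s \<in> J" for k
  proof (induct k)
    case (Suc k)
    have "a + single v (Suc k) = (a + single v k) + ?e"
      by (simp add: single_add[symmetric] add.assoc)
    thus ?case using step[of "a + single v k"] Suc by simp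
  qed simp
  let ?K = "fst ` keys s"
  have "inj (\<lambda>k. a + single v k)"
    by (auto simp: inj_def dest: injD[OF inj_single[of v]])
  hence "infinite (range (\<lambda>k. a + single v k))"
    by (simp add: range_inj_infinite)
  hence "\<not> range (\<lambda>k. a + single v k) \<subseteq> ?K"
    using finite_subset[OF _ finite_imageI[OF finite_keys]] by blast
  then obtain k where "a + single v k \<notin> ?K" by blast
  thus "xslice a s \<in> J"
    using down[of k] xslice_eq_0_outside ideal_setD(1)[OF J] by metis
qed

lemma ypoly_ext_ideal: "ideal_set J \<Longrightarrow> ypoly p \<in> ext_ideal J \<longleftrightarrow> p \<in> J"
proof -
  have "xslice a (ypoly p) = (if a = 0 then p else 0)" for a
    by (rule additive_eqI[where p=p]) (auto simp: map2_add map2_single)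
  thus "ideal_set J \<Longrightarrow> ?thesis" by (auto simp: ext_ideal_def ideal_setD)
qed

text \<open>The preimage under the substitution is the ideal generated by \<open>R \<otimes> J\<close> and the \<open>x\<^sub>v - y\<^sub>v\<close> with
  \<open>v \<in> T\<close>. It interpolates between \<open>R \<otimes> J\<close> for \<open>T = {}\<close> and the preimage of \<open>J\<close> under the diagonal map for
  \<open>T = UNIV\<close>. Defined as a preimage, membership can be tested without finding generators.\<close>
definition ident_ideal :: "'n set \<Rightarrow> ('n::finite, 'k::field) mpoly set \<Rightarrow> ('n, 'k) mpoly2 set" where
  "ident_ideal T J = {s. ident T s \<in> ext_ideal J}"

lemma ideal_set_ident: "ideal_set J \<Longrightarrow> ideal_set (ident_ideal T J)"
  using ext_ideal[of J] by (auto simp: ideal_set_def ident_ideal_def map2_add map2_mult)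

lemma ident_ideal_UNIV: "ideal_set J \<Longrightarrow> s \<in> ident_ideal UNIV J \<longleftrightarrow> diag s \<in> J"
  by (simp add: ident_ideal_def ident_UNIV ypoly_ext_ideal)

text \<open>Expanding \<open>s\<close> by powers of \<open>x\<close> writes its image as a combination of the coefficients of \<open>s\<close>, which
  the substitution does not change.\<close>
lemma ext_ideal_ident:
  assumes J: "ideal_set J" and s: "s \<in> ext_ideal J"
  shows "ident T s \<in> ext_ideal J"
proof -
  have y: "ident T (ypoly p) = ypoly p" for p
    by (rule additive_eqI[where p=p]) (simp_all add: map2_add map2_single)
  have "ident T s = (\<Sum>a\<in>fst ` keys s.
      ident T (single (a, 0) 1) * ypoly (xslice a s))"
    by (subst xslice_expansion) (simp add: map2_sum map2_mult y)
  also have "\<dots> \<in> ext_ideal J"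
  proof (intro ideal_set_sum ideal_setD(3) ext_ideal J)
    show "ypoly (xslice a s) \<in> ext_ideal J" for a
      using s by (simp add: ypoly_ext_ideal[OF J], simp add: ext_ideal_def)
  qed
  finally show ?thesis .
qed

text \<open>The last two parts say that \<open>x\<^sub>v - y\<^sub>v\<close> together with the ideal for \<open>T\<close> generates the ideal for
  \<open>T \<union> {v}\<close>, and that it is a nonzerodivisor modulo the ideal for \<open>T\<close>. They are what the exact sequences of the
  rigidity proof use.\<close>
lemma ident_ideal_insert:
  assumes J: "ideal_set J"
  shows "ident_ideal T J \<subseteq> ident_ideal (insert v T) J" "xy v * s \<in> ident_ideal (insert v T) J"
    and "w \<in> ident_ideal (insert v T) J \<Longrightarrow> \<exists>u. w - xy v * u \<in> ident_ideal T J"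
    and "v \<notin> T \<Longrightarrow> xy v * s \<in> ident_ideal T J \<Longrightarrow> s \<in> ident_ideal T J"
proof -
  have "ident (insert v T) s = ident {v} (ident T s)" for s :: "('a, 'b) mpoly2" by (simp add: ident_ident)
  thus "ident_ideal T J \<subseteq> ident_ideal (insert v T) J"
    using ext_ideal_ident[OF J] by (auto simp: ident_ideal_def)
  show "xy v * s \<in> ident_ideal (insert v T) J"
    using ext_ideal[OF J] by (simp add: ident_ideal_def map2_mult ident_xy ideal_setD)
  show "\<exists>u. w - xy v * u \<in> ident_ideal T J" if "w \<in> ident_ideal (insert v T) J"
  proof -
    obtain u where "w - ident {v} w = xy v * u" using xy_dvd by (auto simp: dvd_def)
    hence "w - xy v * u = ident {v} w" by (simp add: algebra_simps)
    thus ?thesis using that by (intro exI[of _ u]) (simp add: ident_ideal_def ident_ident)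
  qed
  show "v \<notin> T \<Longrightarrow> xy v * s \<in> ident_ideal T J \<Longrightarrow> s \<in> ident_ideal T J"
    using xy_regular[OF J] by (auto simp: ident_ideal_def map2_mult ident_xy)
qed

section \<open>Truncation by degree\<close>

text \<open>Closure under truncation amounts to closure under taking homogeneous components, and is the form in
  which the Nakayama argument needs it.\<close>
definition graded_set :: "('n::finite, 'k::field) mpoly set \<Rightarrow> bool" where
  "graded_set J \<longleftrightarrow> (\<forall>p\<in>J. \<forall>D. filt (\<lambda>m. mdeg m \<le> D) p \<in> J)"

abbreviation trunc2 :: "int \<Rightarrow> ('n::finite, 'k::field) mpoly2 \<Rightarrow> ('n, 'k) mpoly2" where
  "trunc2 D \<equiv> filt (\<lambda>m. mdeg2 m \<le> D)"

lemma xslice_trunc2: "xslice a (trunc2 D s) = filt (\<lambda>m. mdeg m \<le> D - mdeg a) (xslice a s)"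
  by (rule poly_mapping_eqI) (auto simp: lookup_slice lookup_filt mdeg2_def)

lemma ident_trunc2: "ident T (trunc2 D s) = trunc2 D (ident T s)"
proof (rule mpoly2_eqI[where p=s])
  fix m m' c
  have "mdeg2 (restr (- T) m, m' + restr T m) = mdeg2 (m, m')"
    using mdeg_add[of "restr (- T) m" "restr T m"] by (simp add: mdeg2_def mdeg_add restr_split)
  thus "ident T (trunc2 D (single (m, m') c)) = trunc2 D (ident T (single (m, m') c))"
    by (simp add: map2_single filt_single)
qed (simp_all add: filt_add map2_add)

lemma trunc2_ident_ideal: "graded_set J \<Longrightarrow> s \<in> ident_ideal T J \<Longrightarrow> trunc2 D s \<in> ident_ideal T J"
  by (simp add: ident_ideal_def ident_trunc2 ext_ideal_def xslice_trunc2 graded_set_def)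

lemma homog_xpoly:
  assumes "homog mdeg e h"
  shows "homog mdeg2 e (xpoly h)"
  using assms
  by (induct rule: homog_induct)
    (auto simp: map2_add map2_single mdeg2_def mdeg_def intro!: homog_add homog_single)

lemma homog_xy: "homog mdeg2 1 (xy v)"
  unfolding xy_def diff_conv_add_uminus
  by (intro homog_add homog_uminus homog_single) (simp_all add: mdeg2_def mdeg_def lookup_single when_def)

lemma trunc2_xpoly: "homog mdeg e h \<Longrightarrow> trunc2 D (s * xpoly h) = trunc2 (D - e) s * xpoly h"
  by (rule filt_mult_homog[OF mdeg2_add homog_xpoly])

lemma trunc2_xy: "trunc2 D (xy v * s) = xy v * trunc2 (D - 1) s"
  using filt_mult_homog[OF mdeg2_add homog_xy, of D s] by (simp add: mult.commute)

lemma trunc2_neg: "D < 0 \<Longrightarrow> trunc2 D s = 0"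
proof (rule poly_mapping_eqI)
  show "D < 0 \<Longrightarrow> lookup (trunc2 D s) m = lookup 0 m" for m
    using mdeg2_nonneg[of m] by (simp add: lookup_filt)
qed

text \<open>Together with \<open>trunc2_neg\<close> this makes induction on the truncation degree possible.\<close>
lemma trunc2_large: "\<exists>D0. \<forall>D\<ge>D0. trunc2 D s = s"
proof (intro exI allI impI filt_True)
  fix D m assume D: "Max (mdeg2 ` keys s) \<le> D" and m: "m \<in> keys s"
  show "mdeg2 m \<le> D" using m by (intro order.trans[OF Max_ge D]) auto
qed

section \<open>Linear projections with a given ideal as kernel\<close>

text \<open>A basis of the vector space \<open>J\<close> is extended to one of \<open>R\<close>; the projection kills the former and fixes the
  added vectors. It identifies \<open>R/J\<close> with a subspace of \<open>R\<close>, and so avoids quotients when exactness of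
  \<open>F \<otimes>\<^sub>k R/J\<close> is proved.\<close>
lemma ideal_projection:
  fixes J :: "('n::finite, 'k::field) mpoly set"
  assumes J: "ideal_set J"
  obtains \<pi> where "\<And>p q. \<pi> (p + q) = \<pi> p + \<pi> q"
    "\<And>c p. \<pi> (single 0 c * p) = single 0 c * \<pi> p"
    "\<And>p. p - \<pi> p \<in> J" "\<And>p. p \<in> J \<Longrightarrow> \<pi> p = 0"
proof -
  define sc :: "'k \<Rightarrow> ('n, 'k) mpoly \<Rightarrow> ('n, 'k) mpoly" where "sc = (\<lambda>c p. single 0 c * p)"
  interpret vs: vector_space sc
    by unfold_locales (simp_all add: sc_def distrib_left distrib_right single_add mult_single mult.assoc[symmetric])
  interpret pr: vector_space_pair sc sc ..
  have Jsub: "vs.subspace J"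
    unfolding vs.subspace_def using J by (simp add: ideal_setD sc_def)
  obtain B where B: "B \<subseteq> J" "vs.independent B" "J \<subseteq> vs.span B"
    using vs.basis_exists[of J] by metis
  define E where "E = vs.extend_basis B"
  have E: "vs.independent E" "vs.span E = UNIV" "B \<subseteq> E"
    using B(2) unfolding E_def
    by (simp_all add: vs.independent_extend_basis vs.span_extend_basis vs.extend_basis_superset)
  define \<pi> where "\<pi> = pr.construct E (\<lambda>b. if b \<in> B then 0 else b)"
  have lin: "Vector_Spaces.linear sc sc \<pi>" unfolding \<pi>_def by (rule pr.linear_construct[OF E(1)])
  interpret l: Vector_Spaces.linear sc sc \<pi> by (rule lin)
  have b: "\<pi> b = (if b \<in> B then 0 else b)" if "b \<in> E" for b
    using that by (simp add: \<pi>_def pr.construct_basis[OF E(1)])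
  have z: "\<pi> p = 0" if "p \<in> J" for p
  proof (rule pr.linear_eq_0_on_span[OF lin, of B])
    show "\<pi> b = 0" if "b \<in> B" for b using b[of b] that E(3) by auto
    show "p \<in> vs.span B" using that B(3) by blast
  qed
  have "p \<in> vs.span E \<Longrightarrow> p - \<pi> p \<in> J" for p
  proof (induct p rule: vs.span_induct)
    case base
    show ?case
    proof (rule vs.subspaceI; unfold mem_Collect_eq)
      show "0 - \<pi> 0 \<in> J" using J by (simp add: l.zero ideal_setD)
    next
      fix x y assume "x - \<pi> x \<in> J" "y - \<pi> y \<in> J"
      hence "(x - \<pi> x) + (y - \<pi> y) \<in> J" by (rule ideal_setD(2)[OF J])
      thus "(x + y) - \<pi> (x + y) \<in> J" by (simp add: l.add algebra_simps)
    next
      fix c x assume "x - \<pi> x \<in> J"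
      hence "single 0 c * (x - \<pi> x) \<in> J" by (rule ideal_setD(3)[OF J])
      thus "sc c x - \<pi> (sc c x) \<in> J" unfolding l.scale by (simp add: sc_def right_diff_distrib)
    qed
  next
    case (step x)
    show ?case
    proof (cases "x \<in> B")
      case True
      thus ?thesis using B(1) b[OF step] by auto
    next
      case False
      thus ?thesis using J b[OF step] by (simp add: ideal_setD)
    qed
  qed
  hence "p - \<pi> p \<in> J" for p using E(2) by blast
  thus thesis
    using that[of \<pi>] z l.add l.scale unfolding sc_def by blast
qed

text \<open>The map \<open>id \<otimes> \<pi>\<close> on \<open>R \<otimes>\<^sub>k R\<close>.\<close>
definition yproj :: "(('n::finite, 'k::field) mpoly \<Rightarrow> ('n, 'k) mpoly) \<Rightarrow> ('n, 'k) mpoly2 \<Rightarrow> ('n, 'k) mpoly2" where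
  "yproj \<pi> = lin_ext (\<lambda>m. single (fst m, 0) 1 * ypoly (\<pi> (single (snd m) 1)))"

lemma yproj_add: "yproj \<pi> (r + s) = yproj \<pi> r + yproj \<pi> s"
  by (simp add: yproj_def lin_ext_add)

lemma yproj_sum: "yproj \<pi> (sum f A) = (\<Sum>a\<in>A. yproj \<pi> (f a))"
  by (simp add: yproj_def lin_ext_sum)

lemma yproj_xpoly: "yproj \<pi> (s * xpoly h) = yproj \<pi> s * xpoly h"
proof (induct h rule: poly_mapping_induct_single)
  case (single e c')
  show ?case
  proof (rule mpoly2_eqI[where p=s])
    fix m m' :: "'a \<Rightarrow>\<^sub>0 nat" and c :: 'b
    have y: "yproj \<pi> (single (m, m') c) = single (m, 0) c * ypoly (\<pi> (single m' 1))"
      for m m' :: "'a \<Rightarrow>\<^sub>0 nat" and c :: 'b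
      by (simp add: yproj_def lin_ext_single mult_single flip: mult.assoc)
    have s: "single (m + e, 0) (c * c') = single (m, 0 :: 'a \<Rightarrow>\<^sub>0 nat) c * single (e, 0) c'"
      by (simp add: mult_single)
    have e: "single (m, m') c * single (e, 0) c' = single (m + e, m') (c * c')"
      by (simp add: mult_single)
    show "yproj \<pi> (single (m, m') c * xpoly (single e c')) =
        yproj \<pi> (single (m, m') c) * xpoly (single e c')"
      unfolding map2_single e y s by (simp only: ac_simps)
  qed (simp_all add: yproj_add distrib_right)
qed (simp add: yproj_add map2_add distrib_left)

lemma xslice_yproj:
  assumes "\<And>p q. \<pi> (p + q) = \<pi> p + \<pi> q"
    and sc: "\<And>c p. \<pi> (single 0 c * p) = single 0 c * \<pi> p"
  shows "xslice a (yproj \<pi> s) = \<pi> (xslice a s)"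
proof (rule mpoly2_eqI[where p=s])
  fix m m' c
  have 1: "xslice a (single (m, 0) 1 * ypoly p) = (if m = a then p else 0)" for p :: "('a, 'b) mpoly"
    by (rule poly_mapping_eqI) (simp add: lookup_slice lookup_mult_xpoly)
  have 2: "xslice a (single 0 c * t) = single 0 c * xslice a t" for t :: "('a, 'b) mpoly2"
    unfolding xslice_def by (rule lin_ext_scale)
  have "\<pi> 0 = 0" using sc[of 0 0] by simp
  moreover have "\<pi> (single m' c) = single 0 c * \<pi> (single m' 1)"
    using sc[of c "single m' 1"] by (simp add: mult_single)
  ultimately show "xslice a (yproj \<pi> (single (m, m') c)) = \<pi> (xslice a (single (m, m') c))"
    by (simp add: yproj_def lin_ext_single 1 2 map2_single)
qed (simp_all add: yproj_add map2_add assms(1))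

section \<open>Complexes given by matrices\<close>

text \<open>A complex of graded free modules with bases \<open>B i\<close>, whose elements have degrees \<open>dg i\<close>, exact except at
  the end. The entry \<open>A i b' b\<close> is the coefficient of \<open>b\<close> in the image of \<open>b'\<close>. Elements of the module in
  degree \<open>i\<close> are functions of which only the values on \<open>B i\<close> matter.\<close>
locale matrix_complex =
  fixes B :: "nat \<Rightarrow> 'x set" and A :: "nat \<Rightarrow> 'x \<Rightarrow> 'x \<Rightarrow> ('n::finite, 'k::field) mpoly"
    and dg :: "nat \<Rightarrow> 'x \<Rightarrow> int"
  assumes finite_B: "finite (B i)"
    and homog_A: "b' \<in> B (Suc i) \<Longrightarrow> b \<in> B i \<Longrightarrow> homog mdeg (dg (Suc i) b' - dg i b) (A i b' b)"
    and A_A: "b'' \<in> B (Suc (Suc i)) \<Longrightarrow> b \<in> B i \<Longrightarrow> (\<Sum>b'\<in>B (Suc i). A (Suc i) b'' b' * A i b' b) = 0"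
    and exact: "(\<And>b. b \<in> B i \<Longrightarrow> (\<Sum>b'\<in>B (Suc i). x b' * A i b' b) = 0) \<Longrightarrow>
       \<exists>y. \<forall>b\<in>B (Suc i). x b = (\<Sum>b'\<in>B (Suc (Suc i)). y b' * A (Suc i) b' b)"
begin

definition d :: "nat \<Rightarrow> ('x \<Rightarrow> ('n, 'k) mpoly) \<Rightarrow> 'x \<Rightarrow> ('n, 'k) mpoly" where
  "d i x b = (\<Sum>b'\<in>B (Suc i). x b' * A i b' b)"

text \<open>The differential of \<open>F \<otimes>\<^sub>k R\<close>.\<close>
definition d2 :: "nat \<Rightarrow> ('x \<Rightarrow> ('n, 'k) mpoly2) \<Rightarrow> 'x \<Rightarrow> ('n, 'k) mpoly2" where
  "d2 i x b = (\<Sum>b'\<in>B (Suc i). x b' * xpoly (A i b' b))"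

lemma d_add: "d i (\<lambda>b. x b + y b) b = d i x b + d i y b"
  and d_diff: "d i (\<lambda>b. x b - y b) b = d i x b - d i y b"
  and d_mult: "d i (\<lambda>b. r * x b) b = r * d i x b"
  by (simp_all add: d_def distrib_right left_diff_distrib sum.distrib sum_subtractf sum_distrib_left mult.assoc)

lemma d2_add: "d2 i (\<lambda>b. x b + y b) b = d2 i x b + d2 i y b"
  and d2_diff: "d2 i (\<lambda>b. x b - y b) b = d2 i x b - d2 i y b"
  and d2_mult: "d2 i (\<lambda>b. r * x b) b = r * d2 i x b"
  by (simp_all add: d2_def distrib_right left_diff_distrib sum.distrib sum_subtractf sum_distrib_left mult.assoc)

lemma d_cong: "(\<And>b'. b' \<in> B (Suc i) \<Longrightarrow> x b' = y b') \<Longrightarrow> d i x b = d i y b"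
  by (simp add: d_def)

lemma d_d:
  assumes "b \<in> B i" shows "d i (d (Suc i) x) b = 0"
proof -
  have "d i (d (Suc i) x) b = (\<Sum>b'\<in>B (Suc (Suc i)). \<Sum>b''\<in>B (Suc i). x b' * (A (Suc i) b' b'' * A i b'' b))"
    unfolding d_def by (subst sum.swap) (simp add: sum_distrib_right mult.assoc)
  thus ?thesis using A_A assms by (simp add: sum_distrib_left[symmetric])
qed

lemma d2_d2:
  assumes "b \<in> B i" shows "d2 i (d2 (Suc i) x) b = 0"
proof -
  have "d2 i (d2 (Suc i) x) b = (\<Sum>b'\<in>B (Suc (Suc i)). \<Sum>b''\<in>B (Suc i). x b' * xpoly (A (Suc i) b' b'' * A i b'' b))"
    unfolding d2_def by (subst sum.swap) (simp add: sum_distrib_right mult.assoc map2_mult)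
  thus ?thesis using A_A assms by (simp add: sum_distrib_left[symmetric] map2_sum(1)[symmetric])
qed

lemma d2_ideal: "ideal_set K \<Longrightarrow> (\<And>b. b \<in> B (Suc i) \<Longrightarrow> x b \<in> K) \<Longrightarrow> d2 i x b \<in> K"
  unfolding d2_def by (intro ideal_set_sum) (auto simp: ideal_setD)

lemma trunc2_d2:
  assumes b: "b \<in> B i"
  shows "trunc2 (D - dg i b) (d2 i x b) = d2 i (\<lambda>b'. trunc2 (D - dg (Suc i) b') (x b')) b"
  unfolding d2_def filt_sum by (rule sum.cong) (simp_all add: trunc2_xpoly[OF homog_A[OF _ b]])

text \<open>Exactness, in homological degree \<open>i + 1\<close>, of \<open>F \<otimes>\<^sub>k R/J\<close> divided by the \<open>x\<^sub>v - y\<^sub>v\<close> with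
  \<open>v \<in> T\<close>.\<close>
definition exact_mod :: "('n, 'k) mpoly set \<Rightarrow> 'n set \<Rightarrow> nat \<Rightarrow> bool" where
  "exact_mod J T i \<longleftrightarrow> (\<forall>x. (\<forall>b\<in>B i. d2 i x b \<in> ident_ideal T J) \<longrightarrow>
     (\<exists>y. \<forall>b\<in>B (Suc i). x b - d2 (Suc i) y b \<in> ident_ideal T J))"

text \<open>If \<open>dx\<close> vanishes modulo \<open>R \<otimes> J\<close>, then \<open>x' = (id \<otimes> \<pi>) x\<close> is a cycle congruent to \<open>x\<close>. Each coefficient
  of \<open>x'\<close> with respect to \<open>y\<close> is a cycle of \<open>F\<close>, hence a boundary.\<close>
lemma exact_mod_empty:
  assumes J: "ideal_set J"
  shows "exact_mod J {} i"
  unfolding exact_mod_def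
proof (intro allI impI)
  fix x assume x: "\<forall>b\<in>B i. d2 i x b \<in> ident_ideal {} J"
  obtain \<pi> where \<pi>: "\<And>p q. \<pi> (p + q) = \<pi> p + \<pi> q"
    "\<And>c p. \<pi> (single 0 c * p) = single 0 c * \<pi> p"
    "\<And>p. p - \<pi> p \<in> J" "\<And>p. p \<in> J \<Longrightarrow> \<pi> p = 0"
    using ideal_projection[OF J] by blast
  define x' where "x' b = yproj \<pi> (x b)" for b
  have sl: "xslice a (x' b) = \<pi> (xslice a (x b))" for a b
    unfolding x'_def by (rule xslice_yproj[OF \<pi>(1,2)])
  have dx': "d2 i x' b = 0" if "b \<in> B i" for b
  proof -
    have e: "d2 i x' b = yproj \<pi> (d2 i x b)"
      by (simp add: d2_def x'_def yproj_sum yproj_xpoly)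
    have "xslice a (d2 i x' b) = 0" for a
      unfolding e xslice_yproj[OF \<pi>(1,2)] using x that by (intro \<pi>(4)) (simp add: ident_ideal_def ext_ideal_def)
    thus ?thesis by (subst xslice_expansion) simp
  qed
  define Y where "Y = (\<Union>b\<in>B (Suc i). snd ` keys (x' b))"
  have Y: "finite Y" unfolding Y_def using finite_B by simp
  have "\<exists>y. \<forall>b\<in>B (Suc i). yslice a (x' b) = d (Suc i) y b" for a
  proof -
    have "(\<Sum>b'\<in>B (Suc i). yslice a (x' b') * A i b' b) = 0" if "b \<in> B i" for b
    proof -
      have "yslice a (s * xpoly h) = yslice a s * h" for s :: "('n, 'k) mpoly2" and h
      proof (induct h rule: poly_mapping_induct_single)
        case (single m c)
        show ?case by (rule mpoly2_eqI[where p=s]) (auto simp: map2_add distrib_right map2_single mult_single)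
      qed (simp add: map2_add distrib_left)
      hence "(\<Sum>b'\<in>B (Suc i). yslice a (x' b') * A i b' b) = yslice a (d2 i x' b)"
        by (simp add: d2_def map2_sum)
      thus ?thesis using dx'[OF that] by simp
    qed
    thus ?thesis using exact[of i "\<lambda>b. yslice a (x' b)"] by (auto simp: d_def)
  qed
  then obtain y where y: "\<And>a b. b \<in> B (Suc i) \<Longrightarrow> yslice a (x' b) = d (Suc i) (y a) b" by metis
  define z where "z b = (\<Sum>a\<in>Y. single (0, a) 1 * xpoly (y a b))" for b
  have "x b - d2 (Suc i) z b \<in> ident_ideal {} J" if b: "b \<in> B (Suc i)" for b
  proof -
    have "x' b = (\<Sum>a\<in>Y. single (0, a) 1 * xpoly (yslice a (x' b)))"
    proof (subst yslice_expansion[of "x' b"], rule sum.mono_neutral_left[OF Y])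
      show "\<forall>a\<in>Y - snd ` keys (x' b). single (0, a) 1 * xpoly (yslice a (x' b)) = 0"
      proof
        fix a assume a: "a \<in> Y - snd ` keys (x' b)"
        have "yslice a (x' b) = 0"
          by (rule poly_mapping_eqI) (use a in \<open>auto simp: lookup_slice image_iff\<close>, metis snd_conv in_keys_iff)
        thus "single (0, a) 1 * xpoly (yslice a (x' b)) = 0" by simp
      qed
    qed (use b in \<open>auto simp: Y_def\<close>)
    also have "\<dots> = d2 (Suc i) z b"
      by (simp add: y[OF b] d_def d2_def z_def map2_sum map2_mult sum_distrib_left sum_distrib_right mult.assoc)
        (rule sum.swap)
    finally have "x' b = d2 (Suc i) z b" .
    moreover have "x b - x' b \<in> ext_ideal J"
      by (simp add: ext_ideal_def map2_diff sl \<pi>(3))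
    ultimately show ?thesis by (simp add: ident_ideal_def)
  qed
  thus "\<exists>y. \<forall>b\<in>B (Suc i). x b - d2 (Suc i) y b \<in> ident_ideal {} J" by blast
qed

text \<open>The graded Nakayama lemma for \<open>H\<^sub>1\<close>. Given a cycle \<open>x\<close> modulo the ideal for \<open>T\<close>, exactness for
  \<open>T \<union> {v}\<close> gives \<open>x = dy + (x\<^sub>v - y\<^sub>v) u\<close>, and \<open>u\<close> is again a cycle because \<open>x\<^sub>v - y\<^sub>v\<close> is regular. If \<open>x\<close> is
  concentrated in degrees up to \<open>D\<close>, truncation puts \<open>u\<close> in degrees up to \<open>D - 1\<close>, and there are no
  nonzero elements in degrees up to \<open>D0\<close>, which lies below the degrees of all basis elements.\<close>
lemma exact_mod_down:
  assumes J: "ideal_set J" "graded_set J" and v: "v \<notin> T" and ex: "exact_mod J (insert v T) 0"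
  shows "exact_mod J T 0"
proof -
  let ?a = "ident_ideal T J"
  note a = ideal_set_ident[OF J(1), of T]
  obtain D0 where D0: "\<And>b. b \<in> B 1 \<Longrightarrow> D0 < dg 1 b"
  proof
    fix b assume "b \<in> B 1"
    hence "Min (dg 1 ` B 1) \<le> dg 1 b" using finite_B by (intro Min_le) auto
    thus "Min (dg 1 ` B 1) - 1 < dg 1 b" by simp
  qed
  have key: "\<exists>y. \<forall>b\<in>B 1. x b - d2 1 y b \<in> ?a"
    if "\<forall>b\<in>B 0. d2 0 x b \<in> ?a" "\<forall>b\<in>B 1. trunc2 (D0 + int N - dg 1 b) (x b) = x b" for N x
    using that
  proof (induct N arbitrary: x)
    case 0
    have "x b = 0" if "b \<in> B 1" for b
    proof -
      have "D0 + int 0 - dg 1 b < 0" using D0[OF that] by simp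
      thus ?thesis using 0(2) that trunc2_neg by metis
    qed
    thus ?case using a by (intro exI[of _ "\<lambda>_. 0"]) (simp add: d2_def ideal_setD)
  next
    case (Suc N)
    let ?D = "D0 + int (Suc N)"
    have "\<forall>b\<in>B 0. d2 0 x b \<in> ident_ideal (insert v T) J"
      using Suc.prems(1) ident_ideal_insert(1)[OF J(1)] by blast
    then obtain y where y: "\<And>b. b \<in> B 1 \<Longrightarrow> x b - d2 1 y b \<in> ident_ideal (insert v T) J"
      using ex unfolding exact_mod_def One_nat_def by blast
    have "\<forall>b. \<exists>u. b \<in> B 1 \<longrightarrow> x b - d2 1 y b - xy v * u \<in> ?a"
      using ident_ideal_insert(3)[OF J(1)] y by blast
    then obtain u where u: "\<And>b. b \<in> B 1 \<Longrightarrow> x b - d2 1 y b - xy v * u b \<in> ?a" by metis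
    define y' where "y' b = trunc2 (?D - dg 2 b) (y b)" for b
    define u' where "u' b = trunc2 (D0 + int N - dg 1 b) (u b)" for b
    define w where "w b = x b - d2 1 y' b - xy v * u' b" for b
    \<comment> \<open>truncation turns the congruence for \<open>y\<close> and \<open>u\<close> into the same congruence for \<open>y'\<close> and \<open>u'\<close>\<close>
    have w: "w b \<in> ?a" if b: "b \<in> B 1" for b
    proof -
      have "trunc2 (?D - dg 1 b) (d2 1 y b) = d2 1 y' b"
        using trunc2_d2[OF b, of ?D y] by (simp add: y'_def[abs_def] numeral_2_eq_2)
      moreover have "?D - dg 1 b - 1 = D0 + int N - dg 1 b" by simp
      hence "trunc2 (?D - dg 1 b) (xy v * u b) = xy v * u' b" by (simp only: trunc2_xy u'_def)
      moreover have "trunc2 (?D - dg 1 b) (x b) = x b" using Suc.prems(2) b by blast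
      ultimately have "w b = trunc2 (?D - dg 1 b) (x b - d2 1 y b - xy v * u b)"
        by (simp only: w_def filt_diff)
      thus ?thesis using trunc2_ident_ideal[OF J(2) u[OF b]] by simp
    qed
    have "d2 0 u' b \<in> ?a" if b: "b \<in> B 0" for b
    proof (rule ident_ideal_insert(4)[OF J(1) v])
      have "d2 0 w b = d2 0 x b - d2 0 (d2 1 y') b - xy v * d2 0 u' b"
        unfolding w_def by (simp add: d2_diff d2_mult)
      moreover have "d2 0 (d2 1 y') b = 0" using d2_d2[OF b] by simp
      ultimately have "xy v * d2 0 u' b = d2 0 x b - d2 0 w b" by simp
      thus "xy v * d2 0 u' b \<in> ?a"
        using Suc.prems(1) b w a by (simp add: ideal_setD d2_ideal)
    qed
    moreover have "\<forall>b\<in>B 1. trunc2 (D0 + int N - dg 1 b) (u' b) = u' b"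
      unfolding u'_def by (auto intro!: filt_True simp: keys_filt)
    ultimately obtain y2 where y2: "\<forall>b\<in>B 1. u' b - d2 1 y2 b \<in> ?a"
      using Suc.hyps by blast
    have "x b - d2 1 (\<lambda>b. y' b + xy v * y2 b) b \<in> ?a" if b: "b \<in> B 1" for b
    proof -
      have "x b - d2 1 (\<lambda>b. y' b + xy v * y2 b) b = w b + xy v * (u' b - d2 1 y2 b)"
        by (simp add: w_def d2_add d2_mult algebra_simps)
      thus ?thesis using w[OF b] y2 b a by (simp add: ideal_setD)
    qed
    thus ?case by blast
  qed
  show ?thesis
    unfolding exact_mod_def
  proof (intro allI impI)
    fix x assume x: "\<forall>b\<in>B 0. d2 0 x b \<in> ?a"
    have "\<forall>b. \<exists>E. \<forall>D\<ge>E. trunc2 D (x b) = x b" using trunc2_large by blast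
    from choice[OF this] obtain E where E: "\<And>b D. D \<ge> E b \<Longrightarrow> trunc2 D (x b) = x b"
      by blast
    define N where "N = nat (Max (insert 0 ((\<lambda>b. E b + dg 1 b - D0) ` B 1)))"
    have "trunc2 (D0 + int N - dg 1 b) (x b) = x b" if "b \<in> B 1" for b
    proof (rule E)
      have "E b + dg 1 b - D0 \<le> Max (insert 0 ((\<lambda>b. E b + dg 1 b - D0) ` B 1))"
        using that finite_B by (intro Max_ge) auto
      thus "E b \<le> D0 + int N - dg 1 b" by (simp add: N_def)
    qed
    hence "\<forall>b\<in>B 1. trunc2 (D0 + int N - dg 1 b) (x b) = x b" by blast
    from key[OF x this] show "\<exists>y. \<forall>b\<in>B (Suc 0). x b - d2 (Suc 0) y b \<in> ?a"
      by simp
  qed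
qed

text \<open>Write \<open>dx = (x\<^sub>v - y\<^sub>v) u\<close> modulo the ideal for \<open>T\<close>. By regularity \<open>u\<close> is a cycle, hence a
  boundary \<open>dy\<close>; then \<open>x - (x\<^sub>v - y\<^sub>v) y\<close> is a cycle for \<open>T\<close>, hence a boundary.\<close>
lemma exact_mod_up:
  assumes J: "ideal_set J" and v: "v \<notin> T" and ex: "\<And>i. exact_mod J T i"
  shows "exact_mod J (insert v T) (Suc i)"
  unfolding exact_mod_def
proof (intro allI impI)
  let ?a = "ident_ideal T J"
  note a = ideal_set_ident[OF J, of T]
  fix x assume x: "\<forall>b\<in>B (Suc i). d2 (Suc i) x b \<in> ident_ideal (insert v T) J"
  hence "\<forall>b. \<exists>u. b \<in> B (Suc i) \<longrightarrow> d2 (Suc i) x b - xy v * u \<in> ?a"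
    using ident_ideal_insert(3)[OF J] by blast
  then obtain u where u: "\<And>b. b \<in> B (Suc i) \<Longrightarrow> d2 (Suc i) x b - xy v * u b \<in> ?a" by metis
  have "d2 i u b \<in> ?a" if b: "b \<in> B i" for b
  proof (rule ident_ideal_insert(4)[OF J v])
    have "d2 i (\<lambda>b. d2 (Suc i) x b - xy v * u b) b \<in> ?a"
      by (rule d2_ideal[OF a u])
    hence "- (xy v * d2 i u b) \<in> ?a" by (simp add: d2_diff d2_mult d2_d2[OF b])
    thus "xy v * d2 i u b \<in> ?a" using ideal_setD(5)[OF a] by force
  qed
  then obtain y where y: "\<And>b. b \<in> B (Suc i) \<Longrightarrow> u b - d2 (Suc i) y b \<in> ?a"
    using ex[of i] unfolding exact_mod_def by blast
  have "d2 (Suc i) (\<lambda>b. x b - xy v * y b) b \<in> ?a" if b: "b \<in> B (Suc i)" for b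
  proof -
    have "d2 (Suc i) (\<lambda>b. x b - xy v * y b) b = (d2 (Suc i) x b - xy v * u b) + xy v * (u b - d2 (Suc i) y b)"
      by (simp add: d2_diff d2_mult algebra_simps)
    thus ?thesis using u[OF b] y[OF b] a by (simp add: ideal_setD)
  qed
  then obtain y2 where y2: "\<And>b. b \<in> B (Suc (Suc i)) \<Longrightarrow> x b - xy v * y b - d2 (Suc (Suc i)) y2 b \<in> ?a"
    using ex[of "Suc i"] unfolding exact_mod_def by blast
  have "x b - d2 (Suc (Suc i)) y2 b \<in> ident_ideal (insert v T) J" if b: "b \<in> B (Suc (Suc i))" for b
  proof -
    have "x b - xy v * y b - d2 (Suc (Suc i)) y2 b \<in> ident_ideal (insert v T) J"
      using y2[OF b] ident_ideal_insert(1)[OF J] by blast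
    hence "(x b - xy v * y b - d2 (Suc (Suc i)) y2 b) + xy v * y b \<in> ident_ideal (insert v T) J"
      by (rule ideal_setD(2)[OF ideal_set_ident[OF J]]) (rule ident_ideal_insert(2)[OF J])
    thus ?thesis by simp
  qed
  thus "\<exists>y. \<forall>b\<in>B (Suc (Suc i)). x b - d2 (Suc (Suc i)) y b \<in> ident_ideal (insert v T) J" by blast
qed

lemma exact_mod_UNIV:
  assumes J: "ideal_set J"
  shows "exact_mod J UNIV i \<longleftrightarrow> (\<forall>x. (\<forall>b\<in>B i. d i x b \<in> J) \<longrightarrow> (\<exists>y. \<forall>b\<in>B (Suc i). x b - d (Suc i) y b \<in> J))"
    (is "?L \<longleftrightarrow> ?R")
proof
  have dd: "diag (d2 i x b) = d i (\<lambda>b. diag (x b)) b" for i x b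
    by (simp add: d2_def d_def map2_sum map2_mult diag_xpoly)
  note iff = ident_ideal_UNIV[OF J]
  show ?R if L: ?L
  proof (intro allI impI)
    fix x assume "\<forall>b\<in>B i. d i x b \<in> J"
    hence "\<forall>b\<in>B i. d2 i (\<lambda>b. xpoly (x b)) b \<in> ident_ideal UNIV J"
      by (simp add: iff dd diag_xpoly)
    then obtain y where "\<forall>b\<in>B (Suc i). xpoly (x b) - d2 (Suc i) y b \<in> ident_ideal UNIV J"
      using L unfolding exact_mod_def by blast
    thus "\<exists>y. \<forall>b\<in>B (Suc i). x b - d (Suc i) y b \<in> J"
      by (intro exI[of _ "\<lambda>b. diag (y b)"]) (simp add: iff dd diag_xpoly map2_diff)
  qed
  show ?L if R: ?R
    unfolding exact_mod_def
  proof (intro allI impI)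
    fix x assume "\<forall>b\<in>B i. d2 i x b \<in> ident_ideal UNIV J"
    hence "\<forall>b\<in>B i. d i (\<lambda>b. diag (x b)) b \<in> J"
      by (simp add: iff dd)
    then obtain y where "\<forall>b\<in>B (Suc i). diag (x b) - d (Suc i) y b \<in> J"
      using R by blast
    thus "\<exists>y. \<forall>b\<in>B (Suc i). x b - d2 (Suc i) y b \<in> ident_ideal UNIV J"
      by (intro exI[of _ "\<lambda>b. xpoly (y b)"]) (simp add: iff dd diag_xpoly map2_diff)
  qed
qed

text \<open>The hypothesis \<open>one\<close> is exactness of \<open>F \<otimes>\<^sub>R R/J\<close> in degree \<open>1\<close>, that is, for \<open>T = UNIV\<close>. Removing
  variables one by one gives exactness in degree \<open>1\<close> for all \<open>T\<close>; adding them back, starting from \<open>T = {}\<close>,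
  gives exactness in the other positive degrees.\<close>
theorem rigidity:
  assumes J: "ideal_set J" "graded_set J"
    and one: "\<And>x. (\<And>b. b \<in> B 0 \<Longrightarrow> d 0 x b \<in> J) \<Longrightarrow> \<exists>y. \<forall>b\<in>B 1. x b - d 1 y b \<in> J"
    and x: "\<And>b. b \<in> B i \<Longrightarrow> d i x b \<in> J"
  shows "\<exists>y. \<forall>b\<in>B (Suc i). x b - d (Suc i) y b \<in> J"
proof -
  have 0: "exact_mod J UNIV 0"
    unfolding exact_mod_UNIV[OF J(1)]
  proof (intro allI impI)
    fix x assume "\<forall>b\<in>B 0. d 0 x b \<in> J"
    thus "\<exists>y. \<forall>b\<in>B (Suc 0). x b - d (Suc 0) y b \<in> J" using one[of x] by simp
  qed
  have down: "exact_mod J (- U) 0" if "finite U" for U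
    using that
  proof (induct U rule: finite_induct)
    case empty
    thus ?case using 0 by simp
  next
    case (insert v U)
    have "insert v (- insert v U) = - U" using insert(2) by auto
    thus ?case using exact_mod_down[OF J, of v "- insert v U"] insert(3) by simp
  qed
  have deg1: "exact_mod J T 0" for T
    using down[of "- T"] by simp
  have "exact_mod J T i" for T i
    using finite[of T]
  proof (induct T arbitrary: i rule: finite_induct)
    case empty
    show ?case by (rule exact_mod_empty[OF J(1)])
  next
    case (insert v T)
    show ?case
    proof (cases i)
      case 0
      thus ?thesis using deg1 by simp
    next
      case (Suc j)
      show ?thesis unfolding Suc by (rule exact_mod_up[OF J(1) insert(2) insert(3)])
    qed
  qed
  hence "exact_mod J UNIV i" .
  hence "\<forall>x. (\<forall>b\<in>B i. d i x b \<in> J) \<longrightarrow> (\<exists>y. \<forall>b\<in>B (Suc i). x b - d (Suc i) y b \<in> J)"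
    unfolding exact_mod_UNIV[OF J(1)] .
  thus ?thesis using x by simp
qed

end

section \<open>The polynomial ring as an algebraic structure\<close>

lemma mpoly_ring_simps [simp]:
  "carrier mpoly_ring = UNIV" "monoid.mult mpoly_ring = (*)" "one mpoly_ring = 1" "ring.zero mpoly_ring = 0"
  "ring.add mpoly_ring = (+)" "smult mpoly_ring = (*)"
  by (simp_all add: mpoly_ring_def)

lemma cring_mpoly_ring: "cring (mpoly_ring :: (('n::finite, 'k::field) mpoly, ('n, 'k) mpoly) graded_module)"
proof (rule cringI)
  show "abelian_group (mpoly_ring :: (('n, 'k) mpoly, ('n, 'k) mpoly) graded_module)"
  proof (rule abelian_groupI)
    show "\<exists>y\<in>carrier mpoly_ring. y \<oplus>\<^bsub>mpoly_ring\<^esub> x = \<zero>\<^bsub>mpoly_ring\<^esub>" for x :: "('n, 'k) mpoly"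
      by (rule bexI[of _ "- x"]) simp_all
  qed (simp_all add: ac_simps)
  show "comm_monoid (mpoly_ring :: (('n, 'k) mpoly, ('n, 'k) mpoly) graded_module)"
    by (rule comm_monoidI) (simp_all add: ac_simps)
qed (simp add: distrib_right)

lemma part_mpoly_ring: "p \<in> part mpoly_ring d \<longleftrightarrow> homog mdeg d p"
  by (simp add: mpoly_ring_def homog_def mdeg_def)

lemma ideal_mpoly_ring:
  assumes "ideal I mpoly_ring"
  shows "ideal_set I"
proof -
  interpret ideal I mpoly_ring by fact
  show ?thesis
    unfolding ideal_set_def using additive_subgroup.zero_closed[OF is_additive_subgroup]
      additive_subgroup.a_closed[OF is_additive_subgroup] I_l_closed by auto
qed

section \<open>Resolutions of cyclic modules given by matrices\<close>

text \<open>The map \<open>x \<mapsto> \<Sum> x b * r b\<close> augments the complex to a resolution of \<open>R/I\<close>: it is onto modulo \<open>I\<close>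
  (\<open>unit\<close>) and the preimage of \<open>I\<close> consists of the boundaries (\<open>aug\<close>). The module in degree \<open>0\<close> may have more
  than one generator.\<close>
locale matrix_resolution = matrix_complex B A dg
  for B :: "nat \<Rightarrow> 'x set" and A :: "nat \<Rightarrow> 'x \<Rightarrow> 'x \<Rightarrow> ('n::finite, 'k::field) mpoly" and dg :: "nat \<Rightarrow> 'x \<Rightarrow> int" +
  fixes r :: "'x \<Rightarrow> ('n, 'k) mpoly" and I :: "('n, 'k) mpoly set"
  assumes ideal_I: "ideal_set I"
    and homog_r: "b \<in> B 0 \<Longrightarrow> homog mdeg (dg 0 b) (r b)"
    and unit: "\<exists>e. (\<Sum>b\<in>B 0. e b * r b) - 1 \<in> I"
    and aug: "(\<Sum>b\<in>B 0. x b * r b) \<in> I \<longleftrightarrow> (\<exists>y. \<forall>b\<in>B 0. x b = (\<Sum>b'\<in>B (Suc 0). y b' * A 0 b' b))"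
begin

lemma aug_d: "(\<Sum>b\<in>B 0. x b * r b) \<in> I \<longleftrightarrow> (\<exists>y. \<forall>b\<in>B 0. x b = d 0 y b)"
  by (simp add: aug d_def)

lemma exact_d: "(\<And>b. b \<in> B i \<Longrightarrow> d i x b = 0) \<Longrightarrow> \<exists>y. \<forall>b\<in>B (Suc i). x b = d (Suc i) y b"
  unfolding d_def by (rule exact)

lemma d_mult_right: "d i (\<lambda>b. x b * q) b = d i x b * q"
  unfolding d_def sum_distrib_right by (simp only: ac_simps)

lemma d_sum: "d i (\<lambda>b. \<Sum>a\<in>K. x a b) b = (\<Sum>a\<in>K. d i (x a) b)"
  unfolding d_def by (subst sum.swap) (simp add: sum_distrib_right)

lemma d_zero: "d i (\<lambda>b. 0) b = 0"
  by (simp add: d_def)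

text \<open>An element \<open>e\<close> mapped to \<open>1\<close> modulo \<open>I\<close> generates the module in degree \<open>0\<close> up to boundaries.\<close>
lemma lift_unit:
  assumes e: "(\<Sum>b\<in>B 0. e b * r b) - 1 \<in> I" and a: "(\<Sum>b\<in>B 0. x b * r b) - a \<in> I"
  shows "\<exists>y. \<forall>b\<in>B 0. x b - a * e b = d 0 y b"
  unfolding aug_d[symmetric]
proof -
  have "(\<Sum>b\<in>B 0. (x b - a * e b) * r b) = ((\<Sum>b\<in>B 0. x b * r b) - a) - a * ((\<Sum>b\<in>B 0. e b * r b) - 1)"
    by (simp add: algebra_simps sum_subtractf sum_distrib_left)
  thus "(\<Sum>b\<in>B 0. (x b - a * e b) * r b) \<in> I"
    using e a ideal_I by (simp only: ideal_setD)
qed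

lemma ideal_lift:
  assumes e: "(\<Sum>b\<in>B 0. e b * r b) - 1 \<in> I" and a: "a \<in> I"
  shows "\<exists>y. \<forall>b\<in>B 0. a * e b = d 0 y b"
proof -
  have "(\<Sum>b\<in>B 0. 0 * r b) - (- a) \<in> I" using a by simp
  from lift_unit[OF e this] show ?thesis by simp
qed

text \<open>The identification of \<open>Tor\<^sub>1(R/I, R/J)\<close> with \<open>(I \<inter> J)/IJ\<close>, in elements. Up to boundaries each basis
  element is the multiple \<open>r b\<close> of \<open>e\<close>, so that \<open>dx\<close>, with coordinates in \<open>J\<close>, is \<open>s e\<close> with
  \<open>s \<in> I \<inter> J\<close>, up to the boundary of an element with coordinates in \<open>J\<close>. As \<open>s\<close> is a sum of products
  \<open>i j\<close> and each \<open>i e\<close> is a boundary, \<open>s e\<close> is itself the boundary of an element with coordinates in \<open>J\<close>.\<close>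
lemma tor_one:
  assumes J: "ideal_set J" and IJ: "I \<inter> J \<subseteq> I \<cdot>\<^bsub>mpoly_ring\<^esub> J"
    and x: "\<And>b. b \<in> B 0 \<Longrightarrow> d 0 x b \<in> J"
  shows "\<exists>y. \<forall>b\<in>B 1. x b - d 1 y b \<in> J"
proof -
  obtain e where e: "(\<Sum>b\<in>B 0. e b * r b) - 1 \<in> I" using unit by blast
  have "\<forall>b. \<exists>g. b \<in> B 0 \<longrightarrow> (\<forall>b'\<in>B 0. (if b' = b then 1 else 0) - r b * e b' = d 0 g b')"
  proof
    fix b
    have "(\<Sum>b'\<in>B 0. (if b' = b then 1 else 0) * r b') - r b \<in> I" if "b \<in> B 0"
    proof -
      have "(\<Sum>b'\<in>B 0. (if b' = b then 1 else 0) * r b') = (\<Sum>b'\<in>B 0. if b' = b then r b' else 0)"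
        by (rule sum.cong) auto
      thus ?thesis using that finite_B ideal_I by (simp add: ideal_setD)
    qed
    from lift_unit[OF e this]
    show "\<exists>g. b \<in> B 0 \<longrightarrow> (\<forall>b'\<in>B 0. (if b' = b then 1 else 0) - r b * e b' = d 0 g b')"
      by blast
  qed
  from choice[OF this] obtain g
    where g: "\<And>b b'. b \<in> B 0 \<Longrightarrow> b' \<in> B 0 \<Longrightarrow> (if b' = b then 1 else 0) - r b * e b' = d 0 (g b) b'"
    by blast
  define s where "s = (\<Sum>b\<in>B 0. d 0 x b * r b)"
  have "s \<in> I" unfolding s_def aug_d by blast
  moreover have "s \<in> J" unfolding s_def by (intro ideal_set_sum[OF J] ideal_setD(4)[OF J] x)
  ultimately have "s \<in> I \<cdot>\<^bsub>mpoly_ring\<^esub> J" using IJ by blast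
  hence "\<exists>h. (\<forall>b\<in>B 1. h b \<in> J) \<and> (\<forall>b\<in>B 0. s * e b = d 0 h b)"
  proof (induct s rule: ideal_prod.induct)
    case (prod i j)
    obtain y where "\<forall>b\<in>B 0. i * e b = d 0 y b" using ideal_lift[OF e prod(1)] by blast
    hence "i * j * e b = j * d 0 y b" if "b \<in> B 0" for b
      using that by (metis mult.assoc mult.commute)
    thus ?case using prod(2) J
      by (intro exI[of _ "\<lambda>b. j * y b"]) (simp add: ideal_setD d_mult)
  next
    case (sum s1 s2)
    then obtain h1 h2 where "\<forall>b\<in>B 1. h1 b \<in> J" "\<forall>b\<in>B 0. s1 * e b = d 0 h1 b"
      "\<forall>b\<in>B 1. h2 b \<in> J" "\<forall>b\<in>B 0. s2 * e b = d 0 h2 b" by blast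
    thus ?case using J
      by (intro exI[of _ "\<lambda>b. h1 b + h2 b"]) (simp add: ideal_setD d_add distrib_right)
  qed
  then obtain h where h: "\<And>b. b \<in> B 1 \<Longrightarrow> h b \<in> J" "\<And>b. b \<in> B 0 \<Longrightarrow> s * e b = d 0 h b" by blast
  define x' where "x' b = h b + (\<Sum>a\<in>B 0. d 0 x a * g a b)" for b
  have x': "x' b \<in> J" if "b \<in> B 1" for b
    unfolding x'_def by (intro ideal_setD(2)[OF J] h(1) that ideal_set_sum[OF J] ideal_setD(4)[OF J] x)
  have "d 0 (\<lambda>b. x b - x' b) b = 0" if b: "b \<in> B 0" for b
  proof -
    have "d 0 x' b = s * e b + (\<Sum>a\<in>B 0. d 0 x a * ((if b = a then 1 else 0) - r a * e b))"
      unfolding x'_def d_add d_sum d_mult h(2)[OF b] by (intro arg_cong2[of _ _ _ _ "(+)"] sum.cong) (simp_all add: g b)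
    also have "(\<Sum>a\<in>B 0. d 0 x a * ((if b = a then 1 else 0) - r a * e b)) =
        (\<Sum>a\<in>B 0. (if b = a then d 0 x a else 0) - d 0 x a * r a * e b)"
      by (rule sum.cong) (auto simp: right_diff_distrib ac_simps)
    also have "\<dots> = d 0 x b - s * e b"
      using b finite_B by (simp add: sum_subtractf s_def sum_distrib_right)
    finally show ?thesis by (simp add: d_diff)
  qed
  then obtain z where "\<forall>b\<in>B (Suc 0). x b - x' b = d (Suc 0) z b" using exact_d by blast
  hence "x b - d 1 z b = x' b" if "b \<in> B 1" for b using that by (simp add: algebra_simps)
  thus ?thesis using x' by metis
qed

end

section \<open>The tensor product of two matrix resolutions\<close>

locale two_resolutions = F: matrix_resolution B A dg r I + G: matrix_resolution C D dh s J
  for B :: "nat \<Rightarrow> 'x set" and A :: "nat \<Rightarrow> 'x \<Rightarrow> 'x \<Rightarrow> ('n::finite, 'k::field) mpoly" and dg r I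
    and C :: "nat \<Rightarrow> 'y set" and D :: "nat \<Rightarrow> 'y \<Rightarrow> 'y \<Rightarrow> ('n, 'k) mpoly" and dh s J +
  assumes graded_J: "graded_set J" and inter_prod: "I \<inter> J \<subseteq> I \<cdot>\<^bsub>mpoly_ring\<^esub> J"
begin

text \<open>Exactness of \<open>F \<otimes>\<^sub>R R/J\<close> in all positive degrees.\<close>
lemma exact_mod_J:
  assumes "\<And>b. b \<in> B i \<Longrightarrow> F.d i x b \<in> J"
  shows "\<exists>y. \<forall>b\<in>B (Suc i). x b - F.d (Suc i) y b \<in> J"
  by (rule F.rigidity[OF G.ideal_I graded_J F.tor_one[OF G.ideal_I inter_prod] assms])

text \<open>The differential of \<open>F \<otimes> G\<close>: \<open>t i b c\<close> is the coefficient of \<open>b \<otimes> c\<close> in the summand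
  \<open>F\<^sub>i \<otimes> G\<^sub>n\<^sub>-\<^sub>i\<close>.\<close>
definition td :: "nat \<Rightarrow> (nat \<Rightarrow> 'x \<Rightarrow> 'y \<Rightarrow> ('n, 'k) mpoly) \<Rightarrow> nat \<Rightarrow> 'x \<Rightarrow> 'y \<Rightarrow> ('n, 'k) mpoly" where
  "td n t i b c = F.d i (\<lambda>b'. t (Suc i) b' c) b + (- 1) ^ i * G.d (n - i) (t i b) c"

lemma td_add: "td n (\<lambda>i b c. t i b c + u i b c) i b c = td n t i b c + td n u i b c"
  by (simp add: td_def F.d_add G.d_add algebra_simps)
lemma td_diff: "td n (\<lambda>i b c. t i b c - u i b c) i b c = td n t i b c - td n u i b c"
  by (simp add: td_def F.d_diff G.d_diff algebra_simps)

lemma F_d_G_d: "F.d i (\<lambda>b. G.d j (x b) c) b = G.d j (\<lambda>c. F.d i (\<lambda>b. x b c) b) c"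
  unfolding F.d_def G.d_def sum_distrib_right by (subst sum.swap) (simp add: ac_simps)

lemma td_td:
  assumes i: "i \<le> n" "b \<in> B i" "c \<in> C (n - i)"
  shows "td n (td (Suc n) u) i b c = 0"
proof -
  have n: "Suc n - i = Suc (n - i)" using i by simp
  have "F.d i (\<lambda>b'. td (Suc n) u (Suc i) b' c) b = (- 1) ^ Suc i * F.d i (\<lambda>b'. G.d (n - i) (u (Suc i) b') c) b"
    by (simp add: td_def F.d_add F.d_mult F.d_d[OF i(2)] F.d_diff F.d_zero)
  moreover have "G.d (n - i) (td (Suc n) u i b) c = G.d (n - i) (\<lambda>c. F.d i (\<lambda>b. u (Suc i) b c) b) c"
    unfolding td_def[abs_def] by (simp add: G.d_add G.d_mult n G.d_d[OF i(3)])
  ultimately show ?thesis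
    by (subst td_def) (simp add: F_d_G_d)
qed

text \<open>The cycle \<open>t\<close> is changed by boundaries until its components vanish, starting with the one in
  \<open>F\<^sub>n\<^sub>+\<^sub>1 \<otimes> G\<^sub>0\<close>. The image of this component in \<open>F \<otimes> R/J\<close> is a cycle, hence a boundary, and this is the
  only place where rigidity enters. Once the components with index above \<open>m\<close> vanish, the component with
  index \<open>m\<close> is a cycle for the differential of \<open>G\<close> alone, and exactness of \<open>G\<close> removes it.\<close>
theorem tensor_exact:
  assumes t: "\<And>i b c. i \<le> n \<Longrightarrow> b \<in> B i \<Longrightarrow> c \<in> C (n - i) \<Longrightarrow> td n t i b c = 0"
  shows "\<exists>u. \<forall>i\<le>Suc n. \<forall>b\<in>B i. \<forall>c\<in>C (Suc n - i). t i b c = td (Suc n) u i b c"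
proof -
  \<comment> \<open>\<open>Q m\<close>: some boundary agrees with \<open>t\<close> in all components with index at least \<open>m\<close>\<close>
  define Q where "Q m \<longleftrightarrow> (\<exists>u. \<forall>i. m \<le> i \<longrightarrow> i \<le> Suc n \<longrightarrow> (\<forall>b\<in>B i. \<forall>c\<in>C (Suc n - i). t i b c = td (Suc n) u i b c))" for m
  have top: "Q (Suc n)"
  proof -
    obtain f where f: "(\<Sum>c\<in>C 0. f c * s c) - 1 \<in> J" using G.unit by blast
    \<comment> \<open>the image of the top component in \<open>F\<^sub>n\<^sub>+\<^sub>1 \<otimes> R/J\<close>\<close>
    define w where "w b = (\<Sum>c\<in>C 0. t (Suc n) b c * s c)" for b
    have "F.d n w b \<in> J" if b: "b \<in> B n" for b
    proof -
      have "F.d n w b = (\<Sum>c\<in>C 0. F.d n (\<lambda>b'. t (Suc n) b' c) b * s c)"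
        unfolding w_def F.d_sum F.d_mult_right ..
      also have "\<dots> = (\<Sum>c\<in>C 0. - ((- 1) ^ n) * (G.d 0 (t n b) c * s c))"
      proof (rule sum.cong[OF refl])
        fix c assume "c \<in> C 0"
        hence "F.d n (\<lambda>b'. t (Suc n) b' c) b + (- 1) ^ n * G.d 0 (t n b) c = 0"
          using t[of n b c] b by (simp add: td_def)
        hence "F.d n (\<lambda>b'. t (Suc n) b' c) b = - ((- 1) ^ n) * G.d 0 (t n b) c"
          by (simp add: eq_neg_iff_add_eq_0)
        thus "F.d n (\<lambda>b'. t (Suc n) b' c) b * s c = - ((- 1) ^ n) * (G.d 0 (t n b) c * s c)"
          by (simp add: mult.assoc)
      qed
      also have "\<dots> = - ((- 1) ^ n) * (\<Sum>c\<in>C 0. G.d 0 (t n b) c * s c)"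
        by (simp only: sum_distrib_left)
      also have "(\<Sum>c\<in>C 0. G.d 0 (t n b) c * s c) \<in> J" unfolding G.aug_d by blast
      hence "- ((- 1) ^ n) * (\<Sum>c\<in>C 0. G.d 0 (t n b) c * s c) \<in> J" by (rule ideal_setD(3)[OF G.ideal_I])
      finally show ?thesis .
    qed
    then obtain w' where w': "\<And>b. b \<in> B (Suc n) \<Longrightarrow> w b - F.d (Suc n) w' b \<in> J"
      using exact_mod_J by blast
    have "\<forall>b. \<exists>v. b \<in> B (Suc n) \<longrightarrow> (\<forall>c\<in>C 0. t (Suc n) b c - F.d (Suc n) w' b * f c = G.d 0 v c)"
      using G.lift_unit[OF f w'[unfolded w_def]] by blast
    from choice[OF this] obtain v where v: "\<And>b c. b \<in> B (Suc n) \<Longrightarrow> c \<in> C 0 \<Longrightarrow>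
      t (Suc n) b c - F.d (Suc n) w' b * f c = G.d 0 (v b) c" by blast
    define u where "u i b c = (if i = Suc n then (- 1) ^ Suc n * v b c else w' b * f c)" for i b c
    have "t (Suc n) b c = td (Suc n) u (Suc n) b c" if "b \<in> B (Suc n)" "c \<in> C 0" for b c
    proof -
      have "td (Suc n) u (Suc n) b c = F.d (Suc n) (\<lambda>b'. w' b' * f c) b + (- 1) ^ Suc n * G.d 0 (\<lambda>c. (- 1) ^ Suc n * v b c) c"
        by (simp add: td_def u_def[abs_def])
      also have "\<dots> = F.d (Suc n) w' b * f c + G.d 0 (v b) c"
        unfolding F.d_mult_right G.d_mult by (simp flip: mult.assoc power_add)
      finally show ?thesis using v[OF that] by (simp add: algebra_simps)
    qed
    thus ?thesis unfolding Q_def by (intro exI[of _ u]) (metis diff_self_eq_0 le_antisym)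
  qed
  have step: "Q m" if m: "m \<le> n" and Q: "Q (Suc m)" for m
  proof -
    obtain u where u: "\<And>i b c. Suc m \<le> i \<Longrightarrow> i \<le> Suc n \<Longrightarrow> b \<in> B i \<Longrightarrow> c \<in> C (Suc n - i) \<Longrightarrow> t i b c = td (Suc n) u i b c"
      using Q unfolding Q_def by blast
    define v where "v i b c = t i b c - td (Suc n) u i b c" for i b c
    have n: "Suc n - m = Suc (n - m)" using m by simp
    have "\<exists>g. \<forall>c\<in>C (Suc (n - m)). v m b c = G.d (Suc (n - m)) g c" if b: "b \<in> B m" for b
    proof (rule G.exact_d)
      fix c assume c: "c \<in> C (n - m)"
      have "td n v m b c = td n t m b c - td n (td (Suc n) u) m b c"
        unfolding v_def by (rule td_diff)
      hence "td n v m b c = 0" using t[OF m b c] td_td[OF m b c] by simp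
      moreover have "F.d m (\<lambda>b'. v (Suc m) b' c) b = F.d m (\<lambda>b'. 0) b"
        by (rule F.d_cong) (use u[of "Suc m"] m c in \<open>simp add: v_def\<close>)
      ultimately have "(- 1) ^ m * G.d (n - m) (v m b) c = 0" by (simp add: td_def F.d_zero)
      hence "(- 1) ^ m * ((- 1) ^ m * G.d (n - m) (v m b) c) = 0" by simp
      thus "G.d (n - m) (v m b) c = 0" by (simp flip: mult.assoc power_add)
    qed
    hence "\<forall>b. \<exists>g. b \<in> B m \<longrightarrow> (\<forall>c\<in>C (Suc (n - m)). v m b c = G.d (Suc (n - m)) g c)" by blast
    from choice[OF this] obtain g where g: "\<And>b c. b \<in> B m \<Longrightarrow> c \<in> C (Suc (n - m)) \<Longrightarrow> v m b c = G.d (Suc (n - m)) (g b) c"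
      by blast
    define u' where "u' i b c = (if i = m then (- 1) ^ m * g b c else 0)" for i b c
    have "t i b c = td (Suc n) (\<lambda>i b c. u i b c + u' i b c) i b c"
      if i: "m \<le> i" "i \<le> Suc n" and b: "b \<in> B i" and c: "c \<in> C (Suc n - i)" for i b c
    proof (cases "i = m")
      case True
      have "td (Suc n) u' m b c = (- 1) ^ m * G.d (Suc n - m) (\<lambda>c. (- 1) ^ m * g b c) c"
        by (simp add: td_def u'_def[abs_def] F.d_zero)
      also have "\<dots> = G.d (Suc n - m) (g b) c"
        unfolding G.d_mult by (simp flip: mult.assoc power_add)
      also have "\<dots> = v m b c" using g[of b c] b c n unfolding True by simp
      finally show ?thesis unfolding td_add True by (simp add: v_def)
    next
      case False
      have "td (Suc n) u' i b c = 0"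
        using False i by (simp add: td_def u'_def[abs_def] F.d_zero G.d_zero)
      thus ?thesis using u[of i b c] i b c False by (simp add: td_add)
    qed
    thus ?thesis unfolding Q_def by blast
  qed
  have "Q (Suc n - k)" for k
  proof (induct k)
    case (Suc k)
    show ?case
    proof (cases "k \<le> n")
      case True
      thus ?thesis using step[of "n - k"] Suc by (simp add: Suc_diff_le)
    next
      case False
      thus ?thesis using Suc by simp
    qed
  qed (simp add: top)
  from this[of "Suc n"] show ?thesis unfolding Q_def by simp
qed

lemma tensor_aug_image:
  "(\<Sum>b\<in>B 0. \<Sum>c\<in>C 0. td 0 u 0 b c * (r b * s c)) \<in> I <+>\<^bsub>mpoly_ring\<^esub> J"
proof -
  have "(\<Sum>b\<in>B 0. \<Sum>c\<in>C 0. td 0 u 0 b c * (r b * s c)) =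
    (\<Sum>c\<in>C 0. s c * (\<Sum>b\<in>B 0. F.d 0 (\<lambda>b'. u (Suc 0) b' c) b * r b)) + (\<Sum>b\<in>B 0. r b * (\<Sum>c\<in>C 0. G.d 0 (u 0 b) c * s c))"
    unfolding td_def distrib_right sum.distrib sum_distrib_left
    by (subst (2) sum.swap) (simp add: ac_simps)
  moreover have "(\<Sum>c\<in>C 0. s c * (\<Sum>b\<in>B 0. F.d 0 (\<lambda>b'. u (Suc 0) b' c) b * r b)) \<in> I"
    by (rule ideal_set_sum[OF F.ideal_I], rule ideal_setD(3)[OF F.ideal_I]) (auto simp: F.aug_d)
  moreover have "(\<Sum>b\<in>B 0. r b * (\<Sum>c\<in>C 0. G.d 0 (u 0 b) c * s c)) \<in> J"
    by (rule ideal_set_sum[OF G.ideal_I], rule ideal_setD(3)[OF G.ideal_I]) (auto simp: G.aug_d)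
  ultimately show ?thesis by (auto simp: set_add_def set_mult_def)
qed

text \<open>Up to boundaries of \<open>F\<close> and of \<open>G\<close>, \<open>t\<close> equals \<open>q (e \<otimes> f)\<close>, where \<open>q\<close> is its image in \<open>R\<close> and \<open>e\<close>, \<open>f\<close>
  lift \<open>1\<close>. If \<open>q = i + j\<close>, then \<open>i e\<close> and \<open>j f\<close> are boundaries too.\<close>
lemma tensor_aug_kernel:
  assumes t: "(\<Sum>b\<in>B 0. \<Sum>c\<in>C 0. t b c * (r b * s c)) \<in> I <+>\<^bsub>mpoly_ring\<^esub> J"
  shows "\<exists>u. \<forall>b\<in>B 0. \<forall>c\<in>C 0. t b c = td 0 u 0 b c"
proof -
  obtain e where e: "(\<Sum>b\<in>B 0. e b * r b) - 1 \<in> I" using F.unit by blast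
  obtain f where f: "(\<Sum>c\<in>C 0. f c * s c) - 1 \<in> J" using G.unit by blast
  define w where "w c = (\<Sum>b\<in>B 0. t b c * r b)" for c
  have "\<exists>y. \<forall>b\<in>B 0. t b c - w c * e b = F.d 0 y b" for c
    by (rule F.lift_unit[OF e]) (simp add: w_def ideal_setD[OF F.ideal_I])
  then obtain y where y: "\<And>b c. b \<in> B 0 \<Longrightarrow> t b c - w c * e b = F.d 0 (y c) b" by metis
  define q where "q = (\<Sum>c\<in>C 0. w c * s c)"
  have "q = (\<Sum>b\<in>B 0. \<Sum>c\<in>C 0. t b c * (r b * s c))"
    unfolding q_def w_def sum_distrib_right by (subst sum.swap) (simp add: ac_simps)
  then obtain i j where ij: "i \<in> I" "j \<in> J" "q = i + j" using t by (auto simp: set_add_def set_mult_def)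
  have "\<exists>z. \<forall>c\<in>C 0. w c - q * f c = G.d 0 z c"
    by (rule G.lift_unit[OF f]) (simp add: q_def ideal_setD[OF G.ideal_I])
  then obtain z where z: "\<And>c. c \<in> C 0 \<Longrightarrow> w c - q * f c = G.d 0 z c" by blast
  obtain y' where y': "\<And>b. b \<in> B 0 \<Longrightarrow> i * e b = F.d 0 y' b" using F.ideal_lift[OF e ij(1)] by blast
  obtain z' where z': "\<And>c. c \<in> C 0 \<Longrightarrow> j * f c = G.d 0 z' c" using G.ideal_lift[OF f ij(2)] by blast
  define u where "u k b c = (if k = 0 then e b * (z c + z' c) else y c b + y' b * f c)" for k :: nat and b c
  have "t b c = td 0 u 0 b c" if b: "b \<in> B 0" and c: "c \<in> C 0" for b c
  proof -
    have "td 0 u 0 b c = F.d 0 (\<lambda>b. y c b + y' b * f c) b + G.d 0 (\<lambda>c. e b * (z c + z' c)) c"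
      by (simp add: td_def u_def[abs_def])
    also have "\<dots> = (t b c - w c * e b) + i * e b * f c + e b * ((w c - q * f c) + j * f c)"
      unfolding F.d_add F.d_mult_right G.d_mult G.d_add y[OF b, symmetric] y'[OF b, symmetric] z[OF c, symmetric] z'[OF c, symmetric] ..
    also have "\<dots> = t b c" by (simp add: ij(3) algebra_simps)
    finally show ?thesis by simp
  qed
  thus ?thesis by blast
qed

lemma tensor_aug_unit: "\<exists>t. (\<Sum>b\<in>B 0. \<Sum>c\<in>C 0. t b c * (r b * s c)) - 1 \<in> I <+>\<^bsub>mpoly_ring\<^esub> J"
proof -
  obtain e where e: "(\<Sum>b\<in>B 0. e b * r b) - 1 \<in> I" using F.unit by blast
  obtain f where f: "(\<Sum>c\<in>C 0. f c * s c) - 1 \<in> J" using G.unit by blast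
  let ?e = "\<Sum>b\<in>B 0. e b * r b" and ?f = "\<Sum>c\<in>C 0. f c * s c"
  have "(\<Sum>b\<in>B 0. \<Sum>c\<in>C 0. e b * f c * (r b * s c)) = ?e * ?f"
    by (simp add: sum_product ac_simps)
  also have "\<dots> - 1 = ?f * (?e - 1) + (?f - 1)" by (simp add: algebra_simps)
  also have "\<dots> \<in> I <+>\<^bsub>mpoly_ring\<^esub> J"
    using ideal_setD(3)[OF F.ideal_I e, of ?f] f by (auto simp: set_add_def set_mult_def)
  finally show ?thesis by (rule exI[of _ "\<lambda>b c. e b * f c"])
qed

end

section \<open>Module homomorphisms, quotients and generated submodules\<close>

text \<open>Homomorphisms are described through \<open>hom\<close> on the additive monoids, so that a graded homomorphism is one
  of these that respects degrees (\<open>graded_hom_iff\<close>).\<close>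
definition mod_hom ::
  "('a, 'r) ring_scheme \<Rightarrow> ('a, 'b, 'm) module_scheme \<Rightarrow> ('a, 'c, 'n) module_scheme \<Rightarrow> ('b \<Rightarrow> 'c) set" where
  "mod_hom R M N = {h \<in> hom (add_monoid M) (add_monoid N).
     \<forall>a\<in>carrier R. \<forall>x\<in>carrier M. h (a \<odot>\<^bsub>M\<^esub> x) = a \<odot>\<^bsub>N\<^esub> h x}"

lemma mod_homI:
  assumes "\<And>x. x \<in> carrier M \<Longrightarrow> h x \<in> carrier N"
    and "\<And>x y. x \<in> carrier M \<Longrightarrow> y \<in> carrier M \<Longrightarrow> h (x \<oplus>\<^bsub>M\<^esub> y) = h x \<oplus>\<^bsub>N\<^esub> h y"
    and "\<And>a x. a \<in> carrier R \<Longrightarrow> x \<in> carrier M \<Longrightarrow> h (a \<odot>\<^bsub>M\<^esub> x) = a \<odot>\<^bsub>N\<^esub> h x"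
  shows "h \<in> mod_hom R M N"
  using assms by (auto simp: mod_hom_def hom_def)

lemma mod_homD:
  assumes "h \<in> mod_hom R M N"
  shows "x \<in> carrier M \<Longrightarrow> h x \<in> carrier N"
    and "x \<in> carrier M \<Longrightarrow> y \<in> carrier M \<Longrightarrow> h (x \<oplus>\<^bsub>M\<^esub> y) = h x \<oplus>\<^bsub>N\<^esub> h y"
    and "a \<in> carrier R \<Longrightarrow> x \<in> carrier M \<Longrightarrow> h (a \<odot>\<^bsub>M\<^esub> x) = a \<odot>\<^bsub>N\<^esub> h x"
  using assms by (auto simp: mod_hom_def hom_def)

lemma mod_hom_zero:
  assumes "module R M" "module R N" "h \<in> mod_hom R M N"
  shows "h \<zero>\<^bsub>M\<^esub> = \<zero>\<^bsub>N\<^esub>"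
proof -
  interpret M: module R M by fact
  interpret N: module R N by fact
  have "h (\<zero>\<^bsub>R\<^esub> \<odot>\<^bsub>M\<^esub> \<zero>\<^bsub>M\<^esub>) = \<zero>\<^bsub>R\<^esub> \<odot>\<^bsub>N\<^esub> h \<zero>\<^bsub>M\<^esub>"
    by (rule mod_homD(3)[OF assms(3)]) simp_all
  thus ?thesis using mod_homD(1)[OF assms(3), of "\<zero>\<^bsub>M\<^esub>"] by simp
qed

lemma mod_hom_uminus:
  assumes "module R M" "module R N" "h \<in> mod_hom R M N" "x \<in> carrier M"
  shows "h (\<ominus>\<^bsub>M\<^esub> x) = \<ominus>\<^bsub>N\<^esub> h x"
proof -
  interpret M: module R M by fact
  interpret N: module R N by fact
  have "h (\<ominus>\<^bsub>M\<^esub> x) = h ((\<ominus>\<^bsub>R\<^esub> \<one>\<^bsub>R\<^esub>) \<odot>\<^bsub>M\<^esub> x)"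
    using assms(4) by (simp add: M.smult_l_minus)
  also have "\<dots> = (\<ominus>\<^bsub>R\<^esub> \<one>\<^bsub>R\<^esub>) \<odot>\<^bsub>N\<^esub> h x"
    by (rule mod_homD(3)[OF assms(3)]) (use assms(4) in simp_all)
  finally show ?thesis using mod_homD(1)[OF assms(3,4)] by (simp add: N.smult_l_minus)
qed

lemma mod_hom_minus:
  assumes "module R M" "module R N" "h \<in> mod_hom R M N" "x \<in> carrier M" "y \<in> carrier M"
  shows "h (x \<ominus>\<^bsub>M\<^esub> y) = h x \<ominus>\<^bsub>N\<^esub> h y"
proof -
  interpret M: module R M by fact
  show ?thesis
    using assms(4,5) mod_homD(2)[OF assms(3)] mod_hom_uminus[OF assms(1-3)] by (simp add: a_minus_def)
qed

lemma mod_hom_finsum: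
  assumes "module R M" "module R N" "h \<in> mod_hom R M N" "\<And>a. a \<in> A \<Longrightarrow> f a \<in> carrier M"
  shows "h (finsum M f A) = finsum N (\<lambda>a. h (f a)) A"
proof -
  interpret M: module R M by fact
  interpret N: module R N by fact
  show ?thesis
    using assms(4)
  proof (induct A rule: infinite_finite_induct)
    case (insert a A)
    have "h (finsum M f (insert a A)) = h (f a \<oplus>\<^bsub>M\<^esub> finsum M f A)"
      using insert by (subst M.finsum_insert) auto
    also have "\<dots> = h (f a) \<oplus>\<^bsub>N\<^esub> h (finsum M f A)"
      using insert by (intro mod_homD(2)[OF assms(3)] M.finsum_closed) auto
    also have "\<dots> = finsum N (\<lambda>a. h (f a)) (insert a A)"
      using insert mod_homD(1)[OF assms(3)] by (subst N.finsum_insert) auto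
    finally show ?case .
  qed (simp_all add: mod_hom_zero[OF assms(1-3)])
qed

lemma submodule_kernel:
  assumes "module R M" "module R N" "h \<in> mod_hom R M N"
  shows "submodule {x \<in> carrier M. h x = \<zero>\<^bsub>N\<^esub>} R M"
proof -
  interpret M: module R M by fact
  interpret N: module R N by fact
  show ?thesis
    by (rule M.submoduleI)
      (auto simp: mod_hom_zero[OF assms] mod_hom_uminus[OF assms] mod_homD(2,3)[OF assms(3)])
qed

lemma submodule_gen_submodule:
  assumes "module R M" "S \<subseteq> carrier M"
  shows "submodule (gen_submodule R M S) R M"
proof -
  interpret M: module R M by fact
  have c: "submodule (carrier M) R M" by (rule M.submoduleI) auto
  show ?thesis
    unfolding gen_submodule_def
  proof (rule M.submoduleI)
    show "\<Inter>{N. submodule N R M \<and> S \<subseteq> N} \<subseteq> carrier M" using c assms(2) by blast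
    show "\<zero>\<^bsub>M\<^esub> \<in> \<Inter>{N. submodule N R M \<and> S \<subseteq> N}"
      using subgroup.one_closed[OF submodule.axioms(1)] by fastforce
  qed (use M.submoduleE in \<open>auto\<close>)
qed

lemma gen_submodule_superset: "S \<subseteq> gen_submodule R M S"
  by (auto simp: gen_submodule_def)

lemma gen_submodule_minimal: "submodule N R M \<Longrightarrow> S \<subseteq> N \<Longrightarrow> gen_submodule R M S \<subseteq> N"
  by (auto simp: gen_submodule_def)

locale quotient = M: module R M for R and M (structure) +
  fixes N
  assumes sub: "submodule N R M"
begin

lemma sub_facts:
  shows "x \<in> N \<Longrightarrow> x \<in> carrier M" "\<zero> \<in> N" "x \<in> N \<Longrightarrow> \<ominus> x \<in> N" "x \<in> N \<Longrightarrow> y \<in> N \<Longrightarrow> x \<oplus> y \<in> N"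
    "a \<in> carrier R \<Longrightarrow> x \<in> N \<Longrightarrow> a \<odot> x \<in> N"
  using M.submoduleE[OF sub] subgroup.one_closed[OF submodule.axioms(1)[OF sub]] by auto

sublocale S: abelian_subgroup N M
  by (rule abelian_subgroupI3[OF additive_subgroup.intro])
    (use submodule.axioms(1)[OF sub] M.abelian_group_axioms in auto)

lemma mem_coset: "y \<in> N +> x \<longleftrightarrow> (\<exists>n\<in>N. y = n \<oplus> x)"
  by (auto simp: a_r_coset_def')

lemma coset_eq_iff:
  assumes "x \<in> carrier M" "y \<in> carrier M"
  shows "N +> x = N +> y \<longleftrightarrow> x \<ominus> y \<in> N"
proof
  assume "N +> x = N +> y"
  hence "x \<in> N +> y" using S.a_rcos_self[OF assms(1)] by simp
  then obtain n where n: "n \<in> N" "x = n \<oplus> y" by (elim mem_coset[THEN iffD1, THEN bexE])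
  hence "x \<ominus> y = n"
    using assms(2) sub_facts(1)[OF n(1)] by (simp add: a_minus_def M.a_assoc M.r_neg)
  thus "x \<ominus> y \<in> N" using n by simp
next
  assume *: "x \<ominus> y \<in> N"
  have "x = (x \<ominus> y) \<oplus> y" using assms by (simp add: a_minus_def M.a_assoc M.l_neg)
  hence "x \<in> N +> y" using * by (intro mem_coset[THEN iffD2] bexI)
  thus "N +> x = N +> y" using S.a_repr_independence'[OF _ assms(2)] by simp
qed

lemma quot_carrier: "carrier (quot_module M N) = {N +> x |x. x \<in> carrier M}"
  by (auto simp: quot_module_def A_RCOSETS_def')

lemma quot_zero: "\<zero>\<^bsub>quot_module M N\<^esub> = N +> \<zero>"
  using S.a_rcos_const[OF sub_facts(2)] by (simp add: quot_module_def)

lemma quot_add: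
  "x \<in> carrier M \<Longrightarrow> y \<in> carrier M \<Longrightarrow> (N +> x) \<oplus>\<^bsub>quot_module M N\<^esub> (N +> y) = N +> (x \<oplus> y)"
  by (simp add: quot_module_def S.a_rcos_sum)

lemma quot_smult:
  assumes a: "a \<in> carrier R" and x: "x \<in> carrier M"
  shows "a \<odot>\<^bsub>quot_module M N\<^esub> (N +> x) = N +> (a \<odot> x)"
proof -
  have "N +> (a \<odot> y) = N +> (a \<odot> x)" if y: "y \<in> N +> x" for y
  proof -
    obtain n where n: "n \<in> N" "y = n \<oplus> x" using iffD1[OF mem_coset y] by (rule bexE)
    have "a \<odot> y = (a \<odot> n) \<oplus> (a \<odot> x)"
      unfolding n(2) by (rule M.smult_r_distr[OF a sub_facts(1)[OF n(1)] x])
    hence "a \<odot> y \<in> N +> (a \<odot> x)"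
      by (intro mem_coset[THEN iffD2] bexI[OF _ sub_facts(5)[OF a n(1)]])
    thus ?thesis using S.a_repr_independence'[of "a \<odot> y" "a \<odot> x"] a x by simp
  qed
  hence "(\<Union>y\<in>N +> x. N +> (a \<odot> y)) = (\<Union>y\<in>N +> x. N +> (a \<odot> x))"
    by (intro SUP_cong refl)
  also have "\<dots> = N +> (a \<odot> x)" using S.a_rcos_self[OF x] by blast
  finally show ?thesis by (simp add: quot_module_def)
qed

lemma quot_module: "module R (quot_module M N)"
proof (rule moduleI)
  show "abelian_group (quot_module M N)"
  proof (rule abelian_groupI)
    fix A assume "A \<in> carrier (quot_module M N)"
    then obtain x where x: "x \<in> carrier M" "A = N +> x" by (auto simp: quot_carrier)
    have "(N +> (\<ominus> x)) \<oplus>\<^bsub>quot_module M N\<^esub> A = \<zero>\<^bsub>quot_module M N\<^esub>"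
      using x by (simp add: quot_add quot_zero M.l_neg)
    thus "\<exists>B\<in>carrier (quot_module M N). B \<oplus>\<^bsub>quot_module M N\<^esub> A = \<zero>\<^bsub>quot_module M N\<^esub>"
      using x by (intro bexI[of _ "N +> (\<ominus> x)"]) (auto simp: quot_carrier)
    show "\<zero>\<^bsub>quot_module M N\<^esub> \<oplus>\<^bsub>quot_module M N\<^esub> A = A"
      using x by (simp add: quot_add quot_zero)
  next
    fix A B assume "A \<in> carrier (quot_module M N)" "B \<in> carrier (quot_module M N)"
    then obtain x y where xy: "x \<in> carrier M" "A = N +> x" "y \<in> carrier M" "B = N +> y"
      by (auto simp: quot_carrier)
    show "A \<oplus>\<^bsub>quot_module M N\<^esub> B \<in> carrier (quot_module M N)"
      unfolding xy(2,4) quot_add[OF xy(1,3)] using xy(1,3) by (auto simp: quot_carrier)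
    show "A \<oplus>\<^bsub>quot_module M N\<^esub> B = B \<oplus>\<^bsub>quot_module M N\<^esub> A"
      unfolding xy(2,4) quot_add[OF xy(1,3)] quot_add[OF xy(3,1)] M.a_comm[OF xy(1,3)] ..
    fix C assume "C \<in> carrier (quot_module M N)"
    then obtain z where z: "z \<in> carrier M" "C = N +> z"
      by (auto simp: quot_carrier)
    show "A \<oplus>\<^bsub>quot_module M N\<^esub> B \<oplus>\<^bsub>quot_module M N\<^esub> C = A \<oplus>\<^bsub>quot_module M N\<^esub> (B \<oplus>\<^bsub>quot_module M N\<^esub> C)"
      unfolding xy(2,4) z(2) using xy(1,3) z(1) by (simp add: quot_add M.a_assoc)
  next
    show "\<zero>\<^bsub>quot_module M N\<^esub> \<in> carrier (quot_module M N)"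
      unfolding quot_zero quot_carrier by auto
  qed
next
  fix a A assume a: "a \<in> carrier R" and "A \<in> carrier (quot_module M N)"
  then obtain x where x: "x \<in> carrier M" "A = N +> x" by (auto simp: quot_carrier)
  show "a \<odot>\<^bsub>quot_module M N\<^esub> A \<in> carrier (quot_module M N)"
    unfolding x(2) quot_smult[OF a x(1)] using a x(1) by (auto simp: quot_carrier)
  fix b assume b: "b \<in> carrier R"
  show "(a \<oplus>\<^bsub>R\<^esub> b) \<odot>\<^bsub>quot_module M N\<^esub> A = a \<odot>\<^bsub>quot_module M N\<^esub> A \<oplus>\<^bsub>quot_module M N\<^esub> b \<odot>\<^bsub>quot_module M N\<^esub> A"
    unfolding x(2) using a b x(1) by (simp add: quot_add quot_smult M.smult_l_distr)
  show "(a \<otimes>\<^bsub>R\<^esub> b) \<odot>\<^bsub>quot_module M N\<^esub> A = a \<odot>\<^bsub>quot_module M N\<^esub> (b \<odot>\<^bsub>quot_module M N\<^esub> A)"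
    unfolding x(2) using a b x(1) by (simp add: quot_smult M.smult_assoc1)
next
  fix a A B assume a: "a \<in> carrier R" and "A \<in> carrier (quot_module M N)" "B \<in> carrier (quot_module M N)"
  then obtain x y where xy: "x \<in> carrier M" "A = N +> x" "y \<in> carrier M" "B = N +> y"
    by (auto simp: quot_carrier)
  show "a \<odot>\<^bsub>quot_module M N\<^esub> (A \<oplus>\<^bsub>quot_module M N\<^esub> B) = a \<odot>\<^bsub>quot_module M N\<^esub> A \<oplus>\<^bsub>quot_module M N\<^esub> a \<odot>\<^bsub>quot_module M N\<^esub> B"
    unfolding xy(2,4) using a xy(1,3) by (simp add: quot_add quot_smult M.smult_r_distr)
next
  fix A assume "A \<in> carrier (quot_module M N)"
  then obtain x where x: "x \<in> carrier M" "A = N +> x" by (auto simp: quot_carrier)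
  show "\<one>\<^bsub>R\<^esub> \<odot>\<^bsub>quot_module M N\<^esub> A = A"
    unfolding x(2) using x(1) by (simp add: quot_smult)
qed (rule M.R.is_cring)

lemma quot_hom: "(\<lambda>x. N +> x) \<in> mod_hom R M (quot_module M N)"
  by (rule mod_homI) (auto simp: quot_carrier quot_add quot_smult)

text \<open>The factorisation through the quotient is written with \<open>the_elem\<close>, because \<open>tensor_map\<close> is
  defined that way.\<close>
lemma quot_lift:
  assumes Q: "module R Q" and h: "h \<in> mod_hom R M Q" and ker: "\<And>x. x \<in> N \<Longrightarrow> h x = \<zero>\<^bsub>Q\<^esub>"
  shows "x \<in> carrier M \<Longrightarrow> the_elem (h ` (N +> x)) = h x"
    and "(\<lambda>A. the_elem (h ` A)) \<in> mod_hom R (quot_module M N) Q"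
proof -
  interpret Q: module R Q by fact
  show *: "the_elem (h ` (N +> x)) = h x" if x: "x \<in> carrier M" for x
  proof -
    have "h y = h x" if y: "y \<in> N +> x" for y
    proof -
      obtain n where n: "n \<in> N" "y = n \<oplus> x" using iffD1[OF mem_coset y] by (rule bexE)
      have "h y = h n \<oplus>\<^bsub>Q\<^esub> h x" unfolding n(2) by (rule mod_homD(2)[OF h sub_facts(1)[OF n(1)] x])
      thus ?thesis using ker[OF n(1)] mod_homD(1)[OF h x] by simp
    qed
    hence "h ` (N +> x) = {h x}" using S.a_rcos_self[OF x] by blast
    thus ?thesis by simp
  qed
  show "(\<lambda>A. the_elem (h ` A)) \<in> mod_hom R (quot_module M N) Q"
    by (rule mod_homI) (auto simp: quot_carrier quot_add quot_smult * mod_homD[OF h])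
qed

end

section \<open>Free modules\<close>

lemma free_module_simps:
  "carrier (free_module R S) = {f \<in> S \<rightarrow>\<^sub>E carrier R. finite {s \<in> S. f s \<noteq> \<zero>\<^bsub>R\<^esub>}}"
  "\<zero>\<^bsub>free_module R S\<^esub> = (\<lambda>s\<in>S. \<zero>\<^bsub>R\<^esub>)"
  "f \<oplus>\<^bsub>free_module R S\<^esub> g = (\<lambda>s\<in>S. f s \<oplus>\<^bsub>R\<^esub> g s)"
  "a \<odot>\<^bsub>free_module R S\<^esub> f = (\<lambda>s\<in>S. a \<otimes>\<^bsub>R\<^esub> f s)"
  by (simp_all add: free_module_def)

locale free = R: cring R for R (structure) +
  fixes S :: "'s set"
begin

lemma carrierD:
  assumes "f \<in> carrier (free_module R S)"
  shows "s \<in> S \<Longrightarrow> f s \<in> carrier R" "finite {s \<in> S. f s \<noteq> \<zero>}" "s \<notin> S \<Longrightarrow> f s = undefined"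
  using assms by (auto simp: free_module_simps)

lemma carrierI:
  assumes "\<And>s. s \<in> S \<Longrightarrow> f s \<in> carrier R" "finite {s \<in> S. f s \<noteq> \<zero>}" "\<And>s. s \<notin> S \<Longrightarrow> f s = undefined"
  shows "f \<in> carrier (free_module R S)"
  using assms by (auto simp: free_module_simps)

lemma restrict_closed:
  assumes "\<And>s. s \<in> S \<Longrightarrow> f s \<in> carrier R" "finite A" "\<And>s. s \<in> S \<Longrightarrow> s \<notin> A \<Longrightarrow> f s = \<zero>"
  shows "(\<lambda>s\<in>S. f s) \<in> carrier (free_module R S)"
  by (rule carrierI) (use assms in \<open>auto intro!: finite_subset[OF _ assms(2)]\<close>)

lemma free_module: "module R (free_module R S)"
proof (rule moduleI)
  have add: "(\<lambda>s\<in>S. f s \<oplus> g s) \<in> carrier (free_module R S)"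
    if "f \<in> carrier (free_module R S)" "g \<in> carrier (free_module R S)" for f g
    using carrierD[OF that(1)] carrierD[OF that(2)]
    by (intro restrict_closed[of _ "{s \<in> S. f s \<noteq> \<zero>} \<union> {s \<in> S. g s \<noteq> \<zero>}"]) auto
  show "abelian_group (free_module R S)"
  proof (rule abelian_groupI)
    fix f assume f: "f \<in> carrier (free_module R S)"
    have "(\<lambda>s\<in>S. \<ominus> f s) \<in> carrier (free_module R S)"
      using carrierD[OF f] by (intro restrict_closed[of _ "{s \<in> S. f s \<noteq> \<zero>}"]) auto
    moreover have "(\<lambda>s\<in>S. \<ominus> f s) \<oplus>\<^bsub>free_module R S\<^esub> f = \<zero>\<^bsub>free_module R S\<^esub>"
      using carrierD[OF f] by (auto simp: free_module_simps fun_eq_iff R.l_neg)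
    ultimately show "\<exists>g\<in>carrier (free_module R S). g \<oplus>\<^bsub>free_module R S\<^esub> f = \<zero>\<^bsub>free_module R S\<^esub>"
      by blast
    show "\<zero>\<^bsub>free_module R S\<^esub> \<oplus>\<^bsub>free_module R S\<^esub> f = f"
      using carrierD[OF f] by (auto simp: free_module_simps fun_eq_iff)
  next
    fix f g assume "f \<in> carrier (free_module R S)" "g \<in> carrier (free_module R S)"
    thus "f \<oplus>\<^bsub>free_module R S\<^esub> g \<in> carrier (free_module R S)" using add by (simp add: free_module_simps(3))
    show "f \<oplus>\<^bsub>free_module R S\<^esub> g = g \<oplus>\<^bsub>free_module R S\<^esub> f"
      using carrierD(1)[OF \<open>f \<in> _\<close>] carrierD(1)[OF \<open>g \<in> _\<close>] by (auto simp: free_module_simps fun_eq_iff R.a_comm)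
  next
    fix f g h assume "f \<in> carrier (free_module R S)" "g \<in> carrier (free_module R S)" "h \<in> carrier (free_module R S)"
    thus "f \<oplus>\<^bsub>free_module R S\<^esub> g \<oplus>\<^bsub>free_module R S\<^esub> h = f \<oplus>\<^bsub>free_module R S\<^esub> (g \<oplus>\<^bsub>free_module R S\<^esub> h)"
      using carrierD(1)[of f] carrierD(1)[of g] carrierD(1)[of h] by (auto simp: free_module_simps(2-) fun_eq_iff R.a_assoc)
  qed (auto intro!: carrierI simp: free_module_simps(2))
next
  fix a f assume a: "a \<in> carrier R" and f: "f \<in> carrier (free_module R S)"
  show "a \<odot>\<^bsub>free_module R S\<^esub> f \<in> carrier (free_module R S)"
    using a carrierD[OF f] unfolding free_module_simps(4)
    by (intro restrict_closed[of _ "{s \<in> S. f s \<noteq> \<zero>}"]) auto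
next
  fix f assume f: "f \<in> carrier (free_module R S)"
  show "\<one> \<odot>\<^bsub>free_module R S\<^esub> f = f"
    using carrierD[OF f] by (auto simp: free_module_simps(4) fun_eq_iff)
next
  fix a b f assume f: "a \<in> carrier R" "b \<in> carrier R" "f \<in> carrier (free_module R S)"
  show "(a \<oplus> b) \<odot>\<^bsub>free_module R S\<^esub> f = a \<odot>\<^bsub>free_module R S\<^esub> f \<oplus>\<^bsub>free_module R S\<^esub> b \<odot>\<^bsub>free_module R S\<^esub> f"
    using f(1,2) carrierD(1)[OF f(3)] by (auto simp: free_module_simps(2-) fun_eq_iff R.l_distr)
  show "(a \<otimes> b) \<odot>\<^bsub>free_module R S\<^esub> f = a \<odot>\<^bsub>free_module R S\<^esub> (b \<odot>\<^bsub>free_module R S\<^esub> f)"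
    using f(1,2) carrierD(1)[OF f(3)] by (auto simp: free_module_simps(2-) fun_eq_iff R.m_assoc)
next
  fix a f g assume f: "a \<in> carrier R" "f \<in> carrier (free_module R S)" "g \<in> carrier (free_module R S)"
  show "a \<odot>\<^bsub>free_module R S\<^esub> (f \<oplus>\<^bsub>free_module R S\<^esub> g) = a \<odot>\<^bsub>free_module R S\<^esub> f \<oplus>\<^bsub>free_module R S\<^esub> a \<odot>\<^bsub>free_module R S\<^esub> g"
    using f(1) carrierD(1)[OF f(2)] carrierD(1)[OF f(3)] by (auto simp: free_module_simps(2-) fun_eq_iff R.r_distr)
qed (rule R.is_cring)

sublocale F: module R "free_module R S" by (rule free_module)

lemma free_gen_closed: "s \<in> S \<Longrightarrow> free_gen R S s \<in> carrier (free_module R S)"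
  unfolding free_gen_def by (rule restrict_closed[of _ "{s}"]) auto

lemma free_module_induct [consumes 1, case_names zero gen add]:
  assumes f: "f \<in> carrier (free_module R S)"
    and zero: "P \<zero>\<^bsub>free_module R S\<^esub>"
    and gen: "\<And>a s. a \<in> carrier R \<Longrightarrow> s \<in> S \<Longrightarrow> P (a \<odot>\<^bsub>free_module R S\<^esub> free_gen R S s)"
    and add: "\<And>f g. f \<in> carrier (free_module R S) \<Longrightarrow> g \<in> carrier (free_module R S) \<Longrightarrow> P f \<Longrightarrow> P g \<Longrightarrow> P (f \<oplus>\<^bsub>free_module R S\<^esub> g)"
  shows "P f"
proof -
  have "P f" if "finite A" "f \<in> carrier (free_module R S)" "{s \<in> S. f s \<noteq> \<zero>} \<subseteq> A" for A f
    using that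
  proof (induct A arbitrary: f rule: finite_induct)
    case empty
    hence "f = \<zero>\<^bsub>free_module R S\<^esub>"
      using carrierD[OF empty(1)] by (auto simp: free_module_simps(2) fun_eq_iff)
    thus ?case using zero by simp
  next
    case (insert s A)
    show ?case
    proof (cases "s \<in> S")
      case False
      thus ?thesis using insert by (intro insert.hyps(3)) auto
    next
      case True
      define g where "g = (\<lambda>t\<in>S. if t = s then \<zero> else f t)"
      have g: "g \<in> carrier (free_module R S)"
        using carrierD[OF insert(4)] unfolding g_def
        by (intro restrict_closed[of _ "{s \<in> S. f s \<noteq> \<zero>}"]) auto
      have "P g"
        by (rule insert.hyps(3)[OF g]) (use insert(5) in \<open>auto simp: g_def\<close>)
      moreover have "f = f s \<odot>\<^bsub>free_module R S\<^esub> free_gen R S s \<oplus>\<^bsub>free_module R S\<^esub> g"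
        using carrierD[OF insert(4)] True
        by (auto simp: free_module_simps(2-) free_gen_def g_def fun_eq_iff)
      ultimately show ?thesis
        using add[OF _ g gen[OF carrierD(1)[OF insert(4) True] True]] carrierD(1)[OF insert(4) True]
          free_gen_closed[OF True] F.smult_closed by metis
    qed
  qed
  thus ?thesis using f carrierD(2)[OF f] by blast
qed

text \<open>The linear extension of \<open>\<beta>\<close> from the generators to the free module.\<close>
definition free_lift :: "('a, 'q, 'z) module_scheme \<Rightarrow> ('s \<Rightarrow> 'q) \<Rightarrow> ('s \<Rightarrow> 'a) \<Rightarrow> 'q" where
  "free_lift Q \<beta> f = finsum Q (\<lambda>s. f s \<odot>\<^bsub>Q\<^esub> \<beta> s) {s \<in> S. f s \<noteq> \<zero>}"

lemma free_lift_superset: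
  assumes Q: "module R Q" and \<beta>: "\<And>s. s \<in> S \<Longrightarrow> \<beta> s \<in> carrier Q"
    and f: "f \<in> carrier (free_module R S)" and A: "finite A" "A \<subseteq> S" "{s \<in> S. f s \<noteq> \<zero>} \<subseteq> A"
  shows "free_lift Q \<beta> f = finsum Q (\<lambda>s. f s \<odot>\<^bsub>Q\<^esub> \<beta> s) A"
proof -
  interpret Q: module R Q by fact
  show ?thesis
    unfolding free_lift_def
  proof (rule Q.add.finprod_mono_neutral_cong_left[OF A(1) A(3)])
    fix i assume "i \<in> A - {s \<in> S. f s \<noteq> \<zero>}"
    thus "f i \<odot>\<^bsub>Q\<^esub> \<beta> i = \<zero>\<^bsub>Q\<^esub>" using A(2) \<beta> by auto
  qed (use A(2) \<beta> carrierD(1)[OF f] in auto)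
qed

lemma free_lift:
  assumes Q: "module R Q" and \<beta>: "\<And>s. s \<in> S \<Longrightarrow> \<beta> s \<in> carrier Q"
  shows "free_lift Q \<beta> \<in> mod_hom R (free_module R S) Q"
    and "s \<in> S \<Longrightarrow> free_lift Q \<beta> (free_gen R S s) = \<beta> s"
proof -
  interpret Q: module R Q by fact
  have sup: "free_lift Q \<beta> f = finsum Q (\<lambda>s. f s \<odot>\<^bsub>Q\<^esub> \<beta> s) A"
    if "f \<in> carrier (free_module R S)" "finite A" "A \<subseteq> S" "{s \<in> S. f s \<noteq> \<zero>} \<subseteq> A" for f A
    by (rule free_lift_superset[OF Q]) (use \<beta> that in auto)
  show "free_lift Q \<beta> \<in> mod_hom R (free_module R S) Q"
  proof (rule mod_homI)
    fix f assume f: "f \<in> carrier (free_module R S)"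
    show "free_lift Q \<beta> f \<in> carrier Q"
      unfolding free_lift_def using carrierD(1)[OF f] \<beta> by (intro Q.finsum_closed) auto
  next
    fix f g assume f: "f \<in> carrier (free_module R S)" and g: "g \<in> carrier (free_module R S)"
    let ?A = "{s \<in> S. f s \<noteq> \<zero>} \<union> {s \<in> S. g s \<noteq> \<zero>}"
    have A: "finite ?A" "?A \<subseteq> S" using carrierD(2)[OF f] carrierD(2)[OF g] by auto
    have fg: "f \<oplus>\<^bsub>free_module R S\<^esub> g \<in> carrier (free_module R S)" using f g by simp
    have "free_lift Q \<beta> (f \<oplus>\<^bsub>free_module R S\<^esub> g) = finsum Q (\<lambda>s. (f \<oplus>\<^bsub>free_module R S\<^esub> g) s \<odot>\<^bsub>Q\<^esub> \<beta> s) ?A"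
      by (rule sup[OF fg A]) (auto simp: free_module_simps(2-))
    also have "\<dots> = finsum Q (\<lambda>s. f s \<odot>\<^bsub>Q\<^esub> \<beta> s \<oplus>\<^bsub>Q\<^esub> g s \<odot>\<^bsub>Q\<^esub> \<beta> s) ?A"
    proof (rule Q.finsum_cong'[OF refl])
      fix s assume "s \<in> ?A"
      hence "s \<in> S" by auto
      thus "(f \<oplus>\<^bsub>free_module R S\<^esub> g) s \<odot>\<^bsub>Q\<^esub> \<beta> s = f s \<odot>\<^bsub>Q\<^esub> \<beta> s \<oplus>\<^bsub>Q\<^esub> g s \<odot>\<^bsub>Q\<^esub> \<beta> s"
        using carrierD(1)[OF f] carrierD(1)[OF g] \<beta> by (simp add: free_module_simps(3) Q.smult_l_distr)
    qed (use carrierD(1)[OF f] carrierD(1)[OF g] \<beta> in auto)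
    also have "\<dots> = finsum Q (\<lambda>s. f s \<odot>\<^bsub>Q\<^esub> \<beta> s) ?A \<oplus>\<^bsub>Q\<^esub> finsum Q (\<lambda>s. g s \<odot>\<^bsub>Q\<^esub> \<beta> s) ?A"
      by (rule Q.finsum_addf) (use carrierD(1)[OF f] carrierD(1)[OF g] \<beta> in auto)
    also have "\<dots> = free_lift Q \<beta> f \<oplus>\<^bsub>Q\<^esub> free_lift Q \<beta> g"
      using sup[OF f A] sup[OF g A] by auto
    finally show "free_lift Q \<beta> (f \<oplus>\<^bsub>free_module R S\<^esub> g) = free_lift Q \<beta> f \<oplus>\<^bsub>Q\<^esub> free_lift Q \<beta> g" .
  next
    fix a f assume a: "a \<in> carrier R" and f: "f \<in> carrier (free_module R S)"
    let ?A = "{s \<in> S. f s \<noteq> \<zero>}"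
    have A: "finite ?A" "?A \<subseteq> S" using carrierD(2)[OF f] by auto
    have af: "a \<odot>\<^bsub>free_module R S\<^esub> f \<in> carrier (free_module R S)" using f a by simp
    have "free_lift Q \<beta> (a \<odot>\<^bsub>free_module R S\<^esub> f) = finsum Q (\<lambda>s. (a \<odot>\<^bsub>free_module R S\<^esub> f) s \<odot>\<^bsub>Q\<^esub> \<beta> s) ?A"
      by (rule sup[OF af A]) (use a in \<open>auto simp: free_module_simps(2-)\<close>)
    also have "\<dots> = finsum Q (\<lambda>s. a \<odot>\<^bsub>Q\<^esub> (f s \<odot>\<^bsub>Q\<^esub> \<beta> s)) ?A"
    proof (rule Q.finsum_cong'[OF refl])
      fix s assume "s \<in> ?A"
      hence "s \<in> S" by auto
      thus "(a \<odot>\<^bsub>free_module R S\<^esub> f) s \<odot>\<^bsub>Q\<^esub> \<beta> s = a \<odot>\<^bsub>Q\<^esub> (f s \<odot>\<^bsub>Q\<^esub> \<beta> s)"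
        using carrierD(1)[OF f] a \<beta> by (simp add: free_module_simps(4) Q.smult_assoc1)
    qed (use carrierD(1)[OF f] a \<beta> in auto)
    also have "\<dots> = a \<odot>\<^bsub>Q\<^esub> free_lift Q \<beta> f"
      unfolding free_lift_def using carrierD(1)[OF f] \<beta> A(1) a by (subst Q.finsum_smult_ldistr) auto
    finally show "free_lift Q \<beta> (a \<odot>\<^bsub>free_module R S\<^esub> f) = a \<odot>\<^bsub>Q\<^esub> free_lift Q \<beta> f" .
  qed
  show "free_lift Q \<beta> (free_gen R S s) = \<beta> s" if s: "s \<in> S"
  proof -
    have "free_lift Q \<beta> (free_gen R S s) = finsum Q (\<lambda>t. free_gen R S s t \<odot>\<^bsub>Q\<^esub> \<beta> t) {s}"
      by (rule sup[OF free_gen_closed[OF s]]) (use s in \<open>auto simp: free_gen_def split: if_splits\<close>)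
    also have "\<dots> = \<beta> s" using s \<beta>[OF s] by (simp add: free_gen_def)
    finally show ?thesis .
  qed
qed

end

section \<open>Tensor products\<close>

locale tensor = M: module R M + N: module R N
  for R :: "('a, 'r) ring_scheme" and M :: "('a, 'b, 'm) module_scheme" and N :: "('a, 'c, 'n) module_scheme"
begin

sublocale F: free R "carrier M \<times> carrier N"
  by unfold_locales

abbreviation TF where "TF \<equiv> free_module R (carrier M \<times> carrier N)"
abbreviation T where "T \<equiv> tensor_module R M N"
abbreviation pt (infixl \<open>\<star>\<close> 75) where "x \<star> y \<equiv> pure_tensor R M N x y"

lemma gen_closed: "x \<in> carrier M \<Longrightarrow> y \<in> carrier N \<Longrightarrow> tensor_gen R M N x y \<in> carrier TF"
  by (rule F.free_gen_closed) simp

lemma tensor_rels_closed: "tensor_rels R M N \<subseteq> carrier TF"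
proof
  fix f assume "f \<in> tensor_rels R M N"
  thus "f \<in> carrier TF"
    by cases (auto intro!: F.F.minus_closed F.F.a_closed F.F.smult_closed gen_closed)
qed

sublocale Q: quotient R TF "tensor_null R M N"
proof (intro quotient.intro quotient_axioms.intro)
  show "submodule (tensor_null R M N) R TF"
    unfolding tensor_null_def by (rule submodule_gen_submodule[OF F.free_module tensor_rels_closed])
qed (rule F.free_module)

lemma T_module: "module R T"
  unfolding tensor_module_def by (rule Q.quot_module)

sublocale T: module R T by (rule T_module)

lemma rels_null: "f \<in> tensor_rels R M N \<Longrightarrow> f \<in> tensor_null R M N"
  using gen_submodule_superset[of "tensor_rels R M N" R TF] unfolding tensor_null_def by blast

lemma pure_closed [simp]: "x \<in> carrier M \<Longrightarrow> y \<in> carrier N \<Longrightarrow> x \<star> y \<in> carrier T"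
  unfolding tensor_module_def Q.quot_carrier pure_tensor_def using gen_closed by blast

lemma pure_add_left:
  assumes "x \<in> carrier M" "x' \<in> carrier M" "y \<in> carrier N"
  shows "(x \<oplus>\<^bsub>M\<^esub> x') \<star> y = (x \<star> y) \<oplus>\<^bsub>T\<^esub> (x' \<star> y)"
  unfolding tensor_module_def pure_tensor_def
  using assms by (subst Q.quot_add) (auto simp: Q.coset_eq_iff gen_closed intro!: rels_null tensor_rels.add_left)

lemma pure_add_right:
  assumes "x \<in> carrier M" "y \<in> carrier N" "y' \<in> carrier N"
  shows "x \<star> (y \<oplus>\<^bsub>N\<^esub> y') = (x \<star> y) \<oplus>\<^bsub>T\<^esub> (x \<star> y')"
  unfolding tensor_module_def pure_tensor_def
  using assms by (subst Q.quot_add) (auto simp: Q.coset_eq_iff gen_closed intro!: rels_null tensor_rels.add_right)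

lemma pure_smult_left:
  assumes "a \<in> carrier R" "x \<in> carrier M" "y \<in> carrier N"
  shows "(a \<odot>\<^bsub>M\<^esub> x) \<star> y = a \<odot>\<^bsub>T\<^esub> (x \<star> y)"
  unfolding tensor_module_def pure_tensor_def
  using assms by (subst Q.quot_smult) (auto simp: Q.coset_eq_iff gen_closed intro!: rels_null tensor_rels.smult_left)

lemma pure_smult_right:
  assumes "a \<in> carrier R" "x \<in> carrier M" "y \<in> carrier N"
  shows "x \<star> (a \<odot>\<^bsub>N\<^esub> y) = a \<odot>\<^bsub>T\<^esub> (x \<star> y)"
  unfolding tensor_module_def pure_tensor_def
  using assms by (subst Q.quot_smult) (auto simp: Q.coset_eq_iff gen_closed intro!: rels_null tensor_rels.smult_right)

lemma pure_hom_left: "y \<in> carrier N \<Longrightarrow> (\<lambda>x. x \<star> y) \<in> mod_hom R M T"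
  by (rule mod_homI) (auto simp: pure_add_left pure_smult_left)

lemma pure_hom_right: "x \<in> carrier M \<Longrightarrow> (\<lambda>y. x \<star> y) \<in> mod_hom R N T"
  by (rule mod_homI) (auto simp: pure_add_right pure_smult_right)

text \<open>Tensor products are spanned by pure tensors because the free module on pairs is spanned by its
  generators.\<close>
lemma tensor_induct [consumes 1, case_names pure add]:
  assumes t: "t \<in> carrier T"
    and pure: "\<And>a x y. a \<in> carrier R \<Longrightarrow> x \<in> carrier M \<Longrightarrow> y \<in> carrier N \<Longrightarrow> P (a \<odot>\<^bsub>T\<^esub> (x \<star> y))"
    and add: "\<And>s t. s \<in> carrier T \<Longrightarrow> t \<in> carrier T \<Longrightarrow> P s \<Longrightarrow> P t \<Longrightarrow> P (s \<oplus>\<^bsub>T\<^esub> t)"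
  shows "P t"
proof -
  let ?q = "\<lambda>f. tensor_null R M N +>\<^bsub>TF\<^esub> f"
  obtain f where f: "f \<in> carrier TF" "t = ?q f"
    using t unfolding tensor_module_def Q.quot_carrier by blast
  have "P (?q f)"
    using f(1)
  proof (induct rule: F.free_module_induct)
    case zero
    have "P (\<zero>\<^bsub>R\<^esub> \<odot>\<^bsub>T\<^esub> (\<zero>\<^bsub>M\<^esub> \<star> \<zero>\<^bsub>N\<^esub>))" by (rule pure) auto
    thus ?case using Q.quot_zero by (simp flip: tensor_module_def)
  next
    case (gen a s)
    then obtain x y where s: "s = (x, y)" "x \<in> carrier M" "y \<in> carrier N" by auto
    have "P (a \<odot>\<^bsub>T\<^esub> (x \<star> y))" by (rule pure) (use s gen in auto)
    thus ?case
      unfolding pure_tensor_def tensor_module_def using gen(1) gen_closed[OF s(2,3)]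
      by (simp add: Q.quot_smult s(1))
  next
    case (add f g)
    have "?q f \<in> carrier T" "?q g \<in> carrier T"
      using add(1,2) unfolding tensor_module_def Q.quot_carrier by auto
    from assms(3)[OF this add(3,4)] show ?case
      using add(1,2) unfolding tensor_module_def by (simp add: Q.quot_add)
  qed
  thus ?thesis using f by simp
qed

text \<open>The map out of the tensor product given by a bilinear \<open>\<beta>\<close>. The formula is that of \<open>tensor_map\<close>, with
  \<open>\<beta> x y\<close> in place of \<open>\<phi> x \<otimes> \<psi> y\<close>; taking \<open>\<beta>\<close> with values in \<open>R\<close> also yields coordinates on the tensor
  product.\<close>
definition tensor_lift :: "('a, 'q, 'z) module_scheme \<Rightarrow> ('b \<Rightarrow> 'c \<Rightarrow> 'q) \<Rightarrow> ('b \<times> 'c \<Rightarrow> 'a) set \<Rightarrow> 'q" where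
  "tensor_lift P \<beta> A = the_elem ((\<lambda>f. finsum P (\<lambda>(x, y). f (x, y) \<odot>\<^bsub>P\<^esub> \<beta> x y)
     {s \<in> carrier M \<times> carrier N. f s \<noteq> \<zero>\<^bsub>R\<^esub>}) ` A)"

lemma tensor_lift:
  assumes P: "module R P"
    and l: "\<And>y. y \<in> carrier N \<Longrightarrow> (\<lambda>x. \<beta> x y) \<in> mod_hom R M P"
    and r: "\<And>x. x \<in> carrier M \<Longrightarrow> (\<lambda>y. \<beta> x y) \<in> mod_hom R N P"
  shows "tensor_lift P \<beta> \<in> mod_hom R T P"
    and "x \<in> carrier M \<Longrightarrow> y \<in> carrier N \<Longrightarrow> tensor_lift P \<beta> (x \<star> y) = \<beta> x y"
proof -
  interpret P: module R P by fact
  let ?h = "F.free_lift P (case_prod \<beta>)"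
  have \<beta>: "case_prod \<beta> s \<in> carrier P" if "s \<in> carrier M \<times> carrier N" for s
    using that mod_homD(1)[OF l] by auto
  have h: "?h \<in> mod_hom R TF P" by (rule F.free_lift(1)[OF P \<beta>])
  have hg: "?h (tensor_gen R M N x y) = \<beta> x y" if "x \<in> carrier M" "y \<in> carrier N" for x y
    by (subst F.free_lift(2)[OF P]) (use \<beta> that in auto)
  have eq: "tensor_lift P \<beta> = (\<lambda>A. the_elem (?h ` A))"
    unfolding tensor_lift_def F.free_lift_def by (simp add: case_prod_beta' split_beta)
  have "tensor_rels R M N \<subseteq> {f \<in> carrier TF. ?h f = \<zero>\<^bsub>P\<^esub>}"
  proof (intro subsetI CollectI conjI)
    fix f assume f: "f \<in> tensor_rels R M N"
    thus "f \<in> carrier TF" using tensor_rels_closed by blast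
    note sub = mod_hom_minus[OF F.free_module P h]
    show "?h f = \<zero>\<^bsub>P\<^esub>"
      using f
      by cases (auto simp: sub mod_homD(2,3)[OF h] gen_closed hg mod_homD(2,3)[OF l] mod_homD(2,3)[OF r]
          mod_homD(1)[OF l] P.minus_eq P.r_neg)
  qed
  hence "tensor_null R M N \<subseteq> {f \<in> carrier TF. ?h f = \<zero>\<^bsub>P\<^esub>}"
    unfolding tensor_null_def by (intro gen_submodule_minimal submodule_kernel[OF F.free_module P h])
  hence ker: "\<And>f. f \<in> tensor_null R M N \<Longrightarrow> ?h f = \<zero>\<^bsub>P\<^esub>" by blast
  show "tensor_lift P \<beta> \<in> mod_hom R T P"
    unfolding eq tensor_module_def by (rule Q.quot_lift(2)[OF P h ker])
  show "x \<in> carrier M \<Longrightarrow> y \<in> carrier N \<Longrightarrow> tensor_lift P \<beta> (x \<star> y) = \<beta> x y"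
    unfolding eq pure_tensor_def using Q.quot_lift(1)[OF P h ker gen_closed] hg by simp
qed

end

lemma tensor_map:
  assumes "module R M" "module R N" "module R M'" "module R N'"
    and f: "\<phi> \<in> mod_hom R M M'" and g: "\<psi> \<in> mod_hom R N N'"
  shows "tensor_map R M N M' N' \<phi> \<psi> \<in> mod_hom R (tensor_module R M N) (tensor_module R M' N')"
    and "x \<in> carrier M \<Longrightarrow> y \<in> carrier N \<Longrightarrow>
      tensor_map R M N M' N' \<phi> \<psi> (pure_tensor R M N x y) = pure_tensor R M' N' (\<phi> x) (\<psi> y)"
proof -
  interpret T: tensor R M N using assms by (simp add: tensor_def)
  interpret T': tensor R M' N' using assms by (simp add: tensor_def)
  let ?\<beta> = "\<lambda>x y. pure_tensor R M' N' (\<phi> x) (\<psi> y)"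
  have eq: "tensor_map R M N M' N' \<phi> \<psi> = T.tensor_lift (tensor_module R M' N') ?\<beta>"
    by (simp add: fun_eq_iff tensor_map_def T.tensor_lift_def)
  have l: "(\<lambda>x. ?\<beta> x y) \<in> mod_hom R M (tensor_module R M' N')" if "y \<in> carrier N" for y
    by (rule mod_homI) (use that in \<open>simp_all add: mod_homD[OF f] mod_homD[OF g] T'.pure_add_left T'.pure_smult_left\<close>)
  have r: "(\<lambda>y. ?\<beta> x y) \<in> mod_hom R N (tensor_module R M' N')" if "x \<in> carrier M" for x
    by (rule mod_homI) (use that in \<open>simp_all add: mod_homD[OF f] mod_homD[OF g] T'.pure_add_right T'.pure_smult_right\<close>)
  show "tensor_map R M N M' N' \<phi> \<psi> \<in> mod_hom R (tensor_module R M N) (tensor_module R M' N')"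
    unfolding eq by (rule T.tensor_lift(1)[OF T'.T_module l r])
  show "x \<in> carrier M \<Longrightarrow> y \<in> carrier N \<Longrightarrow>
      tensor_map R M N M' N' \<phi> \<psi> (pure_tensor R M N x y) = pure_tensor R M' N' (\<phi> x) (\<psi> y)"
    unfolding eq by (rule T.tensor_lift(2)[OF T'.T_module l r])
qed

section \<open>Homogeneous coordinates\<close>

lemma module_mpoly_ring: "module mpoly_ring (mpoly_ring :: (('n::finite, 'k::field) mpoly, ('n, 'k) mpoly) graded_module)"
proof -
  interpret cring "mpoly_ring :: (('n, 'k) mpoly, ('n, 'k) mpoly) graded_module" by (rule cring_mpoly_ring)
  show ?thesis
    by (rule moduleI) (simp_all add: cring_mpoly_ring is_abelian_group distrib_left distrib_right mult.assoc)
qed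

text \<open>Graded tensor products, graded quotients and the modules that underlie them are records of different
  types, so that equations between them are not available.\<close>
lemma module_cong:
  assumes "module R M" and eq: "carrier M' = carrier M" "ring.add M' = ring.add M" "ring.zero M' = ring.zero M" "smult M' = smult M"
  shows "module R M'"
proof -
  interpret M: module R M by fact
  show ?thesis
  proof (rule moduleI)
    show "abelian_group M'"
    proof (rule abelian_groupI)
      show "\<exists>y\<in>carrier M'. y \<oplus>\<^bsub>M'\<^esub> x = \<zero>\<^bsub>M'\<^esub>" if "x \<in> carrier M'" for x
        using that M.l_neg[of x] by (intro bexI[of _ "\<ominus>\<^bsub>M\<^esub> x"]) (simp_all add: eq)
    qed (auto simp: eq M.a_assoc intro: M.a_comm)
  qed (simp_all add: eq M.smult_l_distr M.smult_r_distr M.smult_assoc1 M.R.is_cring)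
qed

lemma finsum_in_subgroup:
  assumes "abelian_group M" "subgroup H (add_monoid M)" "\<And>a. a \<in> A \<Longrightarrow> f a \<in> H"
  shows "finsum M f A \<in> H"
proof -
  interpret M: abelian_group M by fact
  have H: "H \<subseteq> carrier M" "\<zero>\<^bsub>M\<^esub> \<in> H" "\<And>x y. x \<in> H \<Longrightarrow> y \<in> H \<Longrightarrow> x \<oplus>\<^bsub>M\<^esub> y \<in> H"
    using subgroup.subset[OF assms(2)] subgroup.one_closed[OF assms(2)] subgroup.m_closed[OF assms(2)] by auto
  show ?thesis
    using assms(3)
  proof (induct A rule: infinite_finite_induct)
    case (insert a A)
    hence "finsum M f (insert a A) = f a \<oplus>\<^bsub>M\<^esub> finsum M f A"
      using H(1) by (intro M.finsum_insert) auto
    thus ?case using insert H(3) by auto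
  qed (use H in auto)
qed

lemma homog_decomposition:
  assumes "finite D" "mdeg ` keys p \<subseteq> D"
  shows "p = (\<Sum>d\<in>D. filt (\<lambda>m. mdeg m = d) p)"
proof (rule poly_mapping_eqI)
  fix m
  show "lookup p m = lookup (\<Sum>d\<in>D. filt (\<lambda>m. mdeg m = d) p) m"
    using assms by (auto simp: lookup_sum lookup_filt in_keys_iff image_subset_iff)
qed

lemma homog_component:
  assumes "finite D" "\<And>d. d \<in> D \<Longrightarrow> homog w (d - e) (q d)"
  shows "filt (\<lambda>m. w m = d - e) (\<Sum>d\<in>D. q d) = (if d \<in> D then q d else 0)"
proof -
  have "filt (\<lambda>m. w m = d - e) (q d') = (if d' = d then q d else 0)" if d': "d' \<in> D" for d'
  proof (cases "d' = d")
    case True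
    thus ?thesis using assms(2)[OF d'] by (simp add: homog_iff_filt)
  next
    case False
    thus ?thesis using assms(2)[OF d']
      by (intro poly_mapping_eqI) (auto simp: lookup_filt homog_def in_keys_iff)
  qed
  hence "filt (\<lambda>m. w m = d - e) (\<Sum>d\<in>D. q d) = (\<Sum>d'\<in>D. if d' = d then q d else 0)"
    unfolding filt_sum by (rule sum.cong[OF refl])
  thus ?thesis using assms(1) by simp
qed

text \<open>Coordinates with respect to a finite basis that is indexed by \<open>Z\<close>, given by their values rather than by
  the basis. Nothing is required of \<open>\<phi> x\<close> outside \<open>Z\<close>.\<close>
locale free_coords =
  fixes M :: "(('n::finite, 'k::field) mpoly, 'b) graded_module" and Z :: "'z set" and dg :: "'z \<Rightarrow> int"
    and \<phi> :: "'b \<Rightarrow> 'z \<Rightarrow> ('n, 'k) mpoly"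
  assumes mod: "module mpoly_ring M"
    and finite_Z: "finite Z"
    and add: "x \<in> carrier M \<Longrightarrow> y \<in> carrier M \<Longrightarrow> s \<in> Z \<Longrightarrow> \<phi> (x \<oplus>\<^bsub>M\<^esub> y) s = \<phi> x s + \<phi> y s"
    and smult: "x \<in> carrier M \<Longrightarrow> s \<in> Z \<Longrightarrow> \<phi> (a \<odot>\<^bsub>M\<^esub> x) s = a * \<phi> x s"
    and inj: "x \<in> carrier M \<Longrightarrow> y \<in> carrier M \<Longrightarrow> (\<And>s. s \<in> Z \<Longrightarrow> \<phi> x s = \<phi> y s) \<Longrightarrow> x = y"
    and surj: "\<exists>x\<in>carrier M. \<forall>s\<in>Z. \<phi> x s = f s"
begin

sublocale module mpoly_ring M by (rule mod)

lemma hom: "s \<in> Z \<Longrightarrow> (\<lambda>x. \<phi> x s) \<in> mod_hom mpoly_ring M mpoly_ring"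
  by (rule mod_homI) (auto simp: add smult)

lemma smult_closed' [simp]: "x \<in> carrier M \<Longrightarrow> a \<odot>\<^bsub>M\<^esub> x \<in> carrier M"
  by (rule smult_closed) auto

lemma coord_zero: "s \<in> Z \<Longrightarrow> \<phi> \<zero>\<^bsub>M\<^esub> s = 0"
  using mod_hom_zero[OF mod module_mpoly_ring hom] by simp

lemma coord_finsum:
  assumes "s \<in> Z" "\<And>a. a \<in> A \<Longrightarrow> f a \<in> carrier M"
  shows "\<phi> (finsum M f A) s = (\<Sum>a\<in>A. \<phi> (f a) s)"
  using assms(2)
proof (induct A rule: infinite_finite_induct)
  case (insert a A)
  have "\<phi> (finsum M f (insert a A)) s = \<phi> (f a \<oplus>\<^bsub>M\<^esub> finsum M f A) s"
    using insert by (subst finsum_insert) auto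
  also have "\<dots> = \<phi> (f a) s + \<phi> (finsum M f A) s"
    using insert assms(1) by (intro add finsum_closed) auto
  finally show ?case using insert by simp
qed (simp_all add: coord_zero assms(1))

lemma coord_uminus: "s \<in> Z \<Longrightarrow> x \<in> carrier M \<Longrightarrow> \<phi> (\<ominus>\<^bsub>M\<^esub> x) s = - \<phi> x s"
  using add[of "\<ominus>\<^bsub>M\<^esub> x" x s] by (simp add: l_neg coord_zero eq_neg_iff_add_eq_0)

definition el :: "('z \<Rightarrow> ('n, 'k) mpoly) \<Rightarrow> 'b" where
  "el f = (SOME x. x \<in> carrier M \<and> (\<forall>s\<in>Z. \<phi> x s = f s))"

lemma el_props: "el f \<in> carrier M \<and> (\<forall>s\<in>Z. \<phi> (el f) s = f s)"
  unfolding el_def by (rule someI_ex) (use surj[of f] in blast)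

lemma el_closed [simp]: "el f \<in> carrier M"
  and coord_el: "s \<in> Z \<Longrightarrow> \<phi> (el f) s = f s"
  using el_props by auto

definition ev :: "'z \<Rightarrow> 'b" where
  "ev s = el (\<lambda>t. if t = s then 1 else 0)"

lemma ev_closed [simp]: "ev s \<in> carrier M"
  and coord_ev: "t \<in> Z \<Longrightarrow> \<phi> (ev s) t = (if t = s then 1 else 0)"
  by (simp_all add: ev_def coord_el)

lemma inj_on_ev: "inj_on ev Z"
proof (rule inj_onI)
  fix s t assume "s \<in> Z" "t \<in> Z" "ev s = ev t"
  thus "s = t" using coord_ev[of s s] coord_ev[of s t] by (simp split: if_splits)
qed

lemma expansion:
  assumes x: "x \<in> carrier M"
  shows "x = finsum M (\<lambda>s. \<phi> x s \<odot>\<^bsub>M\<^esub> ev s) Z"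
proof (rule inj[OF x finsum_closed])
  fix t assume t: "t \<in> Z"
  have "\<phi> (finsum M (\<lambda>s. \<phi> x s \<odot>\<^bsub>M\<^esub> ev s) Z) t = (\<Sum>s\<in>Z. \<phi> x s * (if t = s then 1 else 0))"
    using t by (simp add: coord_finsum smult coord_ev)
  also have "\<dots> = (\<Sum>s\<in>Z. if t = s then \<phi> x s else 0)"
    by (rule sum.cong) auto
  finally show "\<phi> x t = \<phi> (finsum M (\<lambda>s. \<phi> x s \<odot>\<^bsub>M\<^esub> ev s) Z) t" using t finite_Z by simp
qed auto

text \<open>The component of degree \<open>d\<close> if the basis element with index \<open>s\<close> has degree \<open>dg s\<close>.\<close>
definition comp :: "'b \<Rightarrow> int \<Rightarrow> 'b" where
  "comp x d = el (\<lambda>s. filt (\<lambda>m. mdeg m = d - dg s) (\<phi> x s))"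

lemma comp_closed [simp]: "comp x d \<in> carrier M"
  and coord_comp: "s \<in> Z \<Longrightarrow> \<phi> (comp x d) s = filt (\<lambda>m. mdeg m = d - dg s) (\<phi> x s)"
  by (simp_all add: comp_def coord_el)

lemma comp_decomposition:
  assumes x: "x \<in> carrier M"
  shows "finite {d. comp x d \<noteq> \<zero>\<^bsub>M\<^esub>}" "x = finsum M (comp x) {d. comp x d \<noteq> \<zero>\<^bsub>M\<^esub>}"
proof -
  define D where "D = (\<Union>s\<in>Z. (\<lambda>m. mdeg m + dg s) ` keys (\<phi> x s))"
  have D: "finite D" unfolding D_def using finite_Z by auto
  have out: "comp x d = \<zero>\<^bsub>M\<^esub>" if "d \<notin> D" for d
  proof (rule inj[OF comp_closed zero_closed])
    fix s assume s: "s \<in> Z"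
    have "filt (\<lambda>m. mdeg m = d - dg s) (\<phi> x s) = 0"
    proof (rule poly_mapping_eqI)
      fix m
      have "lookup (\<phi> x s) m = 0" if "mdeg m = d - dg s"
      proof (rule ccontr)
        assume "lookup (\<phi> x s) m \<noteq> 0"
        hence "mdeg m + dg s \<in> D" unfolding D_def by (intro UN_I[OF s] imageI) (simp add: in_keys_iff)
        thus False using that \<open>d \<notin> D\<close> by simp
      qed
      thus "lookup (filt (\<lambda>m. mdeg m = d - dg s) (\<phi> x s)) m = lookup 0 m"
        by (simp add: lookup_filt)
    qed
    thus "\<phi> (comp x d) s = \<phi> \<zero>\<^bsub>M\<^esub> s" using s by (simp add: coord_comp coord_zero)
  qed
  hence sub: "{d. comp x d \<noteq> \<zero>\<^bsub>M\<^esub>} \<subseteq> D" by blast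
  show fin: "finite {d. comp x d \<noteq> \<zero>\<^bsub>M\<^esub>}" by (rule finite_subset[OF sub D])
  show "x = finsum M (comp x) {d. comp x d \<noteq> \<zero>\<^bsub>M\<^esub>}"
  proof (rule inj[OF x finsum_closed])
    fix s assume s: "s \<in> Z"
    have "\<phi> (finsum M (comp x) {d. comp x d \<noteq> \<zero>\<^bsub>M\<^esub>}) s = (\<Sum>d | comp x d \<noteq> \<zero>\<^bsub>M\<^esub>. \<phi> (comp x d) s)"
      by (rule coord_finsum[OF s]) simp
    also have "\<dots> = (\<Sum>d\<in>D. \<phi> (comp x d) s)"
      using sub D s by (intro sum.mono_neutral_left) (auto simp: coord_zero)
    also have "\<dots> = (\<Sum>d\<in>D. filt (\<lambda>m. mdeg m = d - dg s) (\<phi> x s))"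
      using s by (simp add: coord_comp)
    also have "\<dots> = (\<Sum>e\<in>(\<lambda>d. d - dg s) ` D. filt (\<lambda>m. mdeg m = e) (\<phi> x s))"
      by (subst sum.reindex) (auto simp: inj_on_def)
    also have "\<dots> = \<phi> x s"
    proof (rule homog_decomposition[symmetric])
      show "mdeg ` keys (\<phi> x s) \<subseteq> (\<lambda>d. d - dg s) ` D"
      proof (rule image_subsetI)
        fix m assume "m \<in> keys (\<phi> x s)"
        hence "mdeg m + dg s \<in> D" unfolding D_def by (intro UN_I[OF s] imageI)
        thus "mdeg m \<in> (\<lambda>d. d - dg s) ` D" by (rule rev_image_eqI) simp
      qed
    qed (use D in simp)
    finally show "\<phi> x s = \<phi> (finsum M (comp x) {d. comp x d \<noteq> \<zero>\<^bsub>M\<^esub>}) s" by simp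
  qed simp
qed

end

text \<open>Here the grading of \<open>M\<close> is the one for which the basis elements are homogeneous of degree \<open>dg s\<close>.\<close>
locale graded_coords = free_coords M Z dg \<phi>
  for M :: "(('n::finite, 'k::field) mpoly, 'b) graded_module" and Z :: "'z set" and dg \<phi> +
  assumes part: "part M d = {x \<in> carrier M. \<forall>s\<in>Z. homog mdeg (d - dg s) (\<phi> x s)}"
begin

lemma ev_part: "s \<in> Z \<Longrightarrow> ev s \<in> part M (dg s)"
  by (auto simp: part coord_ev homog_def mdeg_def)

lemma graded: "is_graded_module mpoly_ring M"
  unfolding is_graded_module_def
proof (intro conjI allI ballI)
  fix d
  have "subgroup (part M d) (add_monoid M)"
  proof (rule add.subgroupI)
    have "\<zero>\<^bsub>M\<^esub> \<in> part M d" by (simp add: part coord_zero)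
    thus "part M d \<noteq> {}" by blast
  qed (auto simp: part add coord_uminus intro!: homog_add homog_uminus simp flip: a_inv_def)
  thus "additive_subgroup (part M d) M" by (rule additive_subgroup.intro)
next
  fix d e x and a :: "('n, 'k) mpoly" assume a: "a \<in> part mpoly_ring d" and x: "x \<in> part M e"
  have "homog mdeg (d + e - dg s) (a * \<phi> x s)" if "s \<in> Z" for s
    using homog_mult[OF mdeg_add, of d a "e - dg s" "\<phi> x s"] a x that
    by (simp add: part part_mpoly_ring algebra_simps)
  thus "a \<odot>\<^bsub>M\<^esub> x \<in> part M (d + e)" using x by (simp add: part smult)
next
  fix x assume x: "x \<in> carrier M"
  show "\<exists>!c. (\<forall>d. c d \<in> part M d) \<and> finite {d. c d \<noteq> \<zero>\<^bsub>M\<^esub>} \<and> x = finsum M c {d. c d \<noteq> \<zero>\<^bsub>M\<^esub>}"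
  proof (rule ex1I[of _ "comp x"])
    show "(\<forall>d. comp x d \<in> part M d) \<and> finite {d. comp x d \<noteq> \<zero>\<^bsub>M\<^esub>} \<and> x = finsum M (comp x) {d. comp x d \<noteq> \<zero>\<^bsub>M\<^esub>}"
      using comp_decomposition[OF x] by (simp add: part coord_comp homog_filt)
  next
    fix c assume c: "(\<forall>d. c d \<in> part M d) \<and> finite {d. c d \<noteq> \<zero>\<^bsub>M\<^esub>} \<and> x = finsum M c {d. c d \<noteq> \<zero>\<^bsub>M\<^esub>}"
    have cc: "c d \<in> carrier M" for d using c by (auto simp: part)
    show "c = comp x"
    proof
      fix d
      show "c d = comp x d"
      proof (rule inj[OF cc comp_closed])
        fix s assume s: "s \<in> Z"
        have "\<phi> x s = \<phi> (finsum M c {d. c d \<noteq> \<zero>\<^bsub>M\<^esub>}) s" using c by simp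
        also have "\<dots> = (\<Sum>d | c d \<noteq> \<zero>\<^bsub>M\<^esub>. \<phi> (c d) s)"
          by (rule coord_finsum[OF s]) (rule cc)
        finally have "\<phi> (comp x d) s = filt (\<lambda>m. mdeg m = d - dg s) (\<Sum>d | c d \<noteq> \<zero>\<^bsub>M\<^esub>. \<phi> (c d) s)"
          using s by (simp add: coord_comp)
        also have "\<dots> = (if d \<in> {d. c d \<noteq> \<zero>\<^bsub>M\<^esub>} then \<phi> (c d) s else 0)"
          using c s by (intro homog_component) (auto simp: part)
        finally show "\<phi> (c d) s = \<phi> (comp x d) s" using s by (auto simp: coord_zero)
      qed
    qed
  qed
qed (rule mod)

lemma coord_finsum_ev:
  assumes t: "t \<in> Z"
  shows "\<phi> (finsum M (\<lambda>b. c b \<odot>\<^bsub>M\<^esub> b) (ev ` Z)) t = c (ev t)"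
proof -
  have "\<phi> (finsum M (\<lambda>b. c b \<odot>\<^bsub>M\<^esub> b) (ev ` Z)) t = (\<Sum>b\<in>ev ` Z. \<phi> (c b \<odot>\<^bsub>M\<^esub> b) t)"
    by (rule coord_finsum[OF t]) auto
  also have "\<dots> = (\<Sum>s\<in>Z. c (ev s) * (if t = s then 1 else 0))"
    using t by (simp add: sum.reindex[OF inj_on_ev] smult coord_ev)
  also have "\<dots> = (\<Sum>s\<in>Z. if t = s then c (ev s) else 0)"
    by (rule sum.cong) auto
  also have "\<dots> = c (ev t)" using t finite_Z by simp
  finally show ?thesis .
qed

lemma graded_free: "graded_free mpoly_ring M"
  unfolding graded_free_def
proof (intro conjI graded exI[of _ "ev ` Z"] ballI)
  show "finite (ev ` Z)" using finite_Z by simp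
  show "ev ` Z \<subseteq> (\<Union>d. part M d)" using ev_part by blast
  fix x assume x: "x \<in> carrier M"
  have char: "x = finsum M (\<lambda>b. c b \<odot>\<^bsub>M\<^esub> b) (ev ` Z) \<longleftrightarrow> (\<forall>s\<in>Z. c (ev s) = \<phi> x s)" for c
  proof
    assume "x = finsum M (\<lambda>b. c b \<odot>\<^bsub>M\<^esub> b) (ev ` Z)"
    thus "\<forall>s\<in>Z. c (ev s) = \<phi> x s" using coord_finsum_ev by metis
  next
    assume *: "\<forall>s\<in>Z. c (ev s) = \<phi> x s"
    show "x = finsum M (\<lambda>b. c b \<odot>\<^bsub>M\<^esub> b) (ev ` Z)"
      by (rule inj[OF x finsum_closed]) (use * coord_finsum_ev in auto)
  qed
  show "\<exists>!c. c \<in> ev ` Z \<rightarrow>\<^sub>E carrier mpoly_ring \<and> x = finsum M (\<lambda>b. c b \<odot>\<^bsub>M\<^esub> b) (ev ` Z)"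
    unfolding char
  proof (rule ex1I[of _ "\<lambda>b\<in>ev ` Z. \<phi> x (inv_into Z ev b)"])
    show "(\<lambda>b\<in>ev ` Z. \<phi> x (inv_into Z ev b)) \<in> ev ` Z \<rightarrow>\<^sub>E carrier mpoly_ring \<and>
      (\<forall>s\<in>Z. (\<lambda>b\<in>ev ` Z. \<phi> x (inv_into Z ev b)) (ev s) = \<phi> x s)"
      using inj_on_ev by (auto simp: inv_into_f_f)
  next
    fix c assume c: "c \<in> ev ` Z \<rightarrow>\<^sub>E carrier mpoly_ring \<and> (\<forall>s\<in>Z. c (ev s) = \<phi> x s)"
    show "c = (\<lambda>b\<in>ev ` Z. \<phi> x (inv_into Z ev b))"
    proof (rule extensionalityI[of _ "ev ` Z"])
      show "c \<in> extensional (ev ` Z)" using c by (auto simp: PiE_def)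
    qed (use c inj_on_ev in \<open>auto simp: inv_into_f_f\<close>)
  qed
qed

text \<open>For the irrelevant ideal \<open>K\<close> this expresses minimality by the entries of the differentials.\<close>
lemma coords_in_ideal:
  assumes K: "ideal_set K" and x: "x \<in> carrier M"
  shows "x \<in> gen_submodule mpoly_ring M {a \<odot>\<^bsub>M\<^esub> y |a y. a \<in> K \<and> y \<in> carrier M} \<longleftrightarrow> (\<forall>s\<in>Z. \<phi> x s \<in> K)"
proof
  let ?S = "{a \<odot>\<^bsub>M\<^esub> y |a y. a \<in> K \<and> y \<in> carrier M}"
  have "submodule {x \<in> carrier M. \<forall>s\<in>Z. \<phi> x s \<in> K} mpoly_ring M"
    by (rule submoduleI) (auto simp: coord_zero coord_uminus add smult ideal_setD[OF K])
  moreover have "?S \<subseteq> {x \<in> carrier M. \<forall>s\<in>Z. \<phi> x s \<in> K}"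
    by (auto simp: smult ideal_setD[OF K])
  ultimately have "gen_submodule mpoly_ring M ?S \<subseteq> {x \<in> carrier M. \<forall>s\<in>Z. \<phi> x s \<in> K}"
    by (rule gen_submodule_minimal)
  thus "x \<in> gen_submodule mpoly_ring M ?S \<Longrightarrow> \<forall>s\<in>Z. \<phi> x s \<in> K" by blast
  assume *: "\<forall>s\<in>Z. \<phi> x s \<in> K"
  have sub: "submodule (gen_submodule mpoly_ring M ?S) mpoly_ring M"
    by (rule submodule_gen_submodule[OF mod]) auto
  have "finsum M (\<lambda>s. \<phi> x s \<odot>\<^bsub>M\<^esub> ev s) Z \<in> gen_submodule mpoly_ring M ?S"
  proof (rule finsum_in_subgroup[OF module.axioms(2)[OF mod] submodule.axioms(1)[OF sub]])
    fix s assume s: "s \<in> Z"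
    hence "\<phi> x s \<odot>\<^bsub>M\<^esub> ev s \<in> ?S" using * ev_closed by blast
    thus "\<phi> x s \<odot>\<^bsub>M\<^esub> ev s \<in> gen_submodule mpoly_ring M ?S"
      by (rule subsetD[OF gen_submodule_superset])
  qed
  thus "x \<in> gen_submodule mpoly_ring M ?S" using expansion[OF x] by simp
qed

end

text \<open>The coordinates are those with respect to a homogeneous basis. That an element of degree \<open>d\<close> has
  homogeneous coordinates follows from uniqueness of its decomposition: the components formed in
  coordinates are one decomposition, and the element alone in degree \<open>d\<close> is another.\<close>
lemma graded_free_coords:
  fixes M :: "(('n::finite, 'k::field) mpoly, 'b) graded_module"
  assumes "graded_free mpoly_ring M"
  obtains Z :: "'b set" and dg \<phi> where "graded_coords M Z dg \<phi>"
proof -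
  have gr: "is_graded_module mpoly_ring M" using assms by (simp add: graded_free_def)
  interpret module mpoly_ring M using gr by (simp add: is_graded_module_def)
  obtain Z where ZZ: "finite Z \<and> Z \<subseteq> (\<Union>d. part M d) \<and>
      (\<forall>x\<in>carrier M. \<exists>!c. c \<in> Z \<rightarrow>\<^sub>E carrier mpoly_ring \<and> x = finsum M (\<lambda>b. c b \<odot>\<^bsub>M\<^esub> b) Z)"
    using assms[unfolded graded_free_def, THEN conjunct2] by (rule exE)
  note Z = ZZ[THEN conjunct1] ZZ[THEN conjunct2, THEN conjunct1]
    and basis = ZZ[THEN conjunct2, THEN conjunct2, THEN bspec]
  have addsub: "additive_subgroup (part M d) M" for d using gr by (simp add: is_graded_module_def)
  have pc: "part M d \<subseteq> carrier M" for d using additive_subgroup.a_subset[OF addsub] .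
  have Zc: "b \<in> carrier M" if "b \<in> Z" for b using Z(2) pc that by blast
  have "\<forall>b. \<exists>d. b \<in> Z \<longrightarrow> b \<in> part M d" using Z(2) by blast
  from choice[OF this] obtain dg where dg: "\<And>b. b \<in> Z \<Longrightarrow> b \<in> part M (dg b)" by blast
  define \<phi> where "\<phi> x = (THE c. c \<in> Z \<rightarrow>\<^sub>E carrier mpoly_ring \<and> x = finsum M (\<lambda>b. c b \<odot>\<^bsub>M\<^esub> b) Z)" for x
  have \<phi>: "x = finsum M (\<lambda>b. \<phi> x b \<odot>\<^bsub>M\<^esub> b) Z" if "x \<in> carrier M" for x
    using theI'[OF basis[OF that]] unfolding \<phi>_def by (rule conjunct2)
  have uniq: "\<phi> x b = c b" if x: "x = finsum M (\<lambda>b. c b \<odot>\<^bsub>M\<^esub> b) Z" and b: "b \<in> Z" for x c b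
  proof -
    have xc: "x \<in> carrier M" unfolding x by (rule finsum_closed) (auto simp: Zc)
    have "x = finsum M (\<lambda>b. restrict c Z b \<odot>\<^bsub>M\<^esub> b) Z"
      unfolding x by (rule finsum_cong') (auto simp: Zc)
    hence "\<phi> x = restrict c Z"
      unfolding \<phi>_def by (intro the1_equality[OF basis[OF xc]]) auto
    thus ?thesis using b by simp
  qed
  have add: "\<phi> (x \<oplus>\<^bsub>M\<^esub> y) s = \<phi> x s + \<phi> y s" if x: "x \<in> carrier M" and y: "y \<in> carrier M" and s: "s \<in> Z" for x y s
  proof (rule uniq[OF _ s])
    have "x \<oplus>\<^bsub>M\<^esub> y = finsum M (\<lambda>b. \<phi> x b \<odot>\<^bsub>M\<^esub> b) Z \<oplus>\<^bsub>M\<^esub> finsum M (\<lambda>b. \<phi> y b \<odot>\<^bsub>M\<^esub> b) Z"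
      using \<phi>[OF x] \<phi>[OF y] by simp
    also have "\<dots> = finsum M (\<lambda>b. \<phi> x b \<odot>\<^bsub>M\<^esub> b \<oplus>\<^bsub>M\<^esub> \<phi> y b \<odot>\<^bsub>M\<^esub> b) Z"
      by (rule finsum_addf[symmetric]) (auto simp: Zc)
    also have "\<dots> = finsum M (\<lambda>b. (\<phi> x b + \<phi> y b) \<odot>\<^bsub>M\<^esub> b) Z"
    proof (rule finsum_cong'[OF refl])
      fix b assume "b \<in> Z"
      thus "\<phi> x b \<odot>\<^bsub>M\<^esub> b \<oplus>\<^bsub>M\<^esub> \<phi> y b \<odot>\<^bsub>M\<^esub> b = (\<phi> x b + \<phi> y b) \<odot>\<^bsub>M\<^esub> b"
        using smult_l_distr[of "\<phi> x b" "\<phi> y b" b] by (simp add: Zc)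
    qed (auto simp: Zc)
    finally show "x \<oplus>\<^bsub>M\<^esub> y = finsum M (\<lambda>b. (\<phi> x b + \<phi> y b) \<odot>\<^bsub>M\<^esub> b) Z" .
  qed
  have smult: "\<phi> (a \<odot>\<^bsub>M\<^esub> x) s = a * \<phi> x s" if x: "x \<in> carrier M" and s: "s \<in> Z" for a x s
  proof (rule uniq[OF _ s])
    have "a \<odot>\<^bsub>M\<^esub> x = a \<odot>\<^bsub>M\<^esub> finsum M (\<lambda>b. \<phi> x b \<odot>\<^bsub>M\<^esub> b) Z" using \<phi>[OF x] by simp
    also have "\<dots> = finsum M (\<lambda>b. a \<odot>\<^bsub>M\<^esub> (\<phi> x b \<odot>\<^bsub>M\<^esub> b)) Z"
      by (rule finsum_smult_ldistr[OF Z(1)]) (auto simp: Zc)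
    also have "\<dots> = finsum M (\<lambda>b. (a * \<phi> x b) \<odot>\<^bsub>M\<^esub> b) Z"
    proof (rule finsum_cong'[OF refl])
      fix b assume "b \<in> Z"
      thus "a \<odot>\<^bsub>M\<^esub> (\<phi> x b \<odot>\<^bsub>M\<^esub> b) = (a * \<phi> x b) \<odot>\<^bsub>M\<^esub> b"
        using smult_assoc1[of a "\<phi> x b" b] by (simp add: Zc)
    qed (auto simp: Zc)
    finally show "a \<odot>\<^bsub>M\<^esub> x = finsum M (\<lambda>b. (a * \<phi> x b) \<odot>\<^bsub>M\<^esub> b) Z" .
  qed
  have inj: "x = y" if "x \<in> carrier M" "y \<in> carrier M" "\<And>s. s \<in> Z \<Longrightarrow> \<phi> x s = \<phi> y s" for x y
  proof -
    have "finsum M (\<lambda>b. \<phi> x b \<odot>\<^bsub>M\<^esub> b) Z = finsum M (\<lambda>b. \<phi> y b \<odot>\<^bsub>M\<^esub> b) Z"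
      by (rule finsum_cong') (use that(3) Zc in auto)
    thus ?thesis using \<phi>[OF that(1)] \<phi>[OF that(2)] by simp
  qed
  have surj: "\<exists>x\<in>carrier M. \<forall>s\<in>Z. \<phi> x s = f s" for f
    by (rule bexI[of _ "finsum M (\<lambda>b. f b \<odot>\<^bsub>M\<^esub> b) Z"]) (auto simp: Zc uniq intro!: finsum_closed)
  have gsmult: "a \<odot>\<^bsub>M\<^esub> x \<in> part M (d + e)" if "homog mdeg d a" "x \<in> part M e" for a x d e
    using gr that unfolding is_graded_module_def part_mpoly_ring[symmetric] by blast
  have homog_part: "finsum M (\<lambda>b. c b \<odot>\<^bsub>M\<^esub> b) Z \<in> part M d"
    if "\<And>b. b \<in> Z \<Longrightarrow> homog mdeg (d - dg b) (c b)" for c d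
  proof (rule finsum_in_subgroup[OF module.axioms(2)[OF module_axioms] additive_subgroup.a_subgroup[OF addsub]])
    fix b assume b: "b \<in> Z"
    show "c b \<odot>\<^bsub>M\<^esub> b \<in> part M d" using gsmult[OF that[OF b] dg[OF b]] by simp
  qed
  interpret K: free_coords M Z dg \<phi>
    by (rule free_coords.intro) (fact module_axioms Z(1) add smult inj surj)+
  have part: "part M d = {x \<in> carrier M. \<forall>s\<in>Z. homog mdeg (d - dg s) (\<phi> x s)}" for d
  proof (intro subset_antisym subsetI CollectI conjI ballI)
    fix x assume "x \<in> {x \<in> carrier M. \<forall>s\<in>Z. homog mdeg (d - dg s) (\<phi> x s)}"
    thus "x \<in> part M d" using homog_part[of d "\<phi> x"] \<phi>[of x] by simp
  next
    fix x assume xd: "x \<in> part M d"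
    show x: "x \<in> carrier M" using xd pc by blast
    have cp: "K.comp x e \<in> part M e" for e
      by (subst \<phi>[OF K.comp_closed]) (rule homog_part, simp add: K.coord_comp homog_filt)
    define c' where "c' e = (if e = d then x else \<zero>\<^bsub>M\<^esub>)" for e
    have zp: "\<zero>\<^bsub>M\<^esub> \<in> part M e" for e using additive_subgroup.zero_closed[OF addsub] .
    have c'set: "{e. c' e \<noteq> \<zero>\<^bsub>M\<^esub>} = (if x = \<zero>\<^bsub>M\<^esub> then {} else {d})" by (auto simp: c'_def)
    have "(\<forall>e. c' e \<in> part M e) \<and> finite {e. c' e \<noteq> \<zero>\<^bsub>M\<^esub>} \<and> x = finsum M c' {e. c' e \<noteq> \<zero>\<^bsub>M\<^esub>}"
      unfolding c'set using xd x zp by (auto simp: c'_def)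
    moreover have "(\<forall>e. K.comp x e \<in> part M e) \<and> finite {e. K.comp x e \<noteq> \<zero>\<^bsub>M\<^esub>} \<and>
        x = finsum M (K.comp x) {e. K.comp x e \<noteq> \<zero>\<^bsub>M\<^esub>}"
      using cp K.comp_decomposition[OF x] by simp
    moreover have "\<exists>!c. (\<forall>e. c e \<in> part M e) \<and> finite {e. c e \<noteq> \<zero>\<^bsub>M\<^esub>} \<and> x = finsum M c {e. c e \<noteq> \<zero>\<^bsub>M\<^esub>}"
      using gr x unfolding is_graded_module_def by blast
    ultimately have "K.comp x = c'" by blast
    hence "K.comp x d = x" by (simp add: c'_def)
    fix s assume s: "s \<in> Z"
    show "homog mdeg (d - dg s) (\<phi> x s)"
      using K.coord_comp[OF s, of x d] \<open>K.comp x d = x\<close> by (simp add: homog_iff_filt)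
  qed
  have "graded_coords M Z dg \<phi>"
    by (intro graded_coords.intro graded_coords_axioms.intro K.free_coords_axioms part)
  thus thesis by (rule that)
qed

section \<open>Coordinates on tensor products and direct sums\<close>

lemma graded_tensor_simps:
  "carrier (graded_tensor R M N) = carrier (tensor_module R M N)"
  "ring.add (graded_tensor R M N) = ring.add (tensor_module R M N)"
  "ring.zero (graded_tensor R M N) = ring.zero (tensor_module R M N)"
  "smult (graded_tensor R M N) = smult (tensor_module R M N)"
  "part (graded_tensor R M N) d = generate (add_monoid (tensor_module R M N))
        {pure_tensor R M N x y |x y p q. x \<in> part M p \<and> y \<in> part N q \<and> p + q = d}"
  by (simp_all add: graded_tensor_def module.defs graded_module.defs)

locale tensor_coords = M: graded_coords M Z dg \<phi> + N: graded_coords N W dh \<psi>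
  for M :: "(('n::finite, 'k::field) mpoly, 'b) graded_module" and Z :: "'z set" and dg \<phi>
    and N :: "(('n, 'k) mpoly, 'c) graded_module" and W :: "'w set" and dh \<psi>
begin

sublocale T: tensor mpoly_ring M N
  by (simp add: tensor_def M.mod N.mod)

definition tc :: "('b \<times> 'c \<Rightarrow> ('n, 'k) mpoly) set \<Rightarrow> 'z \<times> 'w \<Rightarrow> ('n, 'k) mpoly" where
  "tc t = (\<lambda>(s, w). T.tensor_lift mpoly_ring (\<lambda>x y. \<phi> x s * \<psi> y w) t)"

lemma tc_hom: "s \<in> Z \<Longrightarrow> w \<in> W \<Longrightarrow> (\<lambda>t. tc t (s, w)) \<in> mod_hom mpoly_ring T.T mpoly_ring"
  and tc_pure: "s \<in> Z \<Longrightarrow> w \<in> W \<Longrightarrow> x \<in> carrier M \<Longrightarrow> y \<in> carrier N \<Longrightarrow>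
    tc (pure_tensor mpoly_ring M N x y) (s, w) = \<phi> x s * \<psi> y w"
proof -
  assume s: "s \<in> Z" and w: "w \<in> W"
  let ?\<beta> = "\<lambda>x y. \<phi> x s * \<psi> y w"
  have l: "(\<lambda>x. ?\<beta> x y) \<in> mod_hom mpoly_ring M mpoly_ring" if "y \<in> carrier N" for y
    by (rule mod_homI) (auto simp: M.add M.smult s distrib_right)
  have r: "(\<lambda>y. ?\<beta> x y) \<in> mod_hom mpoly_ring N mpoly_ring" if "x \<in> carrier M" for x
    by (rule mod_homI) (auto simp: N.add N.smult w distrib_left)
  show "(\<lambda>t. tc t (s, w)) \<in> mod_hom mpoly_ring T.T mpoly_ring"
    unfolding tc_def prod.case by (rule T.tensor_lift(1)[OF module_mpoly_ring l r])
  show "x \<in> carrier M \<Longrightarrow> y \<in> carrier N \<Longrightarrow> tc (pure_tensor mpoly_ring M N x y) (s, w) = \<phi> x s * \<psi> y w"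
    unfolding tc_def prod.case by (rule T.tensor_lift(2)[OF module_mpoly_ring l r])
qed

lemma tc_add: "s \<in> Z \<Longrightarrow> w \<in> W \<Longrightarrow> t \<in> carrier T.T \<Longrightarrow> t' \<in> carrier T.T \<Longrightarrow>
    tc (t \<oplus>\<^bsub>T.T\<^esub> t') (s, w) = tc t (s, w) + tc t' (s, w)"
  using mod_homD(2)[OF tc_hom, of s w t t'] by simp

lemma tc_smult: "s \<in> Z \<Longrightarrow> w \<in> W \<Longrightarrow> t \<in> carrier T.T \<Longrightarrow> tc (a \<odot>\<^bsub>T.T\<^esub> t) (s, w) = a * tc t (s, w)"
  using mod_homD(3)[OF tc_hom, of s w a t] by simp

lemma tc_zero: "s \<in> Z \<Longrightarrow> w \<in> W \<Longrightarrow> tc \<zero>\<^bsub>T.T\<^esub> (s, w) = 0"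
  using mod_hom_zero[OF T.T_module module_mpoly_ring tc_hom] by simp

lemma tc_uminus: "s \<in> Z \<Longrightarrow> w \<in> W \<Longrightarrow> t \<in> carrier T.T \<Longrightarrow> tc (\<ominus>\<^bsub>T.T\<^esub> t) (s, w) = - tc t (s, w)"
  using tc_add[of s w "\<ominus>\<^bsub>T.T\<^esub> t" t] by (simp add: T.T.M.l_neg tc_zero eq_neg_iff_add_eq_0)

abbreviation ep :: "'z \<Rightarrow> 'w \<Rightarrow> ('b \<times> 'c \<Rightarrow> ('n, 'k) mpoly) set" where
  "ep s w \<equiv> pure_tensor mpoly_ring M N (M.ev s) (N.ev w)"

text \<open>The candidate for the inverse of \<open>tc\<close>; \<open>combination_tc\<close> proves that the tensors of basis elements span, and
  \<open>tc_combination\<close> that they are independent.\<close>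
definition combination :: "('z \<times> 'w \<Rightarrow> ('n, 'k) mpoly) \<Rightarrow> ('b \<times> 'c \<Rightarrow> ('n, 'k) mpoly) set" where
  "combination c = finsum T.T (\<lambda>s. finsum T.T (\<lambda>w. c (s, w) \<odot>\<^bsub>T.T\<^esub> ep s w) W) Z"

lemma smult_ep [simp]: "a \<odot>\<^bsub>T.T\<^esub> ep s w \<in> carrier T.T"
  by (rule T.T.smult_closed) auto

lemma combination_closed: "combination c \<in> carrier T.T"
  unfolding combination_def by (intro T.T.M.finsum_closed) auto

lemma tc_finsum:
  assumes "s \<in> Z" "w \<in> W" "\<And>a. a \<in> A \<Longrightarrow> f a \<in> carrier T.T"
  shows "tc (finsum T.T f A) (s, w) = (\<Sum>a\<in>A. tc (f a) (s, w))"
  using assms(3)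
proof (induct A rule: infinite_finite_induct)
  case (insert a A)
  have "tc (finsum T.T f (insert a A)) (s, w) = tc (f a \<oplus>\<^bsub>T.T\<^esub> finsum T.T f A) (s, w)"
    using insert by (subst T.T.M.finsum_insert) auto
  also have "\<dots> = tc (f a) (s, w) + tc (finsum T.T f A) (s, w)"
    using insert assms(1,2) by (intro tc_add T.T.M.finsum_closed) auto
  finally show ?case using insert by simp
qed (simp_all add: tc_zero assms(1,2))

lemma tc_combination:
  assumes "s \<in> Z" "w \<in> W"
  shows "tc (combination c) (s, w) = c (s, w)"
proof -
  have "tc (combination c) (s, w) = (\<Sum>s'\<in>Z. \<Sum>w'\<in>W. c (s', w') * ((if s = s' then 1 else 0) * (if w = w' then 1 else 0)))"
    unfolding combination_def
    using assms by (simp add: tc_finsum T.T.M.finsum_closed tc_smult tc_pure M.coord_ev N.coord_ev)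
  also have "\<dots> = (\<Sum>s'\<in>Z. \<Sum>w'\<in>W. if w = w' then if s = s' then c (s', w') else 0 else 0)"
    by (intro sum.cong) auto
  also have "\<dots> = c (s, w)" using assms M.finite_Z N.finite_Z by simp
  finally show ?thesis .
qed

lemma combination_cong: "(\<And>s w. s \<in> Z \<Longrightarrow> w \<in> W \<Longrightarrow> c (s, w) = c' (s, w)) \<Longrightarrow> combination c = combination c'"
  unfolding combination_def by (intro T.T.M.finsum_cong') (auto intro!: T.T.M.finsum_closed T.T.M.finsum_cong')

lemma combination_tc:
  assumes "t \<in> carrier T.T"
  shows "combination (tc t) = t"
  using assms
proof (induct rule: T.tensor_induct)
  case (pure a x y)
  have x: "x \<in> carrier M" and y: "y \<in> carrier N" by fact+
  have "pure_tensor mpoly_ring M N x y = pure_tensor mpoly_ring M N (finsum M (\<lambda>s. \<phi> x s \<odot>\<^bsub>M\<^esub> M.ev s) Z) y"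
    using M.expansion[OF x] by simp
  also have "\<dots> = finsum T.T (\<lambda>s. pure_tensor mpoly_ring M N (\<phi> x s \<odot>\<^bsub>M\<^esub> M.ev s) y) Z"
    by (rule mod_hom_finsum[OF M.mod T.T_module T.pure_hom_left[OF y]]) auto
  also have "\<dots> = finsum T.T (\<lambda>s. finsum T.T (\<lambda>w. (\<phi> x s * \<psi> y w) \<odot>\<^bsub>T.T\<^esub> ep s w) W) Z"
  proof (rule T.T.M.finsum_cong'[OF refl])
    fix s assume s: "s \<in> Z"
    have "pure_tensor mpoly_ring M N (\<phi> x s \<odot>\<^bsub>M\<^esub> M.ev s) y =
        pure_tensor mpoly_ring M N (\<phi> x s \<odot>\<^bsub>M\<^esub> M.ev s) (finsum N (\<lambda>w. \<psi> y w \<odot>\<^bsub>N\<^esub> N.ev w) W)"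
      using N.expansion[OF y] by simp
    also have "\<dots> = finsum T.T (\<lambda>w. pure_tensor mpoly_ring M N (\<phi> x s \<odot>\<^bsub>M\<^esub> M.ev s) (\<psi> y w \<odot>\<^bsub>N\<^esub> N.ev w)) W"
      by (rule mod_hom_finsum[OF N.mod T.T_module T.pure_hom_right]) auto
    also have "\<dots> = finsum T.T (\<lambda>w. (\<phi> x s * \<psi> y w) \<odot>\<^bsub>T.T\<^esub> ep s w) W"
    proof (rule T.T.M.finsum_cong'[OF refl])
      fix w assume "w \<in> W"
      show "pure_tensor mpoly_ring M N (\<phi> x s \<odot>\<^bsub>M\<^esub> M.ev s) (\<psi> y w \<odot>\<^bsub>N\<^esub> N.ev w) = (\<phi> x s * \<psi> y w) \<odot>\<^bsub>T.T\<^esub> ep s w"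
        using T.T.smult_assoc1[of "\<psi> y w" "\<phi> x s" "ep s w"]
        by (simp add: T.pure_smult_right T.pure_smult_left mult.commute)
    qed auto
    finally show "pure_tensor mpoly_ring M N (\<phi> x s \<odot>\<^bsub>M\<^esub> M.ev s) y = finsum T.T (\<lambda>w. (\<phi> x s * \<psi> y w) \<odot>\<^bsub>T.T\<^esub> ep s w) W" .
  qed (auto intro!: T.T.M.finsum_closed)
  finally have e: "pure_tensor mpoly_ring M N x y = finsum T.T (\<lambda>s. finsum T.T (\<lambda>w. (\<phi> x s * \<psi> y w) \<odot>\<^bsub>T.T\<^esub> ep s w) W) Z" .
  have "a \<odot>\<^bsub>T.T\<^esub> pure_tensor mpoly_ring M N x y =
    finsum T.T (\<lambda>s. a \<odot>\<^bsub>T.T\<^esub> finsum T.T (\<lambda>w. (\<phi> x s * \<psi> y w) \<odot>\<^bsub>T.T\<^esub> ep s w) W) Z"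
    unfolding e by (rule T.T.finsum_smult_ldistr[OF M.finite_Z]) (auto intro!: T.T.M.finsum_closed)
  also have "\<dots> = combination (tc (a \<odot>\<^bsub>T.T\<^esub> pure_tensor mpoly_ring M N x y))"
    unfolding combination_def
  proof (rule T.T.M.finsum_cong'[OF refl])
    fix s assume s: "s \<in> Z"
    have "a \<odot>\<^bsub>T.T\<^esub> finsum T.T (\<lambda>w. (\<phi> x s * \<psi> y w) \<odot>\<^bsub>T.T\<^esub> ep s w) W =
      finsum T.T (\<lambda>w. a \<odot>\<^bsub>T.T\<^esub> ((\<phi> x s * \<psi> y w) \<odot>\<^bsub>T.T\<^esub> ep s w)) W"
      by (rule T.T.finsum_smult_ldistr[OF N.finite_Z]) auto
    also have "\<dots> = finsum T.T (\<lambda>w. tc (a \<odot>\<^bsub>T.T\<^esub> pure_tensor mpoly_ring M N x y) (s, w) \<odot>\<^bsub>T.T\<^esub> ep s w) W"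
    proof (rule T.T.M.finsum_cong'[OF refl])
      fix w assume w: "w \<in> W"
      show "a \<odot>\<^bsub>T.T\<^esub> ((\<phi> x s * \<psi> y w) \<odot>\<^bsub>T.T\<^esub> ep s w) = tc (a \<odot>\<^bsub>T.T\<^esub> pure_tensor mpoly_ring M N x y) (s, w) \<odot>\<^bsub>T.T\<^esub> ep s w"
        using T.T.smult_assoc1[of a "\<phi> x s * \<psi> y w" "ep s w"] by (simp add: tc_smult tc_pure s w x y)
    qed auto
    finally show "a \<odot>\<^bsub>T.T\<^esub> finsum T.T (\<lambda>w. (\<phi> x s * \<psi> y w) \<odot>\<^bsub>T.T\<^esub> ep s w) W =
      finsum T.T (\<lambda>w. tc (a \<odot>\<^bsub>T.T\<^esub> pure_tensor mpoly_ring M N x y) (s, w) \<odot>\<^bsub>T.T\<^esub> ep s w) W" .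
  qed (auto intro!: T.T.M.finsum_closed)
  finally show ?case by simp
next
  case (add t t')
  have "combination (tc (t \<oplus>\<^bsub>T.T\<^esub> t')) = combination (\<lambda>z. tc t z + tc t' z)"
    by (rule combination_cong) (use add(1,2) in \<open>simp add: tc_add\<close>)
  also have "\<dots> = finsum T.T (\<lambda>s. finsum T.T (\<lambda>w. tc t (s, w) \<odot>\<^bsub>T.T\<^esub> ep s w) W \<oplus>\<^bsub>T.T\<^esub> finsum T.T (\<lambda>w. tc t' (s, w) \<odot>\<^bsub>T.T\<^esub> ep s w) W) Z"
    unfolding combination_def
  proof (rule T.T.M.finsum_cong'[OF refl])
    fix s assume "s \<in> Z"
    have "finsum T.T (\<lambda>w. (tc t (s, w) + tc t' (s, w)) \<odot>\<^bsub>T.T\<^esub> ep s w) W =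
      finsum T.T (\<lambda>w. tc t (s, w) \<odot>\<^bsub>T.T\<^esub> ep s w \<oplus>\<^bsub>T.T\<^esub> tc t' (s, w) \<odot>\<^bsub>T.T\<^esub> ep s w) W"
    proof (rule T.T.M.finsum_cong'[OF refl])
      fix w
      show "(tc t (s, w) + tc t' (s, w)) \<odot>\<^bsub>T.T\<^esub> ep s w = tc t (s, w) \<odot>\<^bsub>T.T\<^esub> ep s w \<oplus>\<^bsub>T.T\<^esub> tc t' (s, w) \<odot>\<^bsub>T.T\<^esub> ep s w"
        using T.T.smult_l_distr[of "tc t (s, w)" "tc t' (s, w)" "ep s w"] by simp
    qed auto
    also have "\<dots> = finsum T.T (\<lambda>w. tc t (s, w) \<odot>\<^bsub>T.T\<^esub> ep s w) W \<oplus>\<^bsub>T.T\<^esub> finsum T.T (\<lambda>w. tc t' (s, w) \<odot>\<^bsub>T.T\<^esub> ep s w) W"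
      by (rule T.T.M.finsum_addf) auto
    finally show "finsum T.T (\<lambda>w. (tc t (s, w) + tc t' (s, w)) \<odot>\<^bsub>T.T\<^esub> ep s w) W =
      finsum T.T (\<lambda>w. tc t (s, w) \<odot>\<^bsub>T.T\<^esub> ep s w) W \<oplus>\<^bsub>T.T\<^esub> finsum T.T (\<lambda>w. tc t' (s, w) \<odot>\<^bsub>T.T\<^esub> ep s w) W" .
  qed (auto intro!: T.T.M.finsum_closed T.T.M.a_closed)
  also have "\<dots> = combination (tc t) \<oplus>\<^bsub>T.T\<^esub> combination (tc t')"
    unfolding combination_def by (rule T.T.M.finsum_addf) (auto intro!: T.T.M.finsum_closed)
  finally show ?case using add(3,4) by simp
qed

lemma tc_inj:
  assumes "t \<in> carrier T.T" "t' \<in> carrier T.T" "\<And>s w. s \<in> Z \<Longrightarrow> w \<in> W \<Longrightarrow> tc t (s, w) = tc t' (s, w)"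
  shows "t = t'"
proof -
  have "combination (tc t) = combination (tc t')"
    by (rule combination_cong) (rule assms(3))
  thus ?thesis using combination_tc[OF assms(1)] combination_tc[OF assms(2)] by simp
qed

text \<open>The left side is the additive group generated by pure tensors of homogeneous elements. A tensor with
  homogeneous coordinates belongs to it because a coordinate can be moved into the left factor.\<close>
lemma tensor_part:
  "part (graded_tensor mpoly_ring M N) d =
    {t \<in> carrier T.T. \<forall>s\<in>Z. \<forall>w\<in>W. homog mdeg (d - (dg s + dh w)) (tc t (s, w))}"
proof (intro subset_antisym subsetI)
  let ?G = "{pure_tensor mpoly_ring M N x y |x y p q. x \<in> part M p \<and> y \<in> part N q \<and> p + q = d}"
  have G: "?G \<subseteq> carrier T.T" by (auto simp: M.part N.part)
  have pure: "homog mdeg (d - (dg s + dh w)) (tc g (s, w))" if g: "g \<in> ?G" and s: "s \<in> Z" "w \<in> W" for g s w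
  proof -
    obtain x y p q where g: "g = pure_tensor mpoly_ring M N x y" "x \<in> part M p" "y \<in> part N q" "p + q = d"
      using g by blast
    have "homog mdeg ((p - dg s) + (q - dh w)) (\<phi> x s * \<psi> y w)"
      using g(2,3) s by (intro homog_mult[OF mdeg_add]) (auto simp: M.part N.part)
    moreover have "(p - dg s) + (q - dh w) = d - (dg s + dh w)" using g(4) by simp
    moreover have "tc g (s, w) = \<phi> x s * \<psi> y w" using g s by (simp add: tc_pure M.part N.part)
    ultimately show ?thesis by metis
  qed
  {
    fix t assume "t \<in> part (graded_tensor mpoly_ring M N) d"
    hence "t \<in> generate (add_monoid T.T) ?G" by (simp only: graded_tensor_simps)
    hence "t \<in> carrier T.T \<and> (\<forall>s\<in>Z. \<forall>w\<in>W. homog mdeg (d - (dg s + dh w)) (tc t (s, w)))"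
    proof (induct rule: generate.induct)
      case one
      thus ?case by (simp add: tc_zero)
    next
      case (incl h)
      thus ?case using G pure[OF incl] by blast
    next
      case (inv h)
      have "h \<in> carrier T.T" using inv G by blast
      thus ?case using pure[OF inv] by (simp add: tc_uminus homog_uminus flip: a_inv_def)
    next
      case (eng h1 h2)
      thus ?case by (simp add: tc_add homog_add)
    qed
    thus "t \<in> {t \<in> carrier T.T. \<forall>s\<in>Z. \<forall>w\<in>W. homog mdeg (d - (dg s + dh w)) (tc t (s, w))}" by simp
  }
  fix t assume t: "t \<in> {t \<in> carrier T.T. \<forall>s\<in>Z. \<forall>w\<in>W. homog mdeg (d - (dg s + dh w)) (tc t (s, w))}"
  have ab: "abelian_group T.T" by (rule module.axioms(2)[OF T.T_module])
  have sub: "subgroup (generate (add_monoid T.T) ?G) (add_monoid T.T)"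
    by (rule T.T.M.add.generate_is_subgroup) (use G in simp)
  have "combination (tc t) \<in> generate (add_monoid T.T) ?G"
    unfolding combination_def
  proof (intro finsum_in_subgroup[OF ab sub])
    fix s w assume s: "s \<in> Z" "w \<in> W"
    have "tc t (s, w) \<odot>\<^bsub>T.T\<^esub> ep s w = pure_tensor mpoly_ring M N (tc t (s, w) \<odot>\<^bsub>M\<^esub> M.ev s) (N.ev w)"
      by (simp add: T.pure_smult_left)
    moreover have "tc t (s, w) \<odot>\<^bsub>M\<^esub> M.ev s \<in> part M (d - dh w)"
      using t s by (auto simp: M.part M.smult M.coord_ev algebra_simps)
    moreover have "N.ev w \<in> part N (dh w)" using s by (intro N.ev_part)
    moreover have "(d - dh w) + dh w = d" by simp
    ultimately have "tc t (s, w) \<odot>\<^bsub>T.T\<^esub> ep s w \<in> ?G" by blast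
    thus "tc t (s, w) \<odot>\<^bsub>T.T\<^esub> ep s w \<in> generate (add_monoid T.T) ?G" by (rule generate.incl)
  qed
  thus "t \<in> part (graded_tensor mpoly_ring M N) d"
    using t combination_tc[of t] by (simp only: graded_tensor_simps mem_Collect_eq)
qed

lemma graded_tensor_coords:
  "graded_coords (graded_tensor mpoly_ring M N) (Z \<times> W) (\<lambda>(s, w). dg s + dh w) tc"
proof (intro graded_coords.intro free_coords.intro graded_coords_axioms.intro)
  show "module mpoly_ring (graded_tensor mpoly_ring M N)"
    by (rule module_cong[OF T.T_module]) (simp_all add: graded_tensor_simps)
  show "finite (Z \<times> W)" using M.finite_Z N.finite_Z by simp
  show "\<exists>x\<in>carrier (graded_tensor mpoly_ring M N). \<forall>s\<in>Z \<times> W. tc x s = f s" for f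
    by (rule bexI[of _ "combination f"]) (auto simp: graded_tensor_simps tc_combination combination_closed)
  show "part (graded_tensor mpoly_ring M N) d = {x \<in> carrier (graded_tensor mpoly_ring M N).
      \<forall>s\<in>Z \<times> W. homog mdeg (d - (case s of (s, w) \<Rightarrow> dg s + dh w)) (tc x s)}" for d
    unfolding tensor_part by (auto simp: graded_tensor_simps)
  show "t = t'" if "t \<in> carrier (graded_tensor mpoly_ring M N)" "t' \<in> carrier (graded_tensor mpoly_ring M N)"
    "\<And>s. s \<in> Z \<times> W \<Longrightarrow> tc t s = tc t' s" for t t'
    by (rule tc_inj) (use that in \<open>simp_all add: graded_tensor_simps\<close>)
qed (auto simp: graded_tensor_simps tc_add tc_smult)

end

lemma graded_sum_coords:
  fixes M :: "'i \<Rightarrow> (('n::finite, 'k::field) mpoly, 'b) graded_module"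
  assumes A: "finite A" and M: "\<And>i. i \<in> A \<Longrightarrow> graded_coords (M i) (Z i) (dg i) (\<phi> i)"
  shows "graded_coords (graded_sum A M) (Sigma A Z) (\<lambda>(i, s). dg i s) (\<lambda>t (i, s). \<phi> i (t i) s)"
proof (intro graded_coords.intro free_coords.intro graded_coords_axioms.intro)
  have simps: "carrier (graded_sum A M) = (\<Pi>\<^sub>E i\<in>A. carrier (M i))" "\<zero>\<^bsub>graded_sum A M\<^esub> = (\<lambda>i\<in>A. \<zero>\<^bsub>M i\<^esub>)"
    "x \<oplus>\<^bsub>graded_sum A M\<^esub> y = (\<lambda>i\<in>A. x i \<oplus>\<^bsub>M i\<^esub> y i)" "a \<odot>\<^bsub>graded_sum A M\<^esub> x = (\<lambda>i\<in>A. a \<odot>\<^bsub>M i\<^esub> x i)"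
    "part (graded_sum A M) d = (\<Pi>\<^sub>E i\<in>A. part (M i) d)" for x y a d
    by (simp_all add: graded_sum_def)
  note FM = M[THEN graded_coords.axioms(1)]
  have mod: "module mpoly_ring (M i)" if "i \<in> A" for i
    by (rule free_coords.mod[OF FM[OF that]])
  note ab = module.axioms(2)[OF mod]
  have closed: "x i \<oplus>\<^bsub>M i\<^esub> y i \<in> carrier (M i)" "a \<odot>\<^bsub>M i\<^esub> x i \<in> carrier (M i)" "\<zero>\<^bsub>M i\<^esub> \<in> carrier (M i)" "\<ominus>\<^bsub>M i\<^esub> x i \<in> carrier (M i)"
    if "x \<in> (\<Pi>\<^sub>E i\<in>A. carrier (M i))" "y \<in> (\<Pi>\<^sub>E i\<in>A. carrier (M i))" "i \<in> A" for x y i a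
  proof -
    interpret Mi: module mpoly_ring "M i" by (rule mod[OF that(3)])
    have "x i \<in> carrier (M i)" "y i \<in> carrier (M i)" using that by auto
    thus "x i \<oplus>\<^bsub>M i\<^esub> y i \<in> carrier (M i)" "a \<odot>\<^bsub>M i\<^esub> x i \<in> carrier (M i)" "\<zero>\<^bsub>M i\<^esub> \<in> carrier (M i)" "\<ominus>\<^bsub>M i\<^esub> x i \<in> carrier (M i)"
      by auto
  qed
  show "module mpoly_ring (graded_sum A M)"
  proof (rule moduleI)
    show "abelian_group (graded_sum A M)"
    proof (rule abelian_groupI)
      fix x y z assume xyz: "x \<in> carrier (graded_sum A M)" "y \<in> carrier (graded_sum A M)" "z \<in> carrier (graded_sum A M)"
      note xyz' = xyz[unfolded simps]
      show "x \<oplus>\<^bsub>graded_sum A M\<^esub> y \<oplus>\<^bsub>graded_sum A M\<^esub> z = x \<oplus>\<^bsub>graded_sum A M\<^esub> (y \<oplus>\<^bsub>graded_sum A M\<^esub> z)"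
        unfolding simps by (rule restrict_ext) (use xyz' in \<open>simp add: abelian_monoid.a_assoc[OF abelian_group.axioms(1)[OF ab]] PiE_mem[OF xyz'(1)] PiE_mem[OF xyz'(2)] PiE_mem[OF xyz'(3)]\<close>)
    next
      fix x y assume xy: "x \<in> carrier (graded_sum A M)" "y \<in> carrier (graded_sum A M)"
      note xy' = xy[unfolded simps]
      show "x \<oplus>\<^bsub>graded_sum A M\<^esub> y \<in> carrier (graded_sum A M)"
        unfolding simps by (rule restrict_PiE_iff[THEN iffD2]) (use closed(1)[OF xy'] in blast)
      show "x \<oplus>\<^bsub>graded_sum A M\<^esub> y = y \<oplus>\<^bsub>graded_sum A M\<^esub> x"
        unfolding simps by (rule restrict_ext) (simp add: abelian_monoid.a_comm[OF abelian_group.axioms(1)[OF ab]] PiE_mem[OF xy'(1)] PiE_mem[OF xy'(2)])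
    next
      show "\<zero>\<^bsub>graded_sum A M\<^esub> \<in> carrier (graded_sum A M)"
        unfolding simps by (rule restrict_PiE_iff[THEN iffD2]) (use abelian_monoid.zero_closed[OF abelian_group.axioms(1)[OF ab]] in blast)
    next
      fix x assume x: "x \<in> carrier (graded_sum A M)"
      note x' = x[unfolded simps]
      show "\<zero>\<^bsub>graded_sum A M\<^esub> \<oplus>\<^bsub>graded_sum A M\<^esub> x = x"
        unfolding simps
      proof (rule extensionalityI[of _ A])
        show "x \<in> extensional A" using x' by (simp add: PiE_def)
      qed (simp_all add: abelian_monoid.l_zero[OF abelian_group.axioms(1)[OF ab]] PiE_mem[OF x'])
      show "\<exists>y\<in>carrier (graded_sum A M). y \<oplus>\<^bsub>graded_sum A M\<^esub> x = \<zero>\<^bsub>graded_sum A M\<^esub>"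
        unfolding simps
      proof (rule bexI[of _ "\<lambda>i\<in>A. \<ominus>\<^bsub>M i\<^esub> x i"])
        show "(\<lambda>i\<in>A. (\<lambda>i\<in>A. \<ominus>\<^bsub>M i\<^esub> x i) i \<oplus>\<^bsub>M i\<^esub> x i) = (\<lambda>i\<in>A. \<zero>\<^bsub>M i\<^esub>)"
          by (rule restrict_ext) (simp add: abelian_group.l_neg[OF ab] PiE_mem[OF x'])
        show "(\<lambda>i\<in>A. \<ominus>\<^bsub>M i\<^esub> x i) \<in> (\<Pi>\<^sub>E i\<in>A. carrier (M i))"
          by (rule restrict_PiE_iff[THEN iffD2]) (use closed(4)[OF x' x'] in blast)
      qed
    qed
  next
    fix a x assume x: "x \<in> carrier (graded_sum A M)" and a: "a \<in> carrier (mpoly_ring :: (('n, 'k) mpoly, ('n, 'k) mpoly) graded_module)"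
    note x' = x[unfolded simps]
    show "a \<odot>\<^bsub>graded_sum A M\<^esub> x \<in> carrier (graded_sum A M)"
      unfolding simps by (rule restrict_PiE_iff[THEN iffD2]) (use closed(2)[OF x' x'] in blast)
    fix b assume b: "b \<in> carrier (mpoly_ring :: (('n, 'k) mpoly, ('n, 'k) mpoly) graded_module)"
    show "(a \<oplus>\<^bsub>mpoly_ring\<^esub> b) \<odot>\<^bsub>graded_sum A M\<^esub> x = a \<odot>\<^bsub>graded_sum A M\<^esub> x \<oplus>\<^bsub>graded_sum A M\<^esub> b \<odot>\<^bsub>graded_sum A M\<^esub> x"
      unfolding simps by (rule restrict_ext) (use module.smult_l_distr[OF mod a b PiE_mem[OF x']] in simp)
    show "(a \<otimes>\<^bsub>mpoly_ring\<^esub> b) \<odot>\<^bsub>graded_sum A M\<^esub> x = a \<odot>\<^bsub>graded_sum A M\<^esub> (b \<odot>\<^bsub>graded_sum A M\<^esub> x)"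
      unfolding simps by (rule restrict_ext) (use module.smult_assoc1[OF mod a b PiE_mem[OF x']] in simp)
  next
    fix a x y assume x: "x \<in> carrier (graded_sum A M)" "y \<in> carrier (graded_sum A M)"
      and a: "a \<in> carrier (mpoly_ring :: (('n, 'k) mpoly, ('n, 'k) mpoly) graded_module)"
    note x' = x[unfolded simps]
    show "a \<odot>\<^bsub>graded_sum A M\<^esub> (x \<oplus>\<^bsub>graded_sum A M\<^esub> y) = a \<odot>\<^bsub>graded_sum A M\<^esub> x \<oplus>\<^bsub>graded_sum A M\<^esub> a \<odot>\<^bsub>graded_sum A M\<^esub> y"
      unfolding simps by (rule restrict_ext) (use module.smult_r_distr[OF mod a PiE_mem[OF x'(1)] PiE_mem[OF x'(2)]] in simp)
  next
    fix x assume x: "x \<in> carrier (graded_sum A M)"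
    note x' = x[unfolded simps]
    show "\<one>\<^bsub>mpoly_ring\<^esub> \<odot>\<^bsub>graded_sum A M\<^esub> x = x"
      unfolding simps
    proof (rule extensionalityI[of _ A])
      show "x \<in> extensional A" using x' by (simp add: PiE_def)
    qed (use module.smult_one[OF mod PiE_mem[OF x']] in simp_all)
  qed (rule cring_mpoly_ring)
  show "finite (Sigma A Z)" using A free_coords.finite_Z[OF FM] by simp
  show "(case s of (i, s) \<Rightarrow> \<phi> i ((x \<oplus>\<^bsub>graded_sum A M\<^esub> y) i) s) = (case s of (i, s) \<Rightarrow> \<phi> i (x i) s) + (case s of (i, s) \<Rightarrow> \<phi> i (y i) s)"
    if xy: "x \<in> carrier (graded_sum A M)" "y \<in> carrier (graded_sum A M)" "s \<in> Sigma A Z" for x y s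
  proof -
    obtain i u where s: "s = (i, u)" "i \<in> A" "u \<in> Z i" using xy(3) by blast
    show ?thesis
      using free_coords.add[OF FM[OF s(2)] PiE_mem[OF xy(1)[unfolded simps] s(2)] PiE_mem[OF xy(2)[unfolded simps] s(2)] s(3)] s
      by (simp add: simps)
  qed
  show "(case s of (i, s) \<Rightarrow> \<phi> i ((a \<odot>\<^bsub>graded_sum A M\<^esub> x) i) s) = a * (case s of (i, s) \<Rightarrow> \<phi> i (x i) s)"
    if xy: "x \<in> carrier (graded_sum A M)" "s \<in> Sigma A Z" for a x s
  proof -
    obtain i u where s: "s = (i, u)" "i \<in> A" "u \<in> Z i" using xy(2) by blast
    show ?thesis
      using free_coords.smult[OF FM[OF s(2)] PiE_mem[OF xy(1)[unfolded simps] s(2)] s(3)] s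
      by (simp add: simps)
  qed
  show "x = y" if x: "x \<in> carrier (graded_sum A M)" "y \<in> carrier (graded_sum A M)"
    and eq: "\<And>s. s \<in> Sigma A Z \<Longrightarrow> (case s of (i, s) \<Rightarrow> \<phi> i (x i) s) = (case s of (i, s) \<Rightarrow> \<phi> i (y i) s)" for x y
  proof (rule PiE_ext[OF x[unfolded simps]])
    fix i assume i: "i \<in> A"
    show "x i = y i"
      using PiE_mem[OF x(1)[unfolded simps] i] PiE_mem[OF x(2)[unfolded simps] i]
    proof (rule free_coords.inj[OF FM[OF i]])
      show "\<phi> i (x i) s = \<phi> i (y i) s" if "s \<in> Z i" for s
        using eq[of "(i, s)"] i that by simp
    qed
  qed
  show "\<exists>x\<in>carrier (graded_sum A M). \<forall>s\<in>Sigma A Z. (case s of (i, s) \<Rightarrow> \<phi> i (x i) s) = f s" for f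
  proof -
    have "\<forall>i. \<exists>x. i \<in> A \<longrightarrow> x \<in> carrier (M i) \<and> (\<forall>s\<in>Z i. \<phi> i x s = f (i, s))"
    proof
      fix i
      show "\<exists>x. i \<in> A \<longrightarrow> x \<in> carrier (M i) \<and> (\<forall>s\<in>Z i. \<phi> i x s = f (i, s))"
        using free_coords.surj[OF FM[of i], of "\<lambda>s. f (i, s)"] by blast
    qed
    from choice[OF this] obtain x where x: "\<And>i. i \<in> A \<Longrightarrow> x i \<in> carrier (M i) \<and> (\<forall>s\<in>Z i. \<phi> i (x i) s = f (i, s))" by blast
    thus ?thesis unfolding simps by (intro bexI[of _ "restrict x A"]) auto
  qed
  show "part (graded_sum A M) d = {x \<in> carrier (graded_sum A M).
      \<forall>s\<in>Sigma A Z. homog mdeg (d - (case s of (i, s) \<Rightarrow> dg i s)) (case s of (i, s) \<Rightarrow> \<phi> i (x i) s)}" for d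
  proof -
    have "(\<Pi>\<^sub>E i\<in>A. part (M i) d) = (\<Pi>\<^sub>E i\<in>A. {x \<in> carrier (M i). \<forall>s\<in>Z i. homog mdeg (d - dg i s) (\<phi> i x s)})"
      by (rule PiE_cong) (rule graded_coords.part[OF M])
    also have "\<dots> = {x \<in> (\<Pi>\<^sub>E i\<in>A. carrier (M i)). \<forall>i\<in>A. \<forall>s\<in>Z i. homog mdeg (d - dg i s) (\<phi> i (x i) s)}"
      by (rule Set.set_eqI) (simp add: PiE_iff ball_conj_distrib conj_ac)
    also have "\<dots> = {x \<in> (\<Pi>\<^sub>E i\<in>A. carrier (M i)).
        \<forall>s\<in>Sigma A Z. homog mdeg (d - (case s of (i, s) \<Rightarrow> dg i s)) (case s of (i, s) \<Rightarrow> \<phi> i (x i) s)}"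
      by (rule Collect_cong) auto
    finally show ?thesis unfolding simps .
  qed
qed

section \<open>From resolutions to matrices\<close>

lemma a_inv_mpoly_ring: "\<ominus>\<^bsub>mpoly_ring\<^esub> p = - p"
proof -
  interpret cring "mpoly_ring :: (('a, 'b) mpoly, ('a, 'b) mpoly) graded_module" by (rule cring_mpoly_ring)
  have "\<ominus>\<^bsub>mpoly_ring\<^esub> p + p = 0" using l_neg[of p] by simp
  thus ?thesis by (simp add: eq_neg_iff_add_eq_0)
qed

lemma a_minus_mpoly_ring: "p \<ominus>\<^bsub>mpoly_ring\<^esub> q = p - q"
  by (simp add: a_minus_def a_inv_mpoly_ring)

lemma finsum_mpoly_ring: "finsum mpoly_ring f A = sum f A"
proof -
  interpret cring "mpoly_ring :: (('a, 'b) mpoly, ('a, 'b) mpoly) graded_module" by (rule cring_mpoly_ring)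
  show ?thesis
    by (induct A rule: infinite_finite_induct) (simp_all add: finsum_insert)
qed

lemma quotient_mpoly_ring:
  fixes I :: "('n::finite, 'k::field) mpoly set"
  assumes "ideal_set I"
  shows "quotient mpoly_ring mpoly_ring I"
proof (intro quotient.intro quotient_axioms.intro module_mpoly_ring)
  show "submodule I mpoly_ring mpoly_ring"
    by (rule module.submoduleI[OF module_mpoly_ring]) (simp_all add: a_inv_mpoly_ring ideal_setD[OF assms])
qed

lemma graded_quot_simps:
  "carrier (graded_quot M N) = carrier (quot_module M N)"
  "ring.add (graded_quot M N) = ring.add (quot_module M N)"
  "ring.zero (graded_quot M N) = ring.zero (quot_module M N)"
  "smult (graded_quot M N) = smult (quot_module M N)"
  "part (graded_quot M N) d = (\<lambda>x. N +>\<^bsub>M\<^esub> x) ` part M d"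
  by (simp_all add: graded_quot_def module.defs graded_module.defs)

lemma graded_hom_iff:
  "graded_hom R M N h \<longleftrightarrow> h \<in> mod_hom R M N \<and> (\<forall>d. h ` part M d \<subseteq> part N d)"
  by (auto simp: graded_hom_def mod_hom_def)

locale cyclic_quotient =
  fixes I :: "('n::finite, 'k::field) mpoly set"
  assumes ideal: "ideal_set I"
begin

sublocale Q: quotient mpoly_ring mpoly_ring I
  by (rule quotient_mpoly_ring[OF ideal])

abbreviation cls :: "('n, 'k) mpoly \<Rightarrow> ('n, 'k) mpoly set" where
  "cls p \<equiv> I +>\<^bsub>mpoly_ring\<^esub> p"

abbreviation RI :: "(('n, 'k) mpoly, ('n, 'k) mpoly set) graded_module" where
  "RI \<equiv> graded_quot mpoly_ring I"

lemma module_RI: "module mpoly_ring RI"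
  by (rule module_cong[OF Q.quot_module]) (simp_all add: graded_quot_simps)

lemma cls_eq: "cls p = cls q \<longleftrightarrow> p - q \<in> I"
  using Q.coset_eq_iff[of p q] by (simp add: a_minus_mpoly_ring)

lemma carrier_RI: "carrier RI = range cls"
  by (auto simp: graded_quot_simps Q.quot_carrier)

lemma zero_RI: "\<zero>\<^bsub>RI\<^esub> = cls 0"
  using Q.quot_zero by (simp add: graded_quot_simps)

lemma cls_hom: "cls \<in> mod_hom mpoly_ring mpoly_ring RI"
  using Q.quot_hom by (simp add: mod_hom_def hom_def graded_quot_simps)

lemma part_RI: "part RI d = cls ` {p. homog mdeg d p}"
proof -
  have "part (mpoly_ring :: (('n, 'k) mpoly, ('n, 'k) mpoly) graded_module) d = {p. homog mdeg d p}"
    by (simp add: part_mpoly_ring Set.set_eq_iff)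
  thus ?thesis by (simp add: graded_quot_simps)
qed

end

locale resolution_coords =
  fixes C :: "(('n::finite, 'k::field) mpoly, 'b) graded_complex" and Z :: "nat \<Rightarrow> 'z set"
    and dg :: "nat \<Rightarrow> 'z \<Rightarrow> int" and \<phi> :: "nat \<Rightarrow> 'b \<Rightarrow> 'z \<Rightarrow> ('n, 'k) mpoly"
    and A :: "nat \<Rightarrow> 'z \<Rightarrow> 'z \<Rightarrow> ('n, 'k) mpoly"
  assumes coords: "graded_coords (cmod C i) (Z i) (dg i) (\<phi> i)"
    and diff_hom: "cdiff C i \<in> mod_hom mpoly_ring (cmod C (Suc i)) (cmod C i)"
    and diff_coord: "x \<in> carrier (cmod C (Suc i)) \<Longrightarrow> b \<in> Z i \<Longrightarrow>
      \<phi> i (cdiff C i x) b = (\<Sum>b'\<in>Z (Suc i). \<phi> (Suc i) x b' * A i b' b)"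

text \<open>The matrix entries are the coordinates of the images of the basis elements. The last conclusion records
  this, for the sake of minimality; \<open>r b\<close> is a homogeneous representative of the image of \<open>b\<close> in \<open>R/I\<close>.\<close>
lemma resolution_matrices:
  fixes C :: "(('n::finite, 'k::field) mpoly, 'b) graded_complex"
  assumes I: "ideal_set I" and res: "graded_free_resolution mpoly_ring C (graded_quot mpoly_ring I)"
  obtains Z :: "nat \<Rightarrow> 'b set" and dg \<phi> A r
    where "resolution_coords C Z dg \<phi> A" "matrix_resolution Z A dg r I"
      "\<forall>i. \<forall>b\<in>Z i. \<forall>b'\<in>Z (Suc i). \<exists>x\<in>carrier (cmod C (Suc i)). A i b' b = \<phi> i (cdiff C i x) b"
proof -
  interpret I: cyclic_quotient I by unfold_locales (rule I)
  have free: "graded_free mpoly_ring (cmod C i)"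
    and gh: "graded_hom mpoly_ring (cmod C (Suc i)) (cmod C i) (cdiff C i)"
    and ex: "cdiff C (Suc i) ` carrier (cmod C (Suc (Suc i))) = a_kernel (cmod C (Suc i)) (cmod C i) (cdiff C i)" for i
    using res by (simp_all add: graded_free_resolution_def)
  obtain \<epsilon> where \<epsilon>: "graded_hom mpoly_ring (cmod C 0) I.RI \<epsilon>" "\<epsilon> ` carrier (cmod C 0) = carrier I.RI"
      "cdiff C 0 ` carrier (cmod C (Suc 0)) = a_kernel (cmod C 0) I.RI \<epsilon>"
    using res[unfolded graded_free_resolution_def, THEN conjunct2, THEN conjunct2, THEN conjunct2]
    by (elim exE conjE)
  have "\<forall>i. \<exists>q. graded_coords (cmod C i) (fst q :: 'b set) (fst (snd q)) (snd (snd q))"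
  proof
    fix i
    obtain Z :: "'b set" and dg \<phi> where "graded_coords (cmod C i) Z dg \<phi>" by (rule graded_free_coords[OF free])
    thus "\<exists>q. graded_coords (cmod C i) (fst q :: 'b set) (fst (snd q)) (snd (snd q))"
      by (intro exI[of _ "(Z, dg, \<phi>)"]) simp
  qed
  from choice[OF this] obtain q where q: "\<And>i. graded_coords (cmod C i) (fst (q i) :: 'b set) (fst (snd (q i))) (snd (snd (q i)))"
    by blast
  define Z where "Z i = fst (q i)" for i
  define dg where "dg i = fst (snd (q i))" for i
  define \<phi> where "\<phi> i = snd (snd (q i))" for i
  have gc: "graded_coords (cmod C i) (Z i) (dg i) (\<phi> i)" for i
    using q[of i] by (simp add: Z_def dg_def \<phi>_def)
  interpret K: graded_coords "cmod C i" "Z i" "dg i" "\<phi> i" for i by (rule gc)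
  have dh: "cdiff C i \<in> mod_hom mpoly_ring (cmod C (Suc i)) (cmod C i)" for i
    using gh[of i] by (simp add: graded_hom_iff)
  define A where "A i b' b = \<phi> i (cdiff C i (K.ev (Suc i) b')) b" for i b' b
  have dc: "\<phi> i (cdiff C i x) b = (\<Sum>b'\<in>Z (Suc i). \<phi> (Suc i) x b' * A i b' b)"
    if x: "x \<in> carrier (cmod C (Suc i))" and b: "b \<in> Z i" for x i b
  proof -
    have "cdiff C i x = cdiff C i (finsum (cmod C (Suc i)) (\<lambda>s. \<phi> (Suc i) x s \<odot>\<^bsub>cmod C (Suc i)\<^esub> K.ev (Suc i) s) (Z (Suc i)))"
      using K.expansion[OF x] by simp
    also have "\<dots> = finsum (cmod C i) (\<lambda>s. cdiff C i (\<phi> (Suc i) x s \<odot>\<^bsub>cmod C (Suc i)\<^esub> K.ev (Suc i) s)) (Z (Suc i))"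
      by (rule mod_hom_finsum[OF K.mod K.mod dh]) simp
    also have "\<phi> i \<dots> b = (\<Sum>s\<in>Z (Suc i). \<phi> i (cdiff C i (\<phi> (Suc i) x s \<odot>\<^bsub>cmod C (Suc i)\<^esub> K.ev (Suc i) s)) b)"
      by (rule K.coord_finsum[OF b]) (rule mod_homD(1)[OF dh], simp)
    also have "\<dots> = (\<Sum>b'\<in>Z (Suc i). \<phi> (Suc i) x b' * A i b' b)"
      by (rule sum.cong) (simp_all add: mod_homD(1,3)[OF dh] K.smult b A_def)
    finally show ?thesis .
  qed
  have RC: "resolution_coords C Z dg \<phi> A"
    by (rule resolution_coords.intro) (fact gc dh dc)+
  have \<epsilon>h: "\<epsilon> \<in> mod_hom mpoly_ring (cmod C 0) I.RI" using \<epsilon>(1) by (simp add: graded_hom_iff)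
  have "\<forall>b. \<exists>p. b \<in> Z 0 \<longrightarrow> homog mdeg (dg 0 b) p \<and> \<epsilon> (K.ev 0 b) = I.cls p"
  proof
    fix b
    have "\<epsilon> (K.ev 0 b) \<in> part I.RI (dg 0 b)" if "b \<in> Z 0"
      using \<epsilon>(1) K.ev_part[OF that] by (auto simp: graded_hom_iff)
    thus "\<exists>p. b \<in> Z 0 \<longrightarrow> homog mdeg (dg 0 b) p \<and> \<epsilon> (K.ev 0 b) = I.cls p"
      unfolding I.part_RI by blast
  qed
  from choice[OF this] obtain r where r: "\<And>b. b \<in> Z 0 \<Longrightarrow> homog mdeg (dg 0 b) (r b)"
    "\<And>b. b \<in> Z 0 \<Longrightarrow> \<epsilon> (K.ev 0 b) = I.cls (r b)" by blast
  have \<epsilon>cls: "\<epsilon> x = I.cls (\<Sum>b\<in>Z 0. \<phi> 0 x b * r b)" if x: "x \<in> carrier (cmod C 0)" for x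
  proof -
    have "\<epsilon> x = \<epsilon> (finsum (cmod C 0) (\<lambda>b. \<phi> 0 x b \<odot>\<^bsub>cmod C 0\<^esub> K.ev 0 b) (Z 0))"
      using K.expansion[OF x] by simp
    also have "\<dots> = finsum I.RI (\<lambda>b. \<epsilon> (\<phi> 0 x b \<odot>\<^bsub>cmod C 0\<^esub> K.ev 0 b)) (Z 0)"
      by (rule mod_hom_finsum[OF K.mod I.module_RI \<epsilon>h]) simp
    also have "\<dots> = finsum I.RI (\<lambda>b. I.cls (\<phi> 0 x b * r b)) (Z 0)"
    proof (rule abelian_monoid.finsum_cong'[OF abelian_group.axioms(1)[OF module.axioms(2)[OF I.module_RI]] refl])
      fix b assume b: "b \<in> Z 0"
      show "\<epsilon> (\<phi> 0 x b \<odot>\<^bsub>cmod C 0\<^esub> K.ev 0 b) = I.cls (\<phi> 0 x b * r b)"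
        using mod_homD(3)[OF \<epsilon>h, of "\<phi> 0 x b" "K.ev 0 b"] mod_homD(3)[OF I.cls_hom, of "\<phi> 0 x b" "r b"] r(2)[OF b]
        by simp
    qed (auto simp: I.carrier_RI)
    also have "\<dots> = I.cls (finsum mpoly_ring (\<lambda>b. \<phi> 0 x b * r b) (Z 0))"
      by (rule mod_hom_finsum[OF module_mpoly_ring I.module_RI I.cls_hom, symmetric]) simp
    finally show ?thesis by (simp add: finsum_mpoly_ring)
  qed
  have "matrix_resolution Z A dg r I"
  proof (intro matrix_resolution.intro matrix_complex.intro matrix_resolution_axioms.intro)
    show "finite (Z i)" for i by (rule K.finite_Z)
    show "homog mdeg (dg (Suc i) b' - dg i b) (A i b' b)" if "b' \<in> Z (Suc i)" "b \<in> Z i" for i b b'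
    proof -
      have "cdiff C i (K.ev (Suc i) b') \<in> part (cmod C i) (dg (Suc i) b')"
        using gh[of i] K.ev_part[OF that(1)] by (auto simp: graded_hom_iff)
      thus ?thesis using that(2) by (simp add: K.part A_def)
    qed
    show "(\<Sum>b'\<in>Z (Suc i). A (Suc i) b'' b' * A i b' b) = 0" if "b'' \<in> Z (Suc (Suc i))" "b \<in> Z i" for i b b''
    proof -
      let ?e = "K.ev (Suc (Suc i)) b''"
      have "cdiff C (Suc i) ?e \<in> a_kernel (cmod C (Suc i)) (cmod C i) (cdiff C i)"
        unfolding ex[of i, symmetric] by (rule imageI) simp
      hence *: "cdiff C (Suc i) ?e \<in> carrier (cmod C (Suc i))" "cdiff C i (cdiff C (Suc i) ?e) = \<zero>\<^bsub>cmod C i\<^esub>"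
        by (simp_all add: a_kernel_def')
      have "(\<Sum>b'\<in>Z (Suc i). A (Suc i) b'' b' * A i b' b) = \<phi> i (cdiff C i (cdiff C (Suc i) ?e)) b"
        using dc[OF *(1) that(2)] by (simp add: A_def[of "Suc i"])
      thus ?thesis using *(2) that(2) by (simp add: K.coord_zero)
    qed
    show "\<exists>y. \<forall>b\<in>Z (Suc i). x b = (\<Sum>b'\<in>Z (Suc (Suc i)). y b' * A (Suc i) b' b)"
      if x: "\<And>b. b \<in> Z i \<Longrightarrow> (\<Sum>b'\<in>Z (Suc i). x b' * A i b' b) = 0" for i x
    proof -
      let ?e = "K.el (Suc i) x"
      have "cdiff C i ?e = \<zero>\<^bsub>cmod C i\<^esub>"
      proof (rule K.inj)
        show "cdiff C i ?e \<in> carrier (cmod C i)" by (rule mod_homD(1)[OF dh]) simp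
        fix b assume b: "b \<in> Z i"
        show "\<phi> i (cdiff C i ?e) b = \<phi> i \<zero>\<^bsub>cmod C i\<^esub> b"
          using x[OF b] by (simp add: dc b K.coord_zero K.coord_el)
      qed (rule K.M.zero_closed)
      hence "?e \<in> cdiff C (Suc i) ` carrier (cmod C (Suc (Suc i)))"
        unfolding ex[of i] by (simp add: a_kernel_def')
      then obtain y where y: "?e = cdiff C (Suc i) y" "y \<in> carrier (cmod C (Suc (Suc i)))"
        by (rule imageE)
      have "x b = (\<Sum>b'\<in>Z (Suc (Suc i)). \<phi> (Suc (Suc i)) y b' * A (Suc i) b' b)" if b: "b \<in> Z (Suc i)" for b
        using K.coord_el[OF b, of x] dc[OF y(2) b] y(1) by simp
      thus ?thesis by blast
    qed
    show "ideal_set I" by (rule I)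
    show "homog mdeg (dg 0 b) (r b)" if "b \<in> Z 0" for b using r(1)[OF that] .
    show "\<exists>e. (\<Sum>b\<in>Z 0. e b * r b) - 1 \<in> I"
    proof -
      have "I.cls 1 \<in> \<epsilon> ` carrier (cmod C 0)" unfolding \<epsilon>(2) I.carrier_RI by blast
      then obtain x where "I.cls 1 = \<epsilon> x" "x \<in> carrier (cmod C 0)" by (rule imageE)
      hence "I.cls (\<Sum>b\<in>Z 0. \<phi> 0 x b * r b) = I.cls 1" using \<epsilon>cls by simp
      thus ?thesis unfolding I.cls_eq by blast
    qed
    show "(\<Sum>b\<in>Z 0. x b * r b) \<in> I \<longleftrightarrow> (\<exists>y. \<forall>b\<in>Z 0. x b = (\<Sum>b'\<in>Z (Suc 0). y b' * A 0 b' b))" for x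
    proof -
      let ?e = "K.el 0 x"
      have "(\<Sum>b\<in>Z 0. x b * r b) \<in> I \<longleftrightarrow> \<epsilon> ?e = \<zero>\<^bsub>I.RI\<^esub>"
        using I.cls_eq[of _ 0] by (simp add: \<epsilon>cls I.zero_RI K.coord_el)
      also have "\<dots> \<longleftrightarrow> ?e \<in> cdiff C 0 ` carrier (cmod C (Suc 0))"
        unfolding \<epsilon>(3) by (simp add: a_kernel_def')
      also have "\<dots> \<longleftrightarrow> (\<exists>y. \<forall>b\<in>Z 0. x b = (\<Sum>b'\<in>Z (Suc 0). y b' * A 0 b' b))"
      proof
        assume "?e \<in> cdiff C 0 ` carrier (cmod C (Suc 0))"
        then obtain y where y: "?e = cdiff C 0 y" "y \<in> carrier (cmod C (Suc 0))" by (rule imageE)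
        have "x b = (\<Sum>b'\<in>Z (Suc 0). \<phi> (Suc 0) y b' * A 0 b' b)" if b: "b \<in> Z 0" for b
          using K.coord_el[OF b, of x] dc[OF y(2) b] y(1) by simp
        thus "\<exists>y. \<forall>b\<in>Z 0. x b = (\<Sum>b'\<in>Z (Suc 0). y b' * A 0 b' b)" by blast
      next
        assume "\<exists>y. \<forall>b\<in>Z 0. x b = (\<Sum>b'\<in>Z (Suc 0). y b' * A 0 b' b)"
        then obtain y where y: "\<And>b. b \<in> Z 0 \<Longrightarrow> x b = (\<Sum>b'\<in>Z (Suc 0). y b' * A 0 b' b)" by blast
        have "?e = cdiff C 0 (K.el (Suc 0) y)"
        proof (rule K.inj[of _ 0])
          show "cdiff C 0 (K.el (Suc 0) y) \<in> carrier (cmod C 0)" by (rule mod_homD(1)[OF dh]) simp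
          fix b assume b: "b \<in> Z 0"
          show "\<phi> 0 ?e b = \<phi> 0 (cdiff C 0 (K.el (Suc 0) y)) b"
            using y[OF b] by (simp add: K.coord_el dc b)
        qed simp
        thus "?e \<in> cdiff C 0 ` carrier (cmod C (Suc 0))" by (rule image_eqI) simp
      qed
      finally show ?thesis .
    qed
  qed
  moreover have "\<forall>i. \<forall>b\<in>Z i. \<forall>b'\<in>Z (Suc i). \<exists>x\<in>carrier (cmod C (Suc i)). A i b' b = \<phi> i (cdiff C i x) b"
  proof (intro allI ballI)
    show "\<exists>x\<in>carrier (cmod C (Suc i)). A i b' b = \<phi> i (cdiff C i x) b" for i b b'
      by (rule bexI[of _ "K.ev (Suc i) b'"]) (simp_all add: A_def)
  qed
  ultimately show thesis by (rule that[OF RC])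
qed

section \<open>The tensor product complex\<close>

lemma (in tensor) tensor_hom_eqI:
  assumes \<alpha>: "\<alpha> \<in> mod_hom R T P" and \<beta>: "\<beta> \<in> mod_hom R T P"
    and pure: "\<And>x y. x \<in> carrier M \<Longrightarrow> y \<in> carrier N \<Longrightarrow> \<alpha> (x \<star> y) = \<beta> (x \<star> y)"
    and t: "t \<in> carrier T"
  shows "\<alpha> t = \<beta> t"
  using t by (induct rule: tensor_induct) (simp_all add: mod_homD(2,3)[OF \<alpha>] mod_homD(2,3)[OF \<beta>] pure)

lemma id_mod_hom: "id \<in> mod_hom R M M"
  by (rule mod_homI) auto

locale resolution_pair = FR: resolution_coords FC B dg \<phi> A + GR: resolution_coords GC C dh \<psi> D +
    two_resolutions B A dg r I C D dh s J
  for FC :: "(('n::finite, 'k::field) mpoly, 'b) graded_complex" and B :: "nat \<Rightarrow> 'x set" and dg \<phi> A r I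
    and GC :: "(('n, 'k) mpoly, 'c) graded_complex" and C :: "nat \<Rightarrow> 'y set" and dh \<psi> D s J
begin

sublocale TC: tensor_coords "cmod FC i" "B i" "dg i" "\<phi> i" "cmod GC j" "C j" "dh j" "\<psi> j" for i j
  by (intro tensor_coords.intro FR.coords GR.coords)

sublocale TG: graded_coords "graded_tensor mpoly_ring (cmod FC i) (cmod GC j)" "B i \<times> C j"
  "\<lambda>(b, c). dg i b + dh j c" "TC.tc i j" for i j
  by (rule TC.graded_tensor_coords)

abbreviation TX where "TX \<equiv> tensor_complex mpoly_ring FC GC"
abbreviation FG where "FG i j \<equiv> tensor_module mpoly_ring (cmod FC i) (cmod GC j)"
abbreviation gFG where "gFG i j \<equiv> graded_tensor mpoly_ring (cmod FC i) (cmod GC j)"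
abbreviation pFG where "pFG i j \<equiv> pure_tensor mpoly_ring (cmod FC i) (cmod GC j)"
abbreviation lmap where "lmap i j \<equiv>
  tensor_map mpoly_ring (cmod FC (Suc i)) (cmod GC j) (cmod FC i) (cmod GC j) (cdiff FC i) id"
abbreviation rmap where "rmap i j \<equiv>
  tensor_map mpoly_ring (cmod FC i) (cmod GC (Suc j)) (cmod FC i) (cmod GC j) id (cdiff GC j)"

lemma cmod_TX: "cmod TX n = graded_sum {..n} (\<lambda>i. gFG i (n - i))"
  by (simp add: tensor_complex_def)

sublocale S: graded_coords "cmod TX n" "Sigma {..n} (\<lambda>i. B i \<times> C (n - i))"
    "\<lambda>(i, s). (\<lambda>(b, c). dg i b + dh (n - i) c) s" "\<lambda>t (i, s). TC.tc i (n - i) (t i) s" for n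
  unfolding cmod_TX by (rule graded_sum_coords) (simp, rule TC.graded_tensor_coords)

text \<open>The coordinates of an element of \<open>F \<otimes> G\<close> in the form on which \<open>td\<close> acts.\<close>
definition co :: "nat \<Rightarrow> (nat \<Rightarrow> ('b \<times> 'c \<Rightarrow> ('n, 'k) mpoly) set) \<Rightarrow> nat \<Rightarrow> 'x \<Rightarrow> 'y \<Rightarrow> ('n, 'k) mpoly" where
  "co n t i b c = TC.tc i (n - i) (t i) (b, c)"

lemma co_eqI:
  assumes "x \<in> carrier (cmod TX n)" "y \<in> carrier (cmod TX n)"
    and "\<And>i b c. i \<le> n \<Longrightarrow> b \<in> B i \<Longrightarrow> c \<in> C (n - i) \<Longrightarrow> co n x i b c = co n y i b c"
  shows "x = y"
  by (rule S.inj[OF assms(1,2)]) (use assms(3) in \<open>auto simp: co_def\<close>)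

lemma co_surj: "\<exists>x\<in>carrier (cmod TX n). \<forall>i\<le>n. \<forall>b\<in>B i. \<forall>c\<in>C (n - i). co n x i b c = f i b c"
proof -
  obtain x where x: "x \<in> carrier (cmod TX n)" "\<And>s. s \<in> Sigma {..n} (\<lambda>i. B i \<times> C (n - i)) \<Longrightarrow>
      (case s of (i, s) \<Rightarrow> TC.tc i (n - i) (x i) s) = (case s of (i, b, c) \<Rightarrow> f i b c)"
    using S.surj[of n "\<lambda>(i, b, c). f i b c"] by blast
  have "co n x i b c = f i b c" if "i \<le> n" "b \<in> B i" "c \<in> C (n - i)" for i b c
    using x(2)[of "(i, b, c)"] that by (simp add: co_def)
  thus ?thesis using x(1) by blast
qed

lemma co_part: "x \<in> part (cmod TX n) d \<longleftrightarrow> x \<in> carrier (cmod TX n) \<and>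
    (\<forall>i\<le>n. \<forall>b\<in>B i. \<forall>c\<in>C (n - i). homog mdeg (d - (dg i b + dh (n - i) c)) (co n x i b c))"
  unfolding S.part by (auto simp: co_def)

lemma co_in_ideal:
  assumes "ideal_set K" "x \<in> carrier (cmod TX n)"
  shows "x \<in> gen_submodule mpoly_ring (cmod TX n) {a \<odot>\<^bsub>cmod TX n\<^esub> y |a y. a \<in> K \<and> y \<in> carrier (cmod TX n)} \<longleftrightarrow>
    (\<forall>i\<le>n. \<forall>b\<in>B i. \<forall>c\<in>C (n - i). co n x i b c \<in> K)"
  unfolding S.coords_in_ideal[OF assms] by (auto simp: co_def)

lemma co_add:
  assumes "x \<in> carrier (cmod TX n)" "y \<in> carrier (cmod TX n)" "i \<le> n" "b \<in> B i" "c \<in> C (n - i)"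
  shows "co n (x \<oplus>\<^bsub>cmod TX n\<^esub> y) i b c = co n x i b c + co n y i b c"
  using S.add[OF assms(1,2), of "(i, b, c)"] assms(3-) by (simp add: co_def)

lemma co_smult:
  assumes "x \<in> carrier (cmod TX n)" "i \<le> n" "b \<in> B i" "c \<in> C (n - i)"
  shows "co n (a \<odot>\<^bsub>cmod TX n\<^esub> x) i b c = a * co n x i b c"
  using S.smult[OF assms(1), of "(i, b, c)" a] assms(2-) by (simp add: co_def)

lemma co_zero:
  assumes "i \<le> n" "b \<in> B i" "c \<in> C (n - i)"
  shows "co n \<zero>\<^bsub>cmod TX n\<^esub> i b c = 0"
  using S.coord_zero[of "(i, b, c)" n] assms by (simp add: co_def)

lemma carrier_entry:
  assumes "t \<in> carrier (cmod TX n)" "i \<le> n"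
  shows "t i \<in> carrier (FG i (n - i))"
  using assms by (auto simp: cmod_TX graded_sum_def graded_tensor_simps)

lemma td_cong:
  assumes "\<And>b'. b' \<in> B (Suc i) \<Longrightarrow> t (Suc i) b' c = t' (Suc i) b' c"
    and "\<And>c'. c' \<in> C (Suc (n - i)) \<Longrightarrow> t i b c' = t' i b c'"
  shows "td n t i b c = td n t' i b c"
proof -
  have "F.d i (\<lambda>b'. t (Suc i) b' c) b = F.d i (\<lambda>b'. t' (Suc i) b' c) b"
    by (rule F.d_cong) (rule assms(1))
  moreover have "G.d (n - i) (t i b) c = G.d (n - i) (t' i b) c"
    by (rule G.d_cong) (rule assms(2))
  ultimately show ?thesis by (simp add: td_def)
qed

lemma td_smult: "td n (\<lambda>i b c. a * t i b c) i b c = a * td n t i b c"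
  by (simp add: td_def F.d_mult G.d_mult algebra_simps)

lemma map_left:
  "lmap i j \<in>
    mod_hom mpoly_ring (FG (Suc i) j) (FG i j)"
  by (rule tensor_map(1)[OF TC.M.mod TC.N.mod TC.M.mod TC.N.mod FR.diff_hom id_mod_hom])

lemma map_right:
  "rmap i j \<in>
    mod_hom mpoly_ring (FG i (Suc j)) (FG i j)"
  by (rule tensor_map(1)[OF TC.M.mod TC.N.mod TC.M.mod TC.N.mod id_mod_hom GR.diff_hom])

text \<open>Both sides are linear in \<open>t\<close> and agree on pure tensors.\<close>
lemma map_left_coord:
  assumes b: "b \<in> B i" and c: "c \<in> C j"
    and t: "t \<in> carrier (FG (Suc i) j)"
  shows "TC.tc i j (lmap i j t) (b, c)
    = F.d i (\<lambda>b'. TC.tc (Suc i) j t (b', c)) b"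
proof (rule TC.T.tensor_hom_eqI[where P = mpoly_ring, OF _ _ _ t])
  let ?m = "lmap i j"
  let ?T = "FG (Suc i) j"
  show "(\<lambda>t. TC.tc i j (?m t) (b, c)) \<in> mod_hom mpoly_ring ?T mpoly_ring"
    by (rule mod_homI) (simp_all add: mod_homD[OF map_left] TC.tc_add TC.tc_smult b c)
  show "(\<lambda>t. F.d i (\<lambda>b'. TC.tc (Suc i) j t (b', c)) b) \<in> mod_hom mpoly_ring ?T mpoly_ring"
  proof (rule mod_homI)
    fix x y assume xy: "x \<in> carrier ?T" "y \<in> carrier ?T"
    have "F.d i (\<lambda>b'. TC.tc (Suc i) j (x \<oplus>\<^bsub>?T\<^esub> y) (b', c)) b =
      F.d i (\<lambda>b'. TC.tc (Suc i) j x (b', c) + TC.tc (Suc i) j y (b', c)) b"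
      by (rule F.d_cong) (simp add: TC.tc_add xy c)
    thus "F.d i (\<lambda>b'. TC.tc (Suc i) j (x \<oplus>\<^bsub>?T\<^esub> y) (b', c)) b =
      F.d i (\<lambda>b'. TC.tc (Suc i) j x (b', c)) b \<oplus>\<^bsub>mpoly_ring\<^esub> F.d i (\<lambda>b'. TC.tc (Suc i) j y (b', c)) b"
      by (simp add: F.d_add)
  next
    fix a x assume x: "x \<in> carrier ?T"
    have "F.d i (\<lambda>b'. TC.tc (Suc i) j (a \<odot>\<^bsub>?T\<^esub> x) (b', c)) b = F.d i (\<lambda>b'. a * TC.tc (Suc i) j x (b', c)) b"
      by (rule F.d_cong) (simp add: TC.tc_smult x c)
    thus "F.d i (\<lambda>b'. TC.tc (Suc i) j (a \<odot>\<^bsub>?T\<^esub> x) (b', c)) b = a \<odot>\<^bsub>mpoly_ring\<^esub> F.d i (\<lambda>b'. TC.tc (Suc i) j x (b', c)) b"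
      by (simp add: F.d_mult)
  qed simp
  fix x y assume x: "x \<in> carrier (cmod FC (Suc i))" and y: "y \<in> carrier (cmod GC j)"
  have "?m (pFG (Suc i) j x y) = pFG i j (cdiff FC i x) (id y)"
    by (rule tensor_map(2)[OF TC.M.mod TC.N.mod TC.M.mod TC.N.mod FR.diff_hom id_mod_hom x y])
  hence "TC.tc i j (?m (pFG (Suc i) j x y)) (b, c) =
      F.d i (\<phi> (Suc i) x) b * \<psi> j y c"
    using x y b c by (simp add: TC.tc_pure mod_homD(1)[OF FR.diff_hom] FR.diff_coord F.d_def)
  also have "\<dots> = F.d i (\<lambda>b'. TC.tc (Suc i) j (pFG (Suc i) j x y) (b', c)) b"
    unfolding F.d_mult_right[symmetric] by (rule F.d_cong) (simp add: TC.tc_pure x y c)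
  finally show "TC.tc i j (?m (pFG (Suc i) j x y)) (b, c) =
    F.d i (\<lambda>b'. TC.tc (Suc i) j (pFG (Suc i) j x y) (b', c)) b" .
qed

lemma map_right_coord:
  assumes b: "b \<in> B i" and c: "c \<in> C j"
    and t: "t \<in> carrier (FG i (Suc j))"
  shows "TC.tc i j (rmap i j t) (b, c)
    = G.d j (\<lambda>c'. TC.tc i (Suc j) t (b, c')) c"
proof (rule TC.T.tensor_hom_eqI[where P = mpoly_ring, OF _ _ _ t])
  let ?m = "rmap i j"
  let ?T = "FG i (Suc j)"
  show "(\<lambda>t. TC.tc i j (?m t) (b, c)) \<in> mod_hom mpoly_ring ?T mpoly_ring"
    by (rule mod_homI) (simp_all add: mod_homD[OF map_right] TC.tc_add TC.tc_smult b c)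
  show "(\<lambda>t. G.d j (\<lambda>c'. TC.tc i (Suc j) t (b, c')) c) \<in> mod_hom mpoly_ring ?T mpoly_ring"
  proof (rule mod_homI)
    fix x y assume xy: "x \<in> carrier ?T" "y \<in> carrier ?T"
    have "G.d j (\<lambda>c'. TC.tc i (Suc j) (x \<oplus>\<^bsub>?T\<^esub> y) (b, c')) c =
      G.d j (\<lambda>c'. TC.tc i (Suc j) x (b, c') + TC.tc i (Suc j) y (b, c')) c"
      by (rule G.d_cong) (simp add: TC.tc_add xy b)
    thus "G.d j (\<lambda>c'. TC.tc i (Suc j) (x \<oplus>\<^bsub>?T\<^esub> y) (b, c')) c =
      G.d j (\<lambda>c'. TC.tc i (Suc j) x (b, c')) c \<oplus>\<^bsub>mpoly_ring\<^esub> G.d j (\<lambda>c'. TC.tc i (Suc j) y (b, c')) c"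
      by (simp add: G.d_add)
  next
    fix a x assume x: "x \<in> carrier ?T"
    have "G.d j (\<lambda>c'. TC.tc i (Suc j) (a \<odot>\<^bsub>?T\<^esub> x) (b, c')) c = G.d j (\<lambda>c'. a * TC.tc i (Suc j) x (b, c')) c"
      by (rule G.d_cong) (simp add: TC.tc_smult x b)
    thus "G.d j (\<lambda>c'. TC.tc i (Suc j) (a \<odot>\<^bsub>?T\<^esub> x) (b, c')) c = a \<odot>\<^bsub>mpoly_ring\<^esub> G.d j (\<lambda>c'. TC.tc i (Suc j) x (b, c')) c"
      by (simp add: G.d_mult)
  qed simp
  fix x y assume x: "x \<in> carrier (cmod FC i)" and y: "y \<in> carrier (cmod GC (Suc j))"
  have "?m (pFG i (Suc j) x y) = pFG i j (id x) (cdiff GC j y)"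
    by (rule tensor_map(2)[OF TC.M.mod TC.N.mod TC.M.mod TC.N.mod id_mod_hom GR.diff_hom x y])
  hence "TC.tc i j (?m (pFG i (Suc j) x y)) (b, c) =
      \<phi> i x b * G.d j (\<psi> (Suc j) y) c"
    using x y b c by (simp add: TC.tc_pure mod_homD(1)[OF GR.diff_hom] GR.diff_coord G.d_def)
  also have "\<dots> = G.d j (\<lambda>c'. TC.tc i (Suc j) (pFG i (Suc j) x y) (b, c')) c"
    unfolding G.d_mult[symmetric] by (rule G.d_cong) (simp add: TC.tc_pure x y b)
  finally show "TC.tc i j (?m (pFG i (Suc j) x y)) (b, c) =
    G.d j (\<lambda>c'. TC.tc i (Suc j) (pFG i (Suc j) x y) (b, c')) c" .
qed

text \<open>In coordinates the differential of the tensor product complex is \<open>td\<close>. The remaining properties of the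
  complex are thereby consequences of statements about matrices.\<close>
lemma diff_entry:
  assumes t: "t \<in> carrier (cmod TX (Suc n))" and i: "i \<le> n"
  shows "cdiff TX n t i \<in> carrier (gFG i (n - i))"
    and "b \<in> B i \<Longrightarrow> c \<in> C (n - i) \<Longrightarrow> co n (cdiff TX n t) i b c = td n (co (Suc n) t) i b c"
proof -
  let ?T = "gFG i (n - i)"
  define u where "u = lmap i (n - i) (t (Suc i))"
  define v where "v = rmap i (n - i) (t i)"
  have e: "cdiff TX n t i = u \<oplus>\<^bsub>?T\<^esub> (if even i then v else \<ominus>\<^bsub>?T\<^esub> v)"
    using i by (simp add: tensor_complex_def Let_def u_def v_def)
  have n: "Suc n - i = Suc (n - i)" using i by simp
  have t1: "t (Suc i) \<in> carrier (FG (Suc i) (n - i))"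
    using carrier_entry[OF t, of "Suc i"] i by simp
  have t2: "t i \<in> carrier (FG i (Suc (n - i)))"
    using carrier_entry[OF t, of i] i by (simp add: n)
  have u: "u \<in> carrier ?T" unfolding u_def graded_tensor_simps by (rule mod_homD(1)[OF map_left t1])
  have v: "v \<in> carrier ?T" unfolding v_def graded_tensor_simps by (rule mod_homD(1)[OF map_right t2])
  have v': "(if even i then v else \<ominus>\<^bsub>?T\<^esub> v) \<in> carrier ?T" using v by simp
  show "cdiff TX n t i \<in> carrier ?T" unfolding e using u v' by (rule TG.M.a_closed)
  assume b: "b \<in> B i" and c: "c \<in> C (n - i)"
  have "co n (cdiff TX n t) i b c = TC.tc i (n - i) u (b, c) + TC.tc i (n - i) (if even i then v else \<ominus>\<^bsub>?T\<^esub> v) (b, c)"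
    unfolding co_def e by (rule TG.add[OF u v']) (simp add: b c)
  also have "TC.tc i (n - i) (if even i then v else \<ominus>\<^bsub>?T\<^esub> v) (b, c) = (- 1) ^ i * TC.tc i (n - i) v (b, c)"
    using TG.coord_uminus[OF _ v, of "(b, c)"] b c by simp
  also have "TC.tc i (n - i) v (b, c) = G.d (n - i) (co (Suc n) t i b) c"
    unfolding v_def map_right_coord[OF b c t2] by (simp add: co_def[abs_def] n)
  also have "TC.tc i (n - i) u (b, c) = F.d i (\<lambda>b'. co (Suc n) t (Suc i) b' c) b"
    unfolding u_def map_left_coord[OF b c t1] by (simp add: co_def)
  finally show "co n (cdiff TX n t) i b c = td n (co (Suc n) t) i b c" unfolding td_def .
qed

lemma diff_closed:
  assumes t: "t \<in> carrier (cmod TX (Suc n))"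
  shows "cdiff TX n t \<in> carrier (cmod TX n)"
proof -
  have "cdiff TX n t \<in> (\<Pi>\<^sub>E i\<in>{..n}. carrier (gFG i (n - i)))"
  proof (rule PiE_I)
    show "cdiff TX n t i \<in> carrier (gFG i (n - i))" if "i \<in> {..n}" for i
      using diff_entry(1)[OF t, of i] that by simp
    show "cdiff TX n t i = undefined" if "i \<notin> {..n}" for i
      using that by (simp add: tensor_complex_def)
  qed
  thus ?thesis by (simp add: cmod_TX graded_sum_def)
qed

lemma diff_graded_hom: "graded_hom mpoly_ring (cmod TX (Suc n)) (cmod TX n) (cdiff TX n)"
  unfolding graded_hom_iff
proof (intro conjI allI image_subsetI)
  show "cdiff TX n \<in> mod_hom mpoly_ring (cmod TX (Suc n)) (cmod TX n)"
  proof (rule mod_homI)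
    fix x y assume x: "x \<in> carrier (cmod TX (Suc n))" and y: "y \<in> carrier (cmod TX (Suc n))"
    have xy: "x \<oplus>\<^bsub>cmod TX (Suc n)\<^esub> y \<in> carrier (cmod TX (Suc n))" using x y by (rule S.M.a_closed)
    show "cdiff TX n (x \<oplus>\<^bsub>cmod TX (Suc n)\<^esub> y) = cdiff TX n x \<oplus>\<^bsub>cmod TX n\<^esub> cdiff TX n y"
    proof (rule co_eqI[OF diff_closed[OF xy] S.M.a_closed[OF diff_closed[OF x] diff_closed[OF y]]])
      fix i b c assume i: "i \<le> n" "b \<in> B i" "c \<in> C (n - i)"
      have "co n (cdiff TX n (x \<oplus>\<^bsub>cmod TX (Suc n)\<^esub> y)) i b c = td n (co (Suc n) (x \<oplus>\<^bsub>cmod TX (Suc n)\<^esub> y)) i b c"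
        by (rule diff_entry(2)[OF xy i])
      also have "\<dots> = td n (\<lambda>i b c. co (Suc n) x i b c + co (Suc n) y i b c) i b c"
        by (rule td_cong) (use i in \<open>simp_all add: co_add x y Suc_diff_le\<close>)
      also have "\<dots> = co n (cdiff TX n x \<oplus>\<^bsub>cmod TX n\<^esub> cdiff TX n y) i b c"
        by (simp add: td_add co_add[OF diff_closed[OF x] diff_closed[OF y] i] diff_entry(2)[OF x i] diff_entry(2)[OF y i])
      finally show "co n (cdiff TX n (x \<oplus>\<^bsub>cmod TX (Suc n)\<^esub> y)) i b c = co n (cdiff TX n x \<oplus>\<^bsub>cmod TX n\<^esub> cdiff TX n y) i b c" .
    qed
  next
    fix a x assume x: "x \<in> carrier (cmod TX (Suc n))"
    have ax: "a \<odot>\<^bsub>cmod TX (Suc n)\<^esub> x \<in> carrier (cmod TX (Suc n))" using x by (rule S.smult_closed')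
    show "cdiff TX n (a \<odot>\<^bsub>cmod TX (Suc n)\<^esub> x) = a \<odot>\<^bsub>cmod TX n\<^esub> cdiff TX n x"
    proof (rule co_eqI[OF diff_closed[OF ax] S.smult_closed'[OF diff_closed[OF x]]])
      fix i b c assume i: "i \<le> n" "b \<in> B i" "c \<in> C (n - i)"
      have "co n (cdiff TX n (a \<odot>\<^bsub>cmod TX (Suc n)\<^esub> x)) i b c = td n (co (Suc n) (a \<odot>\<^bsub>cmod TX (Suc n)\<^esub> x)) i b c"
        by (rule diff_entry(2)[OF ax i])
      also have "\<dots> = td n (\<lambda>i b c. a * co (Suc n) x i b c) i b c"
        by (rule td_cong) (use i in \<open>simp_all add: co_smult x Suc_diff_le\<close>)
      also have "\<dots> = co n (a \<odot>\<^bsub>cmod TX n\<^esub> cdiff TX n x) i b c"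
        by (simp add: td_smult co_smult[OF diff_closed[OF x] i] diff_entry(2)[OF x i])
      finally show "co n (cdiff TX n (a \<odot>\<^bsub>cmod TX (Suc n)\<^esub> x)) i b c = co n (a \<odot>\<^bsub>cmod TX n\<^esub> cdiff TX n x) i b c" .
    qed
  qed (rule diff_closed)
  fix e t assume "t \<in> part (cmod TX (Suc n)) e"
  hence t: "t \<in> carrier (cmod TX (Suc n))"
    and h: "\<And>i b c. i \<le> Suc n \<Longrightarrow> b \<in> B i \<Longrightarrow> c \<in> C (Suc n - i) \<Longrightarrow> homog mdeg (e - (dg i b + dh (Suc n - i) c)) (co (Suc n) t i b c)"
    by (auto simp: co_part)
  have "homog mdeg (e - (dg i b + dh (n - i) c)) (td n (co (Suc n) t) i b c)"
    if i: "i \<le> n" "b \<in> B i" "c \<in> C (n - i)" for i b c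
  proof -
    have n: "Suc n - i = Suc (n - i)" using i by simp
    have "homog mdeg (e - (dg i b + dh (n - i) c)) (co (Suc n) t (Suc i) b' c * A i b' b)" if b': "b' \<in> B (Suc i)" for b'
      using homog_mult[OF mdeg_add h[of "Suc i" b' c] F.homog_A[OF b' i(2)]] i b' by (simp add: algebra_simps)
    hence "homog mdeg (e - (dg i b + dh (n - i) c)) (F.d i (\<lambda>b'. co (Suc n) t (Suc i) b' c) b)"
      unfolding F.d_def by (intro homog_sum)
    moreover have "homog mdeg (e - (dg i b + dh (n - i) c)) (co (Suc n) t i b c' * D (n - i) c' c)" if c': "c' \<in> C (Suc (n - i))" for c'
      using homog_mult[OF mdeg_add h[of i b c'] G.homog_A[OF c' i(3)]] i c' by (simp add: n algebra_simps)
    hence "homog mdeg (e - (dg i b + dh (n - i) c)) (G.d (n - i) (co (Suc n) t i b) c)"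
      unfolding G.d_def by (intro homog_sum)
    hence "homog mdeg (e - (dg i b + dh (n - i) c)) ((- 1) ^ i * G.d (n - i) (co (Suc n) t i b) c)"
      by (cases "even i") (simp_all add: homog_uminus)
    ultimately show ?thesis
      unfolding td_def by (rule homog_add)
  qed
  thus "cdiff TX n t \<in> part (cmod TX n) e"
    unfolding co_part using diff_closed[OF t] diff_entry(2)[OF t] by simp
qed

lemma kernel_iff:
  assumes t: "t \<in> carrier (cmod TX (Suc n))"
  shows "cdiff TX n t = \<zero>\<^bsub>cmod TX n\<^esub> \<longleftrightarrow> (\<forall>i\<le>n. \<forall>b\<in>B i. \<forall>c\<in>C (n - i). td n (co (Suc n) t) i b c = 0)"
proof
  assume z: "cdiff TX n t = \<zero>\<^bsub>cmod TX n\<^esub>"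
  show "\<forall>i\<le>n. \<forall>b\<in>B i. \<forall>c\<in>C (n - i). td n (co (Suc n) t) i b c = 0"
  proof (intro allI impI ballI)
    fix i b c assume i: "i \<le> n" "b \<in> B i" "c \<in> C (n - i)"
    show "td n (co (Suc n) t) i b c = 0"
      using diff_entry(2)[OF t i] co_zero[OF i] by (simp add: z)
  qed
next
  assume *: "\<forall>i\<le>n. \<forall>b\<in>B i. \<forall>c\<in>C (n - i). td n (co (Suc n) t) i b c = 0"
  show "cdiff TX n t = \<zero>\<^bsub>cmod TX n\<^esub>"
    by (rule co_eqI[OF diff_closed[OF t] S.M.zero_closed]) (use * in \<open>simp add: diff_entry(2)[OF t] co_zero\<close>)
qed

lemma image_iff_td:
  assumes t: "t \<in> carrier (cmod TX n)"
  shows "t \<in> cdiff TX n ` carrier (cmod TX (Suc n)) \<longleftrightarrow>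
    (\<exists>u. \<forall>i\<le>n. \<forall>b\<in>B i. \<forall>c\<in>C (n - i). co n t i b c = td n u i b c)"
proof
  assume "t \<in> cdiff TX n ` carrier (cmod TX (Suc n))"
  then obtain x where x: "t = cdiff TX n x" "x \<in> carrier (cmod TX (Suc n))" by (rule imageE)
  have "\<forall>i\<le>n. \<forall>b\<in>B i. \<forall>c\<in>C (n - i). co n t i b c = td n (co (Suc n) x) i b c"
    unfolding x(1) using diff_entry(2)[OF x(2)] by simp
  thus "\<exists>u. \<forall>i\<le>n. \<forall>b\<in>B i. \<forall>c\<in>C (n - i). co n t i b c = td n u i b c"
    by (rule exI[of _ "co (Suc n) x"])
next
  assume "\<exists>u. \<forall>i\<le>n. \<forall>b\<in>B i. \<forall>c\<in>C (n - i). co n t i b c = td n u i b c"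
  then obtain u where u: "\<forall>i\<le>n. \<forall>b\<in>B i. \<forall>c\<in>C (n - i). co n t i b c = td n u i b c" by (rule exE)
  obtain x where x: "x \<in> carrier (cmod TX (Suc n))"
    "\<forall>i\<le>Suc n. \<forall>b\<in>B i. \<forall>c\<in>C (Suc n - i). co (Suc n) x i b c = u i b c"
    using co_surj[of "Suc n" u] by (rule bexE)
  have "t = cdiff TX n x"
  proof (rule co_eqI[OF t diff_closed[OF x(1)]])
    fix i b c assume i: "i \<le> n" "b \<in> B i" "c \<in> C (n - i)"
    have "td n u i b c = td n (co (Suc n) x) i b c"
      by (rule td_cong) (use i x(2) in \<open>simp_all add: Suc_diff_le\<close>)
    thus "co n t i b c = co n (cdiff TX n x) i b c" using u i by (simp add: diff_entry(2)[OF x(1) i])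
  qed
  thus "t \<in> cdiff TX n ` carrier (cmod TX (Suc n))" using x(1) by (rule image_eqI)
qed

lemma diff_exact:
  "cdiff TX (Suc n) ` carrier (cmod TX (Suc (Suc n))) = a_kernel (cmod TX (Suc n)) (cmod TX n) (cdiff TX n)"
proof (rule Set.set_eqI)
  fix t
  show "t \<in> cdiff TX (Suc n) ` carrier (cmod TX (Suc (Suc n))) \<longleftrightarrow> t \<in> a_kernel (cmod TX (Suc n)) (cmod TX n) (cdiff TX n)"
  proof (cases "t \<in> carrier (cmod TX (Suc n))")
    case True
    have "(\<exists>u. \<forall>i\<le>Suc n. \<forall>b\<in>B i. \<forall>c\<in>C (Suc n - i). co (Suc n) t i b c = td (Suc n) u i b c) \<longleftrightarrow>
      (\<forall>i\<le>n. \<forall>b\<in>B i. \<forall>c\<in>C (n - i). td n (co (Suc n) t) i b c = 0)"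
    proof
      assume "\<exists>u. \<forall>i\<le>Suc n. \<forall>b\<in>B i. \<forall>c\<in>C (Suc n - i). co (Suc n) t i b c = td (Suc n) u i b c"
      then obtain u where u: "\<forall>i\<le>Suc n. \<forall>b\<in>B i. \<forall>c\<in>C (Suc n - i). co (Suc n) t i b c = td (Suc n) u i b c" by (rule exE)
      show "\<forall>i\<le>n. \<forall>b\<in>B i. \<forall>c\<in>C (n - i). td n (co (Suc n) t) i b c = 0"
      proof (intro allI impI ballI)
        fix i b c assume i: "i \<le> n" "b \<in> B i" "c \<in> C (n - i)"
        have "td n (co (Suc n) t) i b c = td n (td (Suc n) u) i b c"
          by (rule td_cong) (use i u in \<open>simp_all add: Suc_diff_le\<close>)
        thus "td n (co (Suc n) t) i b c = 0" by (simp add: td_td[OF i])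
      qed
    next
      assume "\<forall>i\<le>n. \<forall>b\<in>B i. \<forall>c\<in>C (n - i). td n (co (Suc n) t) i b c = 0"
      thus "\<exists>u. \<forall>i\<le>Suc n. \<forall>b\<in>B i. \<forall>c\<in>C (Suc n - i). co (Suc n) t i b c = td (Suc n) u i b c"
        by (intro tensor_exact) simp
    qed
    thus ?thesis using True by (simp add: image_iff_td[OF True] a_kernel_def' kernel_iff[OF True])
  next
    case False
    thus ?thesis using diff_closed by (auto simp: a_kernel_def')
  qed
qed

lemma ideal_sum: "ideal_set (I <+>\<^bsub>mpoly_ring\<^esub> J)"
proof -
  have m: "p \<in> I <+>\<^bsub>mpoly_ring\<^esub> J \<longleftrightarrow> (\<exists>i\<in>I. \<exists>j\<in>J. p = i + j)" for p
    by (simp add: set_add_def set_mult_def)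
  show ?thesis
    unfolding ideal_set_def
  proof (intro conjI ballI allI)
    show "0 \<in> I <+>\<^bsub>mpoly_ring\<^esub> J"
      unfolding m by (intro bexI[of _ 0]) (simp_all add: ideal_setD(1)[OF F.ideal_I] ideal_setD(1)[OF G.ideal_I])
  next
    fix p q assume "p \<in> I <+>\<^bsub>mpoly_ring\<^esub> J" "q \<in> I <+>\<^bsub>mpoly_ring\<^esub> J"
    then obtain i j i' j' where ij: "i \<in> I" "j \<in> J" "p = i + j" "i' \<in> I" "j' \<in> J" "q = i' + j'"
      unfolding m by (elim bexE)
    have "p + q = (i + i') + (j + j')" using ij by simp
    thus "p + q \<in> I <+>\<^bsub>mpoly_ring\<^esub> J"
      unfolding m using ideal_setD(2)[OF F.ideal_I ij(1,4)] ideal_setD(2)[OF G.ideal_I ij(2,5)] by (intro bexI)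
  next
    fix p q assume "p \<in> I <+>\<^bsub>mpoly_ring\<^esub> J"
    then obtain i j where ij: "i \<in> I" "j \<in> J" "p = i + j"
      unfolding m by (elim bexE)
    have "q * p = q * i + q * j" using ij by (simp add: distrib_left)
    thus "q * p \<in> I <+>\<^bsub>mpoly_ring\<^esub> J"
      unfolding m using ideal_setD(3)[OF F.ideal_I ij(1)] ideal_setD(3)[OF G.ideal_I ij(2)] by (intro bexI)
  qed
qed

text \<open>The augmentation sends \<open>b \<otimes> c\<close> to the class of \<open>r b * s c\<close>.\<close>
theorem tensor_resolution:
  "graded_free_resolution mpoly_ring TX (graded_quot mpoly_ring (I <+>\<^bsub>mpoly_ring\<^esub> J))"
proof -
  interpret K: cyclic_quotient "I <+>\<^bsub>mpoly_ring\<^esub> J" by unfold_locales (rule ideal_sum)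
  define p where "p t = (\<Sum>b\<in>B 0. \<Sum>c\<in>C 0. co 0 t 0 b c * (r b * s c))" for t
  have p_add: "p (x \<oplus>\<^bsub>cmod TX 0\<^esub> y) = p x + p y" if "x \<in> carrier (cmod TX 0)" "y \<in> carrier (cmod TX 0)" for x y
    using that by (simp add: p_def co_add distrib_right sum.distrib)
  have p_smult: "p (a \<odot>\<^bsub>cmod TX 0\<^esub> x) = a * p x" if "x \<in> carrier (cmod TX 0)" for a x
    using that by (simp add: p_def co_smult sum_distrib_left mult.assoc)
  let ?\<epsilon> = "\<lambda>t. K.cls (p t)"
  have hom: "graded_hom mpoly_ring (cmod TX 0) K.RI ?\<epsilon>"
    unfolding graded_hom_iff
  proof (intro conjI allI image_subsetI)
    show "?\<epsilon> \<in> mod_hom mpoly_ring (cmod TX 0) K.RI"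
    proof (rule mod_homI)
      show "?\<epsilon> x \<in> carrier K.RI" for x by (simp add: K.carrier_RI)
      show "?\<epsilon> (x \<oplus>\<^bsub>cmod TX 0\<^esub> y) = ?\<epsilon> x \<oplus>\<^bsub>K.RI\<^esub> ?\<epsilon> y" if "x \<in> carrier (cmod TX 0)" "y \<in> carrier (cmod TX 0)" for x y
        using mod_homD(2)[OF K.cls_hom, of "p x" "p y"] by (simp add: p_add[OF that])
      show "?\<epsilon> (a \<odot>\<^bsub>cmod TX 0\<^esub> x) = a \<odot>\<^bsub>K.RI\<^esub> ?\<epsilon> x" if "x \<in> carrier (cmod TX 0)" for a x
        using mod_homD(3)[OF K.cls_hom, of a "p x"] by (simp add: p_smult[OF that])
    qed
    fix e t assume t: "t \<in> part (cmod TX 0) e"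
    have "homog mdeg e (co 0 t 0 b c * (r b * s c))" if b: "b \<in> B 0" and c: "c \<in> C 0" for b c
    proof -
      have "homog mdeg (e - (dg 0 b + dh 0 c)) (co 0 t 0 b c)" using t b c by (simp add: co_part)
      from homog_mult[OF mdeg_add this homog_mult[OF mdeg_add F.homog_r[OF b] G.homog_r[OF c]]]
      show ?thesis by simp
    qed
    hence "homog mdeg e (p t)" unfolding p_def by (intro homog_sum)
    thus "?\<epsilon> t \<in> part K.RI e" unfolding K.part_RI by blast
  qed
  have surj: "?\<epsilon> ` carrier (cmod TX 0) = carrier K.RI"
  proof
    show "?\<epsilon> ` carrier (cmod TX 0) \<subseteq> carrier K.RI" by (auto simp: K.carrier_RI)
    obtain f where f: "(\<Sum>b\<in>B 0. \<Sum>c\<in>C 0. f b c * (r b * s c)) - 1 \<in> I <+>\<^bsub>mpoly_ring\<^esub> J"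
      using tensor_aug_unit by (rule exE)
    obtain x where x: "x \<in> carrier (cmod TX 0)" "\<forall>i\<le>0. \<forall>b\<in>B i. \<forall>c\<in>C (0 - i). co 0 x i b c = f b c"
      using co_surj[of 0 "\<lambda>_. f"] by (rule bexE)
    have px: "p x - 1 \<in> I <+>\<^bsub>mpoly_ring\<^esub> J" using f x(2) by (simp add: p_def)
    show "carrier K.RI \<subseteq> ?\<epsilon> ` carrier (cmod TX 0)"
      unfolding K.carrier_RI
    proof (rule image_subsetI)
      fix a :: "('n, 'k) mpoly"
      have "a * (p x - 1) \<in> I <+>\<^bsub>mpoly_ring\<^esub> J" by (rule ideal_setD(3)[OF ideal_sum px])
      hence "p (a \<odot>\<^bsub>cmod TX 0\<^esub> x) - a \<in> I <+>\<^bsub>mpoly_ring\<^esub> J"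
        by (simp add: p_smult[OF x(1)] right_diff_distrib)
      hence "K.cls a = ?\<epsilon> (a \<odot>\<^bsub>cmod TX 0\<^esub> x)" unfolding K.cls_eq[symmetric] by (rule sym)
      thus "K.cls a \<in> ?\<epsilon> ` carrier (cmod TX 0)"
        by (rule image_eqI[of _ ?\<epsilon> "a \<odot>\<^bsub>cmod TX 0\<^esub> x"]) (rule S.smult_closed'[OF x(1)])
    qed
  qed
  have ker: "cdiff TX 0 ` carrier (cmod TX (Suc 0)) = a_kernel (cmod TX 0) K.RI ?\<epsilon>"
  proof (rule Set.set_eqI)
    fix t
    show "t \<in> cdiff TX 0 ` carrier (cmod TX (Suc 0)) \<longleftrightarrow> t \<in> a_kernel (cmod TX 0) K.RI ?\<epsilon>"
    proof (cases "t \<in> carrier (cmod TX 0)")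
      case True
      have "t \<in> a_kernel (cmod TX 0) K.RI ?\<epsilon> \<longleftrightarrow> p t \<in> I <+>\<^bsub>mpoly_ring\<^esub> J"
        using True K.cls_eq[of "p t" 0] by (simp add: a_kernel_def' K.zero_RI)
      also have "\<dots> \<longleftrightarrow> (\<exists>u. \<forall>b\<in>B 0. \<forall>c\<in>C 0. co 0 t 0 b c = td 0 u 0 b c)"
      proof
        assume "p t \<in> I <+>\<^bsub>mpoly_ring\<^esub> J"
        thus "\<exists>u. \<forall>b\<in>B 0. \<forall>c\<in>C 0. co 0 t 0 b c = td 0 u 0 b c"
          unfolding p_def by (rule tensor_aug_kernel)
      next
        assume "\<exists>u. \<forall>b\<in>B 0. \<forall>c\<in>C 0. co 0 t 0 b c = td 0 u 0 b c"
        then obtain u where "\<forall>b\<in>B 0. \<forall>c\<in>C 0. co 0 t 0 b c = td 0 u 0 b c" by (rule exE)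
        hence "p t = (\<Sum>b\<in>B 0. \<Sum>c\<in>C 0. td 0 u 0 b c * (r b * s c))" by (simp add: p_def)
        thus "p t \<in> I <+>\<^bsub>mpoly_ring\<^esub> J" by (simp only: tensor_aug_image)
      qed
      finally show ?thesis by (simp add: image_iff_td[OF True])
    next
      case False
      thus ?thesis using diff_closed by (auto simp: a_kernel_def')
    qed
  qed
  show ?thesis
    unfolding graded_free_resolution_def
    using S.graded_free diff_graded_hom diff_exact hom surj ker by (intro conjI allI exI[of _ ?\<epsilon>])
qed

theorem tensor_minimal:
  assumes K: "ideal_set K"
    and A: "\<And>i b b'. b \<in> B i \<Longrightarrow> b' \<in> B (Suc i) \<Longrightarrow> A i b' b \<in> K"
    and D: "\<And>j c c'. c \<in> C j \<Longrightarrow> c' \<in> C (Suc j) \<Longrightarrow> D j c' c \<in> K"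
  shows "cdiff TX n ` carrier (cmod TX (Suc n)) \<subseteq>
    gen_submodule mpoly_ring (cmod TX n) {a \<odot>\<^bsub>cmod TX n\<^esub> x |a x. a \<in> K \<and> x \<in> carrier (cmod TX n)}"
proof (rule image_subsetI)
  fix t assume t: "t \<in> carrier (cmod TX (Suc n))"
  have "td n u i b c \<in> K" if i: "i \<le> n" "b \<in> B i" "c \<in> C (n - i)" for u i b c
    unfolding td_def F.d_def G.d_def
    by (intro ideal_setD(2)[OF K] ideal_set_sum[OF K] ideal_setD(3)[OF K] A D i)
  thus "cdiff TX n t \<in> gen_submodule mpoly_ring (cmod TX n) {a \<odot>\<^bsub>cmod TX n\<^esub> x |a x. a \<in> K \<and> x \<in> carrier (cmod TX n)}"
    unfolding co_in_ideal[OF K diff_closed[OF t]] using diff_entry(2)[OF t] by simp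
qed

end

section \<open>Graded ideals and minimality\<close>

lemma ideal_set_ideal: "ideal_set K \<Longrightarrow> ideal K mpoly_ring"
proof (rule idealI)
  assume K: "ideal_set K"
  interpret cring "mpoly_ring :: (('a, 'b) mpoly, ('a, 'b) mpoly) graded_module" by (rule cring_mpoly_ring)
  show "ring (mpoly_ring :: (('a, 'b) mpoly, ('a, 'b) mpoly) graded_module)" by (rule ring_axioms)
  show "subgroup K (add_monoid mpoly_ring)"
    using ideal_setD[OF K] by (intro add.subgroupI) (auto simp: a_inv_mpoly_ring simp flip: a_inv_def)
qed (auto simp: ideal_setD)

text \<open>The elements all of whose truncations lie in \<open>J\<close> form an ideal. It contains the homogeneous elements of
  \<open>J\<close>, which generate \<open>J\<close>.\<close>
lemma graded_ideal_graded_set: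
  fixes J :: "('n::finite, 'k::field) mpoly set"
  assumes "graded_ideal mpoly_ring J"
  shows "ideal_set J" "graded_set J"
proof -
  interpret cring "mpoly_ring :: (('n, 'k) mpoly, ('n, 'k) mpoly) graded_module" by (rule cring_mpoly_ring)
  show J: "ideal_set J" using assms by (simp add: graded_ideal_def ideal_mpoly_ring)
  let ?K = "{p. \<forall>D. filt (\<lambda>m. mdeg m \<le> D) p \<in> J}"
  have mult: "filt (\<lambda>m. mdeg m \<le> D) (q * p) \<in> J" if p: "p \<in> ?K" for p q D
  proof (induct q rule: poly_mapping_induct_single)
    case (single m c)
    have "filt (\<lambda>m. mdeg m \<le> D) (p * single m c) = filt (\<lambda>m'. mdeg m' \<le> D - mdeg m) p * single m c"
      by (rule filt_mult_homog[OF mdeg_add homog_single]) simp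
    thus ?case using p J by (simp add: ideal_setD mult.commute)
  next
    case (add q1 q2)
    thus ?case by (simp add: distrib_right filt_add ideal_setD[OF J])
  qed
  have "ideal_set ?K"
    unfolding ideal_set_def using J mult by (auto simp: filt_add ideal_setD)
  hence K: "ideal ?K mpoly_ring" by (rule ideal_set_ideal)
  have "J \<inter> (\<Union>d. part mpoly_ring d) \<subseteq> ?K"
  proof (intro subsetI CollectI allI)
    fix p D assume "p \<in> J \<inter> (\<Union>d. part mpoly_ring d)"
    then obtain d where p: "p \<in> J" "homog mdeg d p" by (auto simp: part_mpoly_ring)
    have "filt (\<lambda>m. mdeg m \<le> D) p = (if d \<le> D then p else 0)"
      using p(2) by (intro poly_mapping_eqI) (auto simp: lookup_filt homog_def in_keys_iff)
    thus "filt (\<lambda>m. mdeg m \<le> D) p \<in> J" using p(1) J by (simp add: ideal_setD)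
  qed
  hence "genideal mpoly_ring (J \<inter> (\<Union>d. part mpoly_ring d)) \<subseteq> ?K" by (rule genideal_minimal[OF K])
  hence "J \<subseteq> ?K" using assms by (simp add: graded_ideal_def)
  thus "graded_set J" by (auto simp: graded_set_def)
qed

lemma irrelevant_ideal: "ideal_set (irrelevant_ideal :: ('n::finite, 'k::field) mpoly set)"
proof -
  interpret cring "mpoly_ring :: (('n, 'k) mpoly, ('n, 'k) mpoly) graded_module" by (rule cring_mpoly_ring)
  show ?thesis
    unfolding irrelevant_ideal_def by (rule ideal_mpoly_ring) (rule genideal_ideal, simp)
qed

lemma minimal_resolution_matrices:
  fixes C :: "(('n::finite, 'k::field) mpoly, 'b) graded_complex"
  assumes I: "ideal_set I" and res: "minimal_graded_free_resolution C (graded_quot mpoly_ring I)"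
  obtains Z :: "nat \<Rightarrow> 'b set" and dg \<phi> A r
    where "resolution_coords C Z dg \<phi> A" "matrix_resolution Z A dg r I"
      "\<forall>i. \<forall>b\<in>Z i. \<forall>b'\<in>Z (Suc i). A i b' b \<in> irrelevant_ideal"
proof -
  have "graded_free_resolution mpoly_ring C (graded_quot mpoly_ring I)"
    using res by (simp add: minimal_graded_free_resolution_def)
  then obtain Z :: "nat \<Rightarrow> 'b set" and dg \<phi> A r
    where Z: "resolution_coords C Z dg \<phi> A" "matrix_resolution Z A dg r I"
      "\<forall>i. \<forall>b\<in>Z i. \<forall>b'\<in>Z (Suc i). \<exists>x\<in>carrier (cmod C (Suc i)). A i b' b = \<phi> i (cdiff C i x) b"
    by (rule resolution_matrices[OF I])
  interpret RC: resolution_coords C Z dg \<phi> A by (rule Z(1))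
  have "A i b' b \<in> irrelevant_ideal" if b: "b \<in> Z i" and b': "b' \<in> Z (Suc i)" for i b b'
  proof -
    obtain x where x: "x \<in> carrier (cmod C (Suc i))" "A i b' b = \<phi> i (cdiff C i x) b"
      using Z(3)[THEN spec, THEN bspec, OF b, THEN bspec, OF b'] by (rule bexE)
    have "cdiff C i x \<in> gen_submodule mpoly_ring (cmod C i)
        {a \<odot>\<^bsub>cmod C i\<^esub> y |a y. a \<in> irrelevant_ideal \<and> y \<in> carrier (cmod C i)}"
      using res x(1) unfolding minimal_graded_free_resolution_def by blast
    hence "\<forall>s\<in>Z i. \<phi> i (cdiff C i x) s \<in> irrelevant_ideal"
      unfolding graded_coords.coords_in_ideal[OF RC.coords irrelevant_ideal mod_homD(1)[OF RC.diff_hom x(1)]] .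
    thus ?thesis using b x(2) by simp
  qed
  hence "\<forall>i. \<forall>b\<in>Z i. \<forall>b'\<in>Z (Suc i). A i b' b \<in> irrelevant_ideal" by simp
  thus thesis by (rule that[OF Z(1,2)])
qed

theorem lemma2p2:
  fixes I J :: "('n::finite, 'k::field) mpoly set"
    and F :: "(('n, 'k) mpoly, 'f) graded_complex"
    and G :: "(('n, 'k) mpoly, 'g) graded_complex"
  assumes "graded_ideal mpoly_ring I"
    and "graded_ideal mpoly_ring J"
    and "I \<inter> J = I \<cdot>\<^bsub>mpoly_ring\<^esub> J"
    and "minimal_graded_free_resolution F (graded_quot mpoly_ring I)"
    and "minimal_graded_free_resolution G (graded_quot mpoly_ring J)"
  shows "minimal_graded_free_resolution (tensor_complex mpoly_ring F G)
    (graded_quot mpoly_ring (I <+>\<^bsub>mpoly_ring\<^esub> J))"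
proof -
  note I = graded_ideal_graded_set[OF assms(1)] and J = graded_ideal_graded_set[OF assms(2)]
  obtain B :: "nat \<Rightarrow> 'f set" and dg \<phi> A r where B: "resolution_coords F B dg \<phi> A" "matrix_resolution B A dg r I"
    "\<forall>i. \<forall>b\<in>B i. \<forall>b'\<in>B (Suc i). A i b' b \<in> irrelevant_ideal"
    by (rule minimal_resolution_matrices[OF I(1) assms(4)])
  obtain C :: "nat \<Rightarrow> 'g set" and dh \<psi> D s where C: "resolution_coords G C dh \<psi> D" "matrix_resolution C D dh s J"
    "\<forall>i. \<forall>b\<in>C i. \<forall>b'\<in>C (Suc i). D i b' b \<in> irrelevant_ideal"
    by (rule minimal_resolution_matrices[OF J(1) assms(5)])
  interpret resolution_pair F B dg \<phi> A r I G C dh \<psi> D s J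
    using B(1,2) C(1,2) J(2) assms(3)
    by (intro resolution_pair.intro two_resolutions.intro two_resolutions_axioms.intro) simp_all
  show ?thesis
    unfolding minimal_graded_free_resolution_def
  proof (intro conjI allI tensor_resolution tensor_minimal[OF irrelevant_ideal])
    show "A i b' b \<in> irrelevant_ideal" if "b \<in> B i" "b' \<in> B (Suc i)" for i b b'
      using B(3) that by blast
    show "D j c' c \<in> irrelevant_ideal" if "c \<in> C j" "c' \<in> C (Suc j)" for j c c'
      using C(3) that by blast
  qed
qed

end
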